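(* Let $(\kappa,G)$ be a chain digraph with $G=(V,E)$, $V=\{v_1,\dots,v_m\}$, $E\neq\emptyset$, and let $k=\max\kappa$. Then the Lie algebra $\mathfrak{g}(\kappa,G)$ is $k$-step nilpotent. A basis of $\mathfrak{g}(\kappa,G)$ is $$B_1\cup\bigcup_{l=2}^{k}B_l^\kappa,\qquad B_1=\{v_1,\dots,v_m\},\qquad B_l^\kappa=\{w_{i,j}^l:\ (v_i,v_j)\in E \text{ and } l\le \kappa_{i,j}\}.$$ The Lie bracket of $\mathfrak{g}(\kappa,G)$ is determined by the nonzero brackets (of basis elements) $$[w_{i,j}^l,v_j]=w_{i,j}^{l+1},\qquad \text{if } (v_i,v_j)\in E \text{ and } 1\le l\le \kappa_{i,j}-1,$$ (all brackets of basis elements not obtained from these by skew-symmetry being zero). Moreover, $\mathfrak{g}(\kappa,G)$ is a naturally graded Lie algebra, and a Carnot grading is $$\mathfrak{g}(\kappa,G)=\langle B_1\rangle\oplus\langle B_2^\kappa\rangle\oplus\cdots\oplus\langle B_k^\kappa\rangle.$$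
   Context: All Lie algebras are finite-dimensional over a field $\mathbb{K}$ of characteristic zero. The lower central series is $\mathfrak g^1=\mathfrak g$, $\mathfrak g^{i+1}=[\mathfrak g,\mathfrak g^i]$; $\mathfrak g$ is $k$-step nilpotent if $\mathfrak g^{k+1}=0$ and $\mathfrak g^k\neq0$. It is naturally graded if it is isomorphic to its associated graded Lie algebra $\mathrm{gr}(\mathfrak g)=\bigoplus_{i\ge1}\mathfrak g^i/\mathfrak g^{i+1}$ (with the induced bracket). A Carnot grading is a decomposition $\mathfrak g=V_1\oplus\dots\oplus V_k$ with $[V_i,V_j]\subseteq V_{i+j}$ and $\mathfrak g^i=V_i\oplus\dots\oplus V_k$ for all $i$. $\langle\cdot\rangle$ denotes linear span. A digraph is a pair $G=(V,E)$ with $V=\{v_1,\dots,v_m\}$ finite, $E\subseteq V\times V$, such that $(u,v)\in E$ implies $(v,u)\notin E$ (in particular no loops). A chain digraph is a pair $(\kappa,G)$ with $G=(V,E)$ a digraph and $\kappa:E\to\mathbb{N}_{\ge2}$ a function; $\kappa_{i,j}=\kappa((v_i,v_j))$ and $k$ is the maximum value of $\kappa$. Let $L_{(k)}(m)$ be the free $k$-step nilpotent Lie algebra on $v_1,\dots,v_m$ and $\mathfrak g(k,G)=L_{(k)}(m)/I$, where $I$ is the ideal generated by all $[v_i,v_j]$ such that neither $(v_i,v_j)$ nor $(v_j,v_i)$ is in $E$. Since $I$ is generated by multihomogeneous elements, $\mathfrak g(k,G)$ is graded by $\mathbb{Z}_{\ge0}^m$ with $v_i$ in multidegree $e_i$ (the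 $i$-th standard vector); $V_d$ denotes the sum of the components of total degree $d$, so $\mathfrak g(k,G)=V_1\oplus\dots\oplus V_k$. For $(v_i,v_j)\in E$ and $1\le c\le k$, let $I_{i,j}^{c}$ be the sum of all multihomogeneous components of $\mathfrak g(k,G)$ whose multidegree is not in $\{e_j\}\cup\{e_i+(l-1)e_j:1\le l\le c\}$; it is an ideal. Put $$I_\kappa=\Big(\bigcap_{(v_i,v_j)\in E}I_{i,j}^{\kappa_{i,j}}\Big)\cap(V_3\oplus\dots\oplus V_k),\qquad \mathfrak g(\kappa,G)=\mathfrak g(k,G)/I_\kappa.$$ For $(v_i,v_j)\in E$ define $w_{i,j}^1=v_i$, $w_{i,j}^2=[v_i,v_j]$, $w_{i,j}^l=[w_{i,j}^{l-1},v_j]$ for $l\ge3$; the same symbols denote the images in $\mathfrak g(\kappa,G)$. *)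

theory Defs
  imports "HOL-Algebra.AbelCoset" "Jordan_Normal_Form.Missing_VectorSpace"
begin

section \<open>Lie algebras\<close>

text \<open>
  A vector space with a product is encoded as a \<^typ>\<open>('a, 'b) module\<close> over a field structure with an
  additional field for the product.  The components \<^const>\<open>mult\<close> and \<^const>\<open>one\<close> inherited from the
  library record play no role.
\<close>

record ('a, 'b) bracket_algebra = "('a, 'b) module" +
  bracket :: "'b \<Rightarrow> 'b \<Rightarrow> 'b" (\<open>\<lbrakk>_,_\<rbrakk>\<index>\<close>)

locale lie_algebra = vectorspace K L
  for K (structure) and L :: "('a, 'b, 'm) bracket_algebra_scheme" (structure) +
  assumes bracket_closed:
      "x \<in> carrier L \<Longrightarrow> y \<in> carrier L \<Longrightarrow> \<lbrakk>x,y\<rbrakk>\<^bsub>L\<^esub> \<in> carrier L"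
    and bracket_add_left:
      "x \<in> carrier L \<Longrightarrow> y \<in> carrier L \<Longrightarrow> z \<in> carrier L \<Longrightarrow>
        \<lbrakk>x \<oplus>\<^bsub>L\<^esub> y, z\<rbrakk>\<^bsub>L\<^esub> = \<lbrakk>x,z\<rbrakk>\<^bsub>L\<^esub> \<oplus>\<^bsub>L\<^esub> \<lbrakk>y,z\<rbrakk>\<^bsub>L\<^esub>"
    and bracket_add_right:
      "x \<in> carrier L \<Longrightarrow> y \<in> carrier L \<Longrightarrow> z \<in> carrier L \<Longrightarrow>
        \<lbrakk>x, y \<oplus>\<^bsub>L\<^esub> z\<rbrakk>\<^bsub>L\<^esub> = \<lbrakk>x,y\<rbrakk>\<^bsub>L\<^esub> \<oplus>\<^bsub>L\<^esub> \<lbrakk>x,z\<rbrakk>\<^bsub>L\<^esub>"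
    and bracket_smult_left:
      "a \<in> carrier K \<Longrightarrow> x \<in> carrier L \<Longrightarrow> y \<in> carrier L \<Longrightarrow>
        \<lbrakk>a \<odot>\<^bsub>L\<^esub> x, y\<rbrakk>\<^bsub>L\<^esub> = a \<odot>\<^bsub>L\<^esub> \<lbrakk>x,y\<rbrakk>\<^bsub>L\<^esub>"
    and bracket_smult_right:
      "a \<in> carrier K \<Longrightarrow> x \<in> carrier L \<Longrightarrow> y \<in> carrier L \<Longrightarrow>
        \<lbrakk>x, a \<odot>\<^bsub>L\<^esub> y\<rbrakk>\<^bsub>L\<^esub> = a \<odot>\<^bsub>L\<^esub> \<lbrakk>x,y\<rbrakk>\<^bsub>L\<^esub>"
    and bracket_self:
      "x \<in> carrier L \<Longrightarrow> \<lbrakk>x,x\<rbrakk>\<^bsub>L\<^esub> = \<zero>\<^bsub>L\<^esub>"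
    and jacobi:
      "x \<in> carrier L \<Longrightarrow> y \<in> carrier L \<Longrightarrow> z \<in> carrier L \<Longrightarrow>
        \<lbrakk>x, \<lbrakk>y,z\<rbrakk>\<^bsub>L\<^esub>\<rbrakk>\<^bsub>L\<^esub> \<oplus>\<^bsub>L\<^esub> \<lbrakk>y, \<lbrakk>z,x\<rbrakk>\<^bsub>L\<^esub>\<rbrakk>\<^bsub>L\<^esub> \<oplus>\<^bsub>L\<^esub> \<lbrakk>z, \<lbrakk>x,y\<rbrakk>\<^bsub>L\<^esub>\<rbrakk>\<^bsub>L\<^esub> = \<zero>\<^bsub>L\<^esub>"

text \<open>Both-sided, since ideals of non-associative algebras that are not yet Lie are needed below.\<close>

definition lie_ideal ::
  "('a, 'k) ring_scheme \<Rightarrow> ('a, 'b, 'm) bracket_algebra_scheme \<Rightarrow> 'b set \<Rightarrow> bool" where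
  "lie_ideal K L I \<longleftrightarrow> subspace K I L \<and>
     (\<forall>x\<in>carrier L. \<forall>y\<in>I. \<lbrakk>x,y\<rbrakk>\<^bsub>L\<^esub> \<in> I \<and> \<lbrakk>y,x\<rbrakk>\<^bsub>L\<^esub> \<in> I)"

definition ideal_generated ::
  "('a, 'k) ring_scheme \<Rightarrow> ('a, 'b, 'm) bracket_algebra_scheme \<Rightarrow> 'b set \<Rightarrow> 'b set" where
  "ideal_generated K L S = \<Inter>{I. lie_ideal K L I \<and> S \<subseteq> I}"

definition coset_smult ::
  "('a, 'b, 'm) bracket_algebra_scheme \<Rightarrow> 'b set \<Rightarrow> 'a \<Rightarrow> 'b set \<Rightarrow> 'b set" where
  "coset_smult L I a X = (\<Union>x\<in>X. I +>\<^bsub>L\<^esub> (a \<odot>\<^bsub>L\<^esub> x))"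

definition coset_bracket ::
  "('a, 'b, 'm) bracket_algebra_scheme \<Rightarrow> 'b set \<Rightarrow> 'b set \<Rightarrow> 'b set \<Rightarrow> 'b set" where
  "coset_bracket L I X Y = (\<Union>x\<in>X. \<Union>y\<in>Y. I +>\<^bsub>L\<^esub> \<lbrakk>x,y\<rbrakk>\<^bsub>L\<^esub>)"

definition lie_quot ::
  "('a, 'b, 'm) bracket_algebra_scheme \<Rightarrow> 'b set \<Rightarrow> ('a, 'b set) bracket_algebra" where
  "lie_quot L I =
     \<lparr>carrier = a_rcosets\<^bsub>L\<^esub> I, mult = (\<lambda>X Y. I), one = I, zero = I, add = set_add L,
      smult = coset_smult L I, bracket = coset_bracket L I\<rparr>"

definition lie_iso ::
  "('a, 'k) ring_scheme \<Rightarrow> ('a, 'b, 'm) bracket_algebra_scheme \<Rightarrow>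
     ('a, 'c, 'n) bracket_algebra_scheme \<Rightarrow> ('b \<Rightarrow> 'c) \<Rightarrow> bool" where
  "lie_iso K L M \<phi> \<longleftrightarrow> \<phi> \<in> module_hom K L M \<and> bij_betw \<phi> (carrier L) (carrier M) \<and>
     (\<forall>x\<in>carrier L. \<forall>y\<in>carrier L. \<phi> \<lbrakk>x,y\<rbrakk>\<^bsub>L\<^esub> = \<lbrakk>\<phi> x, \<phi> y\<rbrakk>\<^bsub>M\<^esub>)"


section \<open>Lower central series and gradings\<close>

abbreviation lspan ::
  "('a, 'k) ring_scheme \<Rightarrow> ('a, 'b, 'm) module_scheme \<Rightarrow> 'b set \<Rightarrow> 'b set" where
  "lspan \<equiv> LinearCombinations.module.span"

definition bracket_space ::
  "('a, 'k) ring_scheme \<Rightarrow> ('a, 'b, 'm) bracket_algebra_scheme \<Rightarrow> 'b set \<Rightarrow> 'b set \<Rightarrow> 'b set" where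
  "bracket_space K L A B = lspan K L {\<lbrakk>x,y\<rbrakk>\<^bsub>L\<^esub> |x y. x \<in> A \<and> y \<in> B}"

text \<open>The numbering starts at 1; the value at 0 is never used.\<close>

fun lcs ::
  "('a, 'k) ring_scheme \<Rightarrow> ('a, 'b, 'm) bracket_algebra_scheme \<Rightarrow> nat \<Rightarrow> 'b set" where
  "lcs K L 0 = carrier L"
| "lcs K L (Suc 0) = carrier L"
| "lcs K L (Suc (Suc i)) = bracket_space K L (carrier L) (lcs K L (Suc i))"

definition step_nilpotent ::
  "('a, 'k) ring_scheme \<Rightarrow> ('a, 'b, 'm) bracket_algebra_scheme \<Rightarrow> nat \<Rightarrow> bool" where
  "step_nilpotent K L k \<longleftrightarrow> lcs K L (k + 1) = {\<zero>\<^bsub>L\<^esub>} \<and> lcs K L k \<noteq> {\<zero>\<^bsub>L\<^esub>}"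

text \<open>
  The associated graded algebra.  An element is a family, indexed by \<open>i \<ge> 1\<close>, of cosets
  \<open>f i \<in> \<gg>\<^sup>i / \<gg>\<^sup>i\<^sup>+\<^sup>1\<close>, almost all of them zero.  The component of degree \<open>n\<close> of a bracket is
  the sum of the \<open>[f i, h (n - i)]\<close>, formed in \<open>\<gg> / \<gg>\<^sup>n\<^sup>+\<^sup>1\<close>.
\<close>

definition gr ::
  "('a, 'k) ring_scheme \<Rightarrow> ('a, 'b, 'm) bracket_algebra_scheme \<Rightarrow>
     ('a, nat \<Rightarrow> 'b set) bracket_algebra" where
  "gr K L = (let z = (\<lambda>i\<in>{1..}. lcs K L (i + 1)) in
     \<lparr>carrier = {f \<in> (\<Pi>\<^sub>E i\<in>{1..}. {lcs K L (i + 1) +>\<^bsub>L\<^esub> x |x. x \<in> lcs K L i}).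
                  finite {i \<in> {1..}. f i \<noteq> lcs K L (i + 1)}},
      mult = (\<lambda>f h. z), one = z, zero = z,
      add = (\<lambda>f h. \<lambda>i\<in>{1..}. f i <+>\<^bsub>L\<^esub> h i),
      smult = (\<lambda>a f. \<lambda>i\<in>{1..}. coset_smult L (lcs K L (i + 1)) a (f i)),
      bracket = (\<lambda>f h. \<lambda>n\<in>{1..}.
        finsum (lie_quot L (lcs K L (n + 1)))
          (\<lambda>i. coset_bracket L (lcs K L (n + 1)) (f i) (h (n - i))) {1..<n})\<rparr>)"

definition naturally_graded ::
  "('a, 'k) ring_scheme \<Rightarrow> ('a, 'b, 'm) bracket_algebra_scheme \<Rightarrow> bool" where
  "naturally_graded K L \<longleftrightarrow> (\<exists>\<phi>. lie_iso K L (gr K L) \<phi>)"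

definition is_direct_sum ::
  "('a, 'k) ring_scheme \<Rightarrow> ('a, 'b, 'm) module_scheme \<Rightarrow> 'b set \<Rightarrow> (nat \<Rightarrow> 'b set) \<Rightarrow> nat set \<Rightarrow> bool"
  where
  "is_direct_sum K M D W J \<longleftrightarrow> (\<forall>i\<in>J. subspace K (W i) M) \<and>
     bij_betw (\<lambda>x. finsum M x J) (\<Pi>\<^sub>E i\<in>J. W i) D"

text \<open>By convention \<open>V\<^sub>n = 0\<close> for \<open>n > k\<close>.\<close>

definition carnot_grading ::
  "('a, 'k) ring_scheme \<Rightarrow> ('a, 'b, 'm) bracket_algebra_scheme \<Rightarrow> nat \<Rightarrow> (nat \<Rightarrow> 'b set) \<Rightarrow> bool" where
  "carnot_grading K L k W \<longleftrightarrow>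
     is_direct_sum K L (carrier L) W {1..k} \<and>
     (\<forall>i\<in>{1..k}. \<forall>j\<in>{1..k}.
        bracket_space K L (W i) (W j) \<subseteq> (if i + j \<le> k then W (i + j) else {\<zero>\<^bsub>L\<^esub>})) \<and>
     (\<forall>i\<ge>1. is_direct_sum K L (lcs K L i) W {i..k})"


section \<open>Free nilpotent Lie algebras\<close>

datatype (vars: 'v) monomial = Var 'v | Prod "'v monomial" "'v monomial"

text \<open>The free non-associative algebra on \<open>V\<close>: finite linear combinations of bracketed words.\<close>

definition free_algebra ::
  "('a, 'k) ring_scheme \<Rightarrow> 'v set \<Rightarrow> ('a, 'v monomial \<Rightarrow> 'a) bracket_algebra" where
  "free_algebra K V =
     \<lparr>carrier = {f. range f \<subseteq> carrier K \<and> finite {t. f t \<noteq> \<zero>\<^bsub>K\<^esub>} \<and>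
                    (\<forall>t. f t \<noteq> \<zero>\<^bsub>K\<^esub> \<longrightarrow> vars t \<subseteq> V)},
      mult = (\<lambda>f g t. \<zero>\<^bsub>K\<^esub>), one = (\<lambda>t. \<zero>\<^bsub>K\<^esub>), zero = (\<lambda>t. \<zero>\<^bsub>K\<^esub>),
      add = (\<lambda>f g t. f t \<oplus>\<^bsub>K\<^esub> g t),
      smult = (\<lambda>a f t. a \<otimes>\<^bsub>K\<^esub> f t),
      bracket = (\<lambda>f g t. case t of Var v \<Rightarrow> \<zero>\<^bsub>K\<^esub> | Prod s u \<Rightarrow> f s \<otimes>\<^bsub>K\<^esub> g u)\<rparr>"

definition free_algebra_gen :: "('a, 'k) ring_scheme \<Rightarrow> 'v \<Rightarrow> 'v monomial \<Rightarrow> 'a" where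
  "free_algebra_gen K v = (\<lambda>t. if t = Var v then \<one>\<^bsub>K\<^esub> else \<zero>\<^bsub>K\<^esub>)"

definition lie_relations :: "('a, 'b, 'm) bracket_algebra_scheme \<Rightarrow> 'b set" where
  "lie_relations A = {\<lbrakk>x,x\<rbrakk>\<^bsub>A\<^esub> |x. x \<in> carrier A} \<union>
     {\<lbrakk>x, \<lbrakk>y,z\<rbrakk>\<^bsub>A\<^esub>\<rbrakk>\<^bsub>A\<^esub> \<oplus>\<^bsub>A\<^esub> \<lbrakk>y, \<lbrakk>z,x\<rbrakk>\<^bsub>A\<^esub>\<rbrakk>\<^bsub>A\<^esub> \<oplus>\<^bsub>A\<^esub> \<lbrakk>z, \<lbrakk>x,y\<rbrakk>\<^bsub>A\<^esub>\<rbrakk>\<^bsub>A\<^esub>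
        |x y z. x \<in> carrier A \<and> y \<in> carrier A \<and> z \<in> carrier A}"

definition free_lie_ideal :: "('a, 'k) ring_scheme \<Rightarrow> 'v set \<Rightarrow> ('v monomial \<Rightarrow> 'a) set" where
  "free_lie_ideal K V = ideal_generated K (free_algebra K V) (lie_relations (free_algebra K V))"

definition free_lie ::
  "('a, 'k) ring_scheme \<Rightarrow> 'v set \<Rightarrow> ('a, ('v monomial \<Rightarrow> 'a) set) bracket_algebra" where
  "free_lie K V = lie_quot (free_algebra K V) (free_lie_ideal K V)"

definition free_lie_gen :: "('a, 'k) ring_scheme \<Rightarrow> 'v set \<Rightarrow> 'v \<Rightarrow> ('v monomial \<Rightarrow> 'a) set" where
  "free_lie_gen K V v = free_lie_ideal K V +>\<^bsub>free_algebra K V\<^esub> free_algebra_gen K v"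

definition free_nilpotent ::
  "('a, 'k) ring_scheme \<Rightarrow> nat \<Rightarrow> 'v set \<Rightarrow> ('a, ('v monomial \<Rightarrow> 'a) set set) bracket_algebra" where
  "free_nilpotent K k V = lie_quot (free_lie K V) (lcs K (free_lie K V) (k + 1))"

definition free_nilpotent_gen ::
  "('a, 'k) ring_scheme \<Rightarrow> nat \<Rightarrow> 'v set \<Rightarrow> 'v \<Rightarrow> ('v monomial \<Rightarrow> 'a) set set" where
  "free_nilpotent_gen K k V v = lcs K (free_lie K V) (k + 1) +>\<^bsub>free_lie K V\<^esub> free_lie_gen K V v"


section \<open>The Lie algebra of a digraph\<close>

locale digraph =
  fixes V :: "'v set" and E :: "('v \<times> 'v) set"
  assumes finite_vertices: "finite V"
    and edges: "E \<subseteq> V \<times> V"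
    and oriented: "(u, v) \<in> E \<Longrightarrow> (v, u) \<notin> E"

locale chain_digraph = digraph V E
  for V :: "'v set" and E :: "('v \<times> 'v) set" +
  fixes \<kappa> :: "'v \<times> 'v \<Rightarrow> nat"
  assumes kappa_ge_2: "e \<in> E \<Longrightarrow> 2 \<le> \<kappa> e"

definition graph_ideal ::
  "('a, 'k) ring_scheme \<Rightarrow> nat \<Rightarrow> 'v set \<Rightarrow> ('v \<times> 'v) set \<Rightarrow> ('v monomial \<Rightarrow> 'a) set set set" where
  "graph_ideal K k V E = ideal_generated K (free_nilpotent K k V)
     {\<lbrakk>free_nilpotent_gen K k V u, free_nilpotent_gen K k V v\<rbrakk>\<^bsub>free_nilpotent K k V\<^esub>
        |u v. u \<in> V \<and> v \<in> V \<and> (u, v) \<notin> E \<and> (v, u) \<notin> E}"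

definition graph_lie ::
  "('a, 'k) ring_scheme \<Rightarrow> nat \<Rightarrow> 'v set \<Rightarrow> ('v \<times> 'v) set \<Rightarrow>
     ('a, ('v monomial \<Rightarrow> 'a) set set set) bracket_algebra" where
  "graph_lie K k V E = lie_quot (free_nilpotent K k V) (graph_ideal K k V E)"

definition graph_gen ::
  "('a, 'k) ring_scheme \<Rightarrow> nat \<Rightarrow> 'v set \<Rightarrow> ('v \<times> 'v) set \<Rightarrow> 'v \<Rightarrow> ('v monomial \<Rightarrow> 'a) set set set" where
  "graph_gen K k V E v = graph_ideal K k V E +>\<^bsub>free_nilpotent K k V\<^esub> free_nilpotent_gen K k V v"

definition unit_deg :: "'v \<Rightarrow> 'v \<Rightarrow> nat" where
  "unit_deg v = (\<lambda>u. if u = v then 1 else 0)"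

primrec multideg :: "'v monomial \<Rightarrow> 'v \<Rightarrow> nat" where
  "multideg (Var v) = unit_deg v"
| "multideg (Prod s t) = (\<lambda>u. multideg s u + multideg t u)"

primrec eval_monomial ::
  "('a, 'b, 'm) bracket_algebra_scheme \<Rightarrow> ('v \<Rightarrow> 'b) \<Rightarrow> 'v monomial \<Rightarrow> 'b" where
  "eval_monomial L g (Var v) = g v"
| "eval_monomial L g (Prod s t) = \<lbrakk>eval_monomial L g s, eval_monomial L g t\<rbrakk>\<^bsub>L\<^esub>"

text \<open>
  The component of multidegree \<open>d\<close> of the grading induced from the free algebra, in which \<open>v\<close> has
  degree \<^term>\<open>unit_deg v\<close>: the image of the span of the monomials of multidegree \<open>d\<close>.
\<close>

definition multi_component ::
  "('a, 'k) ring_scheme \<Rightarrow> nat \<Rightarrow> 'v set \<Rightarrow> ('v \<times> 'v) set \<Rightarrow> ('v \<Rightarrow> nat) \<Rightarrow>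
     ('v monomial \<Rightarrow> 'a) set set set set" where
  "multi_component K k V E d = lspan K (graph_lie K k V E)
     {eval_monomial (graph_lie K k V E) (graph_gen K k V E) t |t. vars t \<subseteq> V \<and> multideg t = d}"

definition multidegs :: "'v set \<Rightarrow> ('v \<Rightarrow> nat) set" where
  "multidegs V = {d. \<forall>u. u \<notin> V \<longrightarrow> d u = 0}"

definition sum_components ::
  "('a, 'k) ring_scheme \<Rightarrow> nat \<Rightarrow> 'v set \<Rightarrow> ('v \<times> 'v) set \<Rightarrow> ('v \<Rightarrow> nat) set \<Rightarrow>
     ('v monomial \<Rightarrow> 'a) set set set set" where
  "sum_components K k V E \<D> = lspan K (graph_lie K k V E) (\<Union>d\<in>\<D>. multi_component K k V E d)"

definition total_component ::
  "('a, 'k) ring_scheme \<Rightarrow> nat \<Rightarrow> 'v set \<Rightarrow> ('v \<times> 'v) set \<Rightarrow> nat \<Rightarrow>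
     ('v monomial \<Rightarrow> 'a) set set set set" where
  "total_component K k V E n = sum_components K k V E {d \<in> multidegs V. (\<Sum>u\<in>V. d u) = n}"

definition edge_ideal ::
  "('a, 'k) ring_scheme \<Rightarrow> nat \<Rightarrow> 'v set \<Rightarrow> ('v \<times> 'v) set \<Rightarrow> 'v \<Rightarrow> 'v \<Rightarrow> nat \<Rightarrow>
     ('v monomial \<Rightarrow> 'a) set set set set" where
  "edge_ideal K k V E i j c = sum_components K k V E
     (multidegs V - ({unit_deg j} \<union>
        {(\<lambda>u. unit_deg i u + (l - 1) * unit_deg j u) |l. 1 \<le> l \<and> l \<le> c}))"


section \<open>The Lie algebra of a chain digraph\<close>

definition chain_step :: "('v \<times> 'v) set \<Rightarrow> ('v \<times> 'v \<Rightarrow> nat) \<Rightarrow> nat" where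
  "chain_step E \<kappa> = Max (\<kappa> ` E)"

definition chain_ideal ::
  "('a, 'k) ring_scheme \<Rightarrow> 'v set \<Rightarrow> ('v \<times> 'v) set \<Rightarrow> ('v \<times> 'v \<Rightarrow> nat) \<Rightarrow>
     ('v monomial \<Rightarrow> 'a) set set set set" where
  "chain_ideal K V E \<kappa> = (let k = chain_step E \<kappa> in
     (\<Inter>(i, j)\<in>E. edge_ideal K k V E i j (\<kappa> (i, j))) \<inter>
     lspan K (graph_lie K k V E) (\<Union>n\<in>{3..k}. total_component K k V E n))"

definition chain_lie ::
  "('a, 'k) ring_scheme \<Rightarrow> 'v set \<Rightarrow> ('v \<times> 'v) set \<Rightarrow> ('v \<times> 'v \<Rightarrow> nat) \<Rightarrow>
     ('a, ('v monomial \<Rightarrow> 'a) set set set set) bracket_algebra" where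
  "chain_lie K V E \<kappa> = lie_quot (graph_lie K (chain_step E \<kappa>) V E) (chain_ideal K V E \<kappa>)"

definition chain_gen ::
  "('a, 'k) ring_scheme \<Rightarrow> 'v set \<Rightarrow> ('v \<times> 'v) set \<Rightarrow> ('v \<times> 'v \<Rightarrow> nat) \<Rightarrow> 'v \<Rightarrow>
     ('v monomial \<Rightarrow> 'a) set set set set" where
  "chain_gen K V E \<kappa> v =
     chain_ideal K V E \<kappa> +>\<^bsub>graph_lie K (chain_step E \<kappa>) V E\<^esub> graph_gen K (chain_step E \<kappa>) V E v"

text \<open>
  \<open>iter_bracket L x y l\<close> is \<open>[\<dots>[[x, y], y]\<dots>, y]\<close> with \<open>l - 1\<close> occurrences of \<open>y\<close>; the value at
  \<open>l = 0\<close> is never used.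
\<close>

fun iter_bracket :: "('a, 'b, 'm) bracket_algebra_scheme \<Rightarrow> 'b \<Rightarrow> 'b \<Rightarrow> nat \<Rightarrow> 'b" where
  "iter_bracket L x y 0 = \<zero>\<^bsub>L\<^esub>"
| "iter_bracket L x y (Suc 0) = x"
| "iter_bracket L x y (Suc (Suc l)) = \<lbrakk>iter_bracket L x y (Suc l), y\<rbrakk>\<^bsub>L\<^esub>"

definition chain_word ::
  "('a, 'k) ring_scheme \<Rightarrow> 'v set \<Rightarrow> ('v \<times> 'v) set \<Rightarrow> ('v \<times> 'v \<Rightarrow> nat) \<Rightarrow> 'v \<Rightarrow> 'v \<Rightarrow> nat \<Rightarrow>
     ('v monomial \<Rightarrow> 'a) set set set set" where
  "chain_word K V E \<kappa> i j l =
     iter_bracket (chain_lie K V E \<kappa>) (chain_gen K V E \<kappa> i) (chain_gen K V E \<kappa> j) l"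

definition chain_basis ::
  "('a, 'k) ring_scheme \<Rightarrow> 'v set \<Rightarrow> ('v \<times> 'v) set \<Rightarrow> ('v \<times> 'v \<Rightarrow> nat) \<Rightarrow> nat \<Rightarrow>
     ('v monomial \<Rightarrow> 'a) set set set set set" where
  "chain_basis K V E \<kappa> l = (if l = 1 then chain_gen K V E \<kappa> ` V
     else {chain_word K V E \<kappa> i j l |i j. (i, j) \<in> E \<and> l \<le> \<kappa> (i, j)})"

end

theory Submission
  imports Defs
begin

text \<open>
  The \<open>v\<^sub>i\<close> and the \<open>w\<^sub>i\<^sub>j\<^sup>l\<close> span the chain algebra because every monomial can be rewritten
  into a multiple of one of them; that they are independent needs a model.  Take as coordinates the
  left-normed combs \<open>comb i j n = [\<dots>[[v\<^sub>i, v\<^sub>j], v\<^sub>j]\<dots>, v\<^sub>j]\<close> with \<open>n\<close> brackets, for \<open>n = 0\<close> or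
  \<open>(i, j) \<in> E\<close> and \<open>n < \<kappa>\<^sub>i\<^sub>j\<close>, and let \<open>comb_algebra\<close> be the space of functions on this finite
  set \<open>T\<close> of monomials with the bracket \<open>[f, g](Prod s u) = f(s) g(u) - f(u) g(s)\<close>, zero at
  variables.  It is bilinear and alternating by definition, and the Jacobi identity is a computation
  at a single comb (\<open>comb_algebra_lie\<close>).

  A homomorphism from the free non-associative algebra to this model is given by a recursion along
  combs (\<open>comb_coeff_hom\<close>), so that no sum over monomials ever has to be rearranged.  Because the
  model is a Lie algebra, is nilpotent of step \<open>k\<close> and has \<open>[v\<^sub>i, v\<^sub>j] = 0\<close> for a non-edge, the
  homomorphism factors through the free Lie algebra, the free nilpotent one and the graph algebra
  (\<open>graph_lie_hom_model\<close>).

  The heart of the proof is that the ideal \<open>I\<^sub>\<kappa>\<close> is exactly the kernel of the resulting map on the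
  graph algebra (\<open>chain_ideal_eq_kernel\<close>).  The map respects multidegrees, and \<open>I\<^sub>\<kappa>\<close> lives in
  multidegrees in which the model is zero; so \<open>I\<^sub>\<kappa>\<close> is killed.  Conversely a monomial evaluated in
  the graph algebra either lies in \<open>I\<^sub>\<kappa>\<close> or is a multiple of a comb in \<open>T\<close>
  (\<open>graph_eval_cases\<close>), because a Lie monomial that is linear in \<open>v\<^sub>i\<close> and otherwise contains only
  \<open>v\<^sub>j\<close> is a multiple of a comb.  Being a kernel, \<open>I\<^sub>\<kappa>\<close> is an ideal, and the chain algebra is
  isomorphic to the model, the \<open>v\<^sub>i\<close> and \<open>w\<^sub>i\<^sub>j\<^sup>l\<close> corresponding to the indicator functions of the
  combs (\<open>chain_lie_coordinates\<close>).

  Everything else is read off in these coordinates (locale \<open>comb_coordinates\<close>): spans, the lower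
  central series and direct sums become conditions on the support of the coordinate function.  That
  the algebra is naturally graded follows from its Carnot grading, by a general argument
  (\<open>carnot_grading_naturally_graded\<close>).
\<close>

section \<open>Algebras with a bilinear bracket\<close>

lemma eval_monomial_cong:
  "(\<And>v. v \<in> vars t \<Longrightarrow> g v = h v) \<Longrightarrow> eval_monomial A g t = eval_monomial A h t"
  by (induction t) auto

text \<open>
  The free algebra is not a Lie algebra, but its quotients, ideals and homomorphisms have to be
  handled in the same way; so this part of the theory is done without the Jacobi identity.
\<close>
locale bilinear_algebra = vectorspace K A
  for K (structure) and A :: "('a, 'b, 'm) bracket_algebra_scheme" (structure) +
  assumes br_closed:
      "x \<in> carrier A \<Longrightarrow> y \<in> carrier A \<Longrightarrow> \<lbrakk>x,y\<rbrakk>\<^bsub>A\<^esub> \<in> carrier A"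
    and br_add_left:
      "x \<in> carrier A \<Longrightarrow> y \<in> carrier A \<Longrightarrow> z \<in> carrier A \<Longrightarrow>
        \<lbrakk>x \<oplus>\<^bsub>A\<^esub> y, z\<rbrakk>\<^bsub>A\<^esub> = \<lbrakk>x,z\<rbrakk>\<^bsub>A\<^esub> \<oplus>\<^bsub>A\<^esub> \<lbrakk>y,z\<rbrakk>\<^bsub>A\<^esub>"
    and br_add_right:
      "x \<in> carrier A \<Longrightarrow> y \<in> carrier A \<Longrightarrow> z \<in> carrier A \<Longrightarrow>
        \<lbrakk>x, y \<oplus>\<^bsub>A\<^esub> z\<rbrakk>\<^bsub>A\<^esub> = \<lbrakk>x,y\<rbrakk>\<^bsub>A\<^esub> \<oplus>\<^bsub>A\<^esub> \<lbrakk>x,z\<rbrakk>\<^bsub>A\<^esub>"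
    and br_smult_left:
      "a \<in> carrier K \<Longrightarrow> x \<in> carrier A \<Longrightarrow> y \<in> carrier A \<Longrightarrow>
        \<lbrakk>a \<odot>\<^bsub>A\<^esub> x, y\<rbrakk>\<^bsub>A\<^esub> = a \<odot>\<^bsub>A\<^esub> \<lbrakk>x,y\<rbrakk>\<^bsub>A\<^esub>"
    and br_smult_right:
      "a \<in> carrier K \<Longrightarrow> x \<in> carrier A \<Longrightarrow> y \<in> carrier A \<Longrightarrow>
        \<lbrakk>x, a \<odot>\<^bsub>A\<^esub> y\<rbrakk>\<^bsub>A\<^esub> = a \<odot>\<^bsub>A\<^esub> \<lbrakk>x,y\<rbrakk>\<^bsub>A\<^esub>"

sublocale lie_algebra \<subseteq> bilinear_algebra K L
  by unfold_locales
    (auto simp: bracket_closed bracket_add_left bracket_add_right bracket_smult_left bracket_smult_right)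

context bilinear_algebra
begin

lemma subspaceI:
  assumes "W \<subseteq> carrier A" "\<zero>\<^bsub>A\<^esub> \<in> W" "\<And>x y. x \<in> W \<Longrightarrow> y \<in> W \<Longrightarrow> x \<oplus>\<^bsub>A\<^esub> y \<in> W"
    "\<And>a x. a \<in> carrier K \<Longrightarrow> x \<in> W \<Longrightarrow> a \<odot>\<^bsub>A\<^esub> x \<in> W"
  shows "subspace K W A"
  using assms vectorspace_axioms module_axioms
  by (auto simp: subspace_def submodule_def)

lemma subspaceD:
  assumes "subspace K W A"
  shows "W \<subseteq> carrier A" "\<zero>\<^bsub>A\<^esub> \<in> W" "x \<in> W \<Longrightarrow> y \<in> W \<Longrightarrow> x \<oplus>\<^bsub>A\<^esub> y \<in> W"
    "a \<in> carrier K \<Longrightarrow> x \<in> W \<Longrightarrow> a \<odot>\<^bsub>A\<^esub> x \<in> W"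
    "x \<in> W \<Longrightarrow> \<ominus>\<^bsub>A\<^esub> x \<in> W" "x \<in> W \<Longrightarrow> y \<in> W \<Longrightarrow> x \<ominus>\<^bsub>A\<^esub> y \<in> W"
proof -
  interpret W: submodule K W A using assms by (simp add: subspace_def)
  show *: "W \<subseteq> carrier A" "\<zero>\<^bsub>A\<^esub> \<in> W" "x \<in> W \<Longrightarrow> y \<in> W \<Longrightarrow> x \<oplus>\<^bsub>A\<^esub> y \<in> W"
    "a \<in> carrier K \<Longrightarrow> x \<in> W \<Longrightarrow> a \<odot>\<^bsub>A\<^esub> x \<in> W" using W.subset by auto
  have neg: "\<ominus>\<^bsub>A\<^esub> u \<in> W" if "u \<in> W" for u
  proof -
    have "\<ominus>\<^bsub>K\<^esub> \<one>\<^bsub>K\<^esub> \<odot>\<^bsub>A\<^esub> u \<in> W"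
      by (rule W.smult_closed) (use that in auto)
    moreover have "\<ominus>\<^bsub>K\<^esub> \<one>\<^bsub>K\<^esub> \<odot>\<^bsub>A\<^esub> u = \<ominus>\<^bsub>A\<^esub> u"
      by (rule smult_minus_1) (use that *(1) in auto)
    ultimately show ?thesis by (rule back_subst)
  qed
  show "x \<in> W \<Longrightarrow> \<ominus>\<^bsub>A\<^esub> x \<in> W" "x \<in> W \<Longrightarrow> y \<in> W \<Longrightarrow> x \<ominus>\<^bsub>A\<^esub> y \<in> W"
    using neg by (auto simp: a_minus_def)
qed

lemma subspace_carrier: "subspace K (carrier A) A"
  by (rule subspaceI) auto

lemma subspace_Inter:
  assumes "\<W> \<noteq> {}" "\<And>W. W \<in> \<W> \<Longrightarrow> subspace K W A"
  shows "subspace K (\<Inter>\<W>) A"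
proof (rule subspaceI)
  note D = subspaceD[OF assms(2)]
  show "\<Inter>\<W> \<subseteq> carrier A" using assms(1) D(1) by auto
  show "\<zero>\<^bsub>A\<^esub> \<in> \<Inter>\<W>" using D(2) by auto
qed (use subspaceD(3,4)[OF assms(2)] in auto)

lemma lspan_subspace: "S \<subseteq> carrier A \<Longrightarrow> subspace K (lspan K A S) A"
  by (rule span_is_subspace)

lemma lspan_least: "S \<subseteq> W \<Longrightarrow> subspace K W A \<Longrightarrow> lspan K A S \<subseteq> W"
  by (rule span_is_subset) (simp_all add: subspace_def)

lemma lspan_superset: "S \<subseteq> carrier A \<Longrightarrow> S \<subseteq> lspan K A S"
  by (rule in_own_span)

lemma br_zero [simp]:
  assumes "x \<in> carrier A"
  shows "\<lbrakk>\<zero>\<^bsub>A\<^esub>, x\<rbrakk>\<^bsub>A\<^esub> = \<zero>\<^bsub>A\<^esub>" "\<lbrakk>x, \<zero>\<^bsub>A\<^esub>\<rbrakk>\<^bsub>A\<^esub> = \<zero>\<^bsub>A\<^esub>"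
  using assms br_smult_left[of "\<zero>\<^bsub>K\<^esub>" x x] br_smult_right[of "\<zero>\<^bsub>K\<^esub>" x x]
  by (simp_all add: lmult_0 br_closed)

lemma br_neg:
  assumes "x \<in> carrier A" "y \<in> carrier A"
  shows "\<lbrakk>\<ominus>\<^bsub>A\<^esub> x, y\<rbrakk>\<^bsub>A\<^esub> = \<ominus>\<^bsub>A\<^esub> \<lbrakk>x, y\<rbrakk>\<^bsub>A\<^esub>" "\<lbrakk>x, \<ominus>\<^bsub>A\<^esub> y\<rbrakk>\<^bsub>A\<^esub> = \<ominus>\<^bsub>A\<^esub> \<lbrakk>x, y\<rbrakk>\<^bsub>A\<^esub>"
proof -
  have m: "\<ominus>\<^bsub>A\<^esub> u = \<ominus>\<^bsub>K\<^esub> \<one>\<^bsub>K\<^esub> \<odot>\<^bsub>A\<^esub> u" if "u \<in> carrier A" for u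
    using smult_minus_1[OF that] by (rule sym)
  have c: "\<ominus>\<^bsub>K\<^esub> \<one>\<^bsub>K\<^esub> \<in> carrier K" by simp
  show "\<lbrakk>\<ominus>\<^bsub>A\<^esub> x, y\<rbrakk>\<^bsub>A\<^esub> = \<ominus>\<^bsub>A\<^esub> \<lbrakk>x, y\<rbrakk>\<^bsub>A\<^esub>"
    unfolding m[OF assms(1)] m[OF br_closed[OF assms]] by (rule br_smult_left[OF c assms])
  show "\<lbrakk>x, \<ominus>\<^bsub>A\<^esub> y\<rbrakk>\<^bsub>A\<^esub> = \<ominus>\<^bsub>A\<^esub> \<lbrakk>x, y\<rbrakk>\<^bsub>A\<^esub>"
    unfolding m[OF assms(2)] m[OF br_closed[OF assms]] by (rule br_smult_right[OF c assms])
qed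

lemma br_finsum_left:
  assumes "finite J" "f \<in> J \<rightarrow> carrier A" "y \<in> carrier A"
  shows "\<lbrakk>finsum A f J, y\<rbrakk>\<^bsub>A\<^esub> = finsum A (\<lambda>i. \<lbrakk>f i, y\<rbrakk>\<^bsub>A\<^esub>) J"
  using assms by induction (auto simp: br_add_left br_closed Pi_def M.finsum_insert)

lemma br_finsum_right:
  assumes "finite J" "f \<in> J \<rightarrow> carrier A" "y \<in> carrier A"
  shows "\<lbrakk>y, finsum A f J\<rbrakk>\<^bsub>A\<^esub> = finsum A (\<lambda>i. \<lbrakk>y, f i\<rbrakk>\<^bsub>A\<^esub>) J"
  using assms by induction (auto simp: br_add_right br_closed Pi_def M.finsum_insert)

lemma eval_monomial_closed:
  "g ` vars t \<subseteq> carrier A \<Longrightarrow> eval_monomial A g t \<in> carrier A"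
  by (induction t) (auto simp: br_closed image_Un)

end

section \<open>Homomorphisms, ideals and quotients\<close>

text \<open>
  Homomorphisms are not required to go between Lie algebras: the quotient maps start at the free
  non-associative algebra.
\<close>
definition lie_hom ::
  "('a, 'k) ring_scheme \<Rightarrow> ('a, 'b, 'm) bracket_algebra_scheme \<Rightarrow>
     ('a, 'c, 'n) bracket_algebra_scheme \<Rightarrow> ('b \<Rightarrow> 'c) \<Rightarrow> bool" where
  "lie_hom K A B \<phi> \<longleftrightarrow> \<phi> \<in> module_hom K A B \<and>
     (\<forall>x\<in>carrier A. \<forall>y\<in>carrier A. \<phi> \<lbrakk>x,y\<rbrakk>\<^bsub>A\<^esub> = \<lbrakk>\<phi> x, \<phi> y\<rbrakk>\<^bsub>B\<^esub>)"

lemma lie_homI: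
  assumes "\<And>x. x \<in> carrier A \<Longrightarrow> \<phi> x \<in> carrier B"
    "\<And>x y. x \<in> carrier A \<Longrightarrow> y \<in> carrier A \<Longrightarrow> \<phi> (x \<oplus>\<^bsub>A\<^esub> y) = \<phi> x \<oplus>\<^bsub>B\<^esub> \<phi> y"
    "\<And>a x. a \<in> carrier K \<Longrightarrow> x \<in> carrier A \<Longrightarrow> \<phi> (a \<odot>\<^bsub>A\<^esub> x) = a \<odot>\<^bsub>B\<^esub> \<phi> x"
    "\<And>x y. x \<in> carrier A \<Longrightarrow> y \<in> carrier A \<Longrightarrow> \<phi> \<lbrakk>x,y\<rbrakk>\<^bsub>A\<^esub> = \<lbrakk>\<phi> x, \<phi> y\<rbrakk>\<^bsub>B\<^esub>"
  shows "lie_hom K A B \<phi>"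
  using assms unfolding lie_hom_def module_hom_def by auto

lemma lie_homD:
  assumes "lie_hom K A B \<phi>"
  shows "x \<in> carrier A \<Longrightarrow> \<phi> x \<in> carrier B"
    "x \<in> carrier A \<Longrightarrow> y \<in> carrier A \<Longrightarrow> \<phi> (x \<oplus>\<^bsub>A\<^esub> y) = \<phi> x \<oplus>\<^bsub>B\<^esub> \<phi> y"
    "a \<in> carrier K \<Longrightarrow> x \<in> carrier A \<Longrightarrow> \<phi> (a \<odot>\<^bsub>A\<^esub> x) = a \<odot>\<^bsub>B\<^esub> \<phi> x"
    "x \<in> carrier A \<Longrightarrow> y \<in> carrier A \<Longrightarrow> \<phi> \<lbrakk>x,y\<rbrakk>\<^bsub>A\<^esub> = \<lbrakk>\<phi> x, \<phi> y\<rbrakk>\<^bsub>B\<^esub>"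
    "\<phi> \<in> module_hom K A B"
  using assms unfolding lie_hom_def module_hom_def by auto

lemma module_hom_zero:
  assumes "\<phi> \<in> module_hom K A B" "vectorspace K A" "vectorspace K B"
  shows "\<phi> \<zero>\<^bsub>A\<^esub> = \<zero>\<^bsub>B\<^esub>"
proof -
  interpret A: vectorspace K A by fact
  interpret B: vectorspace K B by fact
  interpret mod_hom K A B \<phi> using assms(1) by unfold_locales
  show ?thesis by simp
qed

lemma module_hom_minus:
  assumes "\<phi> \<in> module_hom K A B" "vectorspace K A" "vectorspace K B" "x \<in> carrier A" "y \<in> carrier A"
  shows "\<phi> (x \<ominus>\<^bsub>A\<^esub> y) = \<phi> x \<ominus>\<^bsub>B\<^esub> \<phi> y"
proof -
  interpret A: vectorspace K A by fact
  interpret B: vectorspace K B by fact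
  interpret mod_hom K A B \<phi> using assms(1) by unfold_locales
  show ?thesis using assms by simp
qed

lemma module_hom_finsum:
  assumes "\<phi> \<in> module_hom K A B" "vectorspace K A" "vectorspace K B" "f \<in> J \<rightarrow> carrier A"
  shows "\<phi> (finsum A f J) = finsum B (\<lambda>i. \<phi> (f i)) J"
proof -
  interpret A: vectorspace K A by fact
  interpret B: vectorspace K B by fact
  interpret mod_hom K A B \<phi> using assms(1) by unfold_locales
  show ?thesis using assms(4)
  proof (induction J rule: infinite_finite_induct)
    case (insert i J)
    then have "f \<in> J \<rightarrow> carrier A" "f i \<in> carrier A"
      "(\<lambda>i. \<phi> (f i)) \<in> J \<rightarrow> carrier B" "\<phi> (f i) \<in> carrier B" by auto
    with insert show ?case by simp
  qed simp_all
qed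

lemma eval_monomial_hom:
  assumes "lie_hom K A B \<phi>" "bilinear_algebra K A" "g ` vars t \<subseteq> carrier A"
  shows "\<phi> (eval_monomial A g t) = eval_monomial B (\<lambda>v. \<phi> (g v)) t"
  using assms(3)
proof (induction t)
  case (Prod s u)
  interpret bilinear_algebra K A by fact
  have "g ` vars s \<subseteq> carrier A" "g ` vars u \<subseteq> carrier A" using Prod.prems by auto
  with Prod.IH show ?case by (simp add: lie_homD(4)[OF assms(1)] eval_monomial_closed)
qed simp

text \<open>The axioms are equations, so they pass to surjective images.\<close>

lemma bilinear_algebra_surj_image:
  assumes A: "bilinear_algebra K A" and h: "lie_hom K A B \<phi>"
    and surj: "carrier B = \<phi> ` carrier A" and zero: "\<phi> \<zero>\<^bsub>A\<^esub> = \<zero>\<^bsub>B\<^esub>"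
  shows "bilinear_algebra K B"
proof -
  interpret bilinear_algebra K A by fact
  note hom = lie_homD[OF h]
  note sym = hom(2-4)[symmetric]
  have z: "\<zero>\<^bsub>B\<^esub> = \<phi> \<zero>\<^bsub>A\<^esub>" using zero by simp
  have "vectorspace K B"
  proof (rule vs_criteria)
    show "\<forall>v\<in>carrier B. \<exists>neg_v\<in>carrier B. v \<oplus>\<^bsub>B\<^esub> neg_v = \<zero>\<^bsub>B\<^esub>"
    proof
      fix v assume "v \<in> carrier B"
      then obtain x where x: "x \<in> carrier A" "v = \<phi> x" unfolding surj by auto
      then have "v \<oplus>\<^bsub>B\<^esub> \<phi> (\<ominus>\<^bsub>A\<^esub> x) = \<zero>\<^bsub>B\<^esub>"
        using hom(2)[of x "\<ominus>\<^bsub>A\<^esub> x"] by (simp add: z M.r_neg)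
      then show "\<exists>neg_v\<in>carrier B. v \<oplus>\<^bsub>B\<^esub> neg_v = \<zero>\<^bsub>B\<^esub>" using x(1) unfolding surj by blast
    qed
  qed (unfold z surj, auto simp: sym M.a_ac smult_assoc1 smult_l_distr smult_r_distr field_axioms)
  moreover have "bilinear_algebra_axioms K B"
    by unfold_locales (unfold surj, auto simp: sym br_closed br_add_left br_add_right br_smult_left br_smult_right)
  ultimately show ?thesis by (rule bilinear_algebra.intro)
qed

lemma lie_algebraI:
  assumes "bilinear_algebra K A" "\<And>x. x \<in> carrier A \<Longrightarrow> \<lbrakk>x,x\<rbrakk>\<^bsub>A\<^esub> = \<zero>\<^bsub>A\<^esub>"
    "\<And>x y z. x \<in> carrier A \<Longrightarrow> y \<in> carrier A \<Longrightarrow> z \<in> carrier A \<Longrightarrow>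
        \<lbrakk>x, \<lbrakk>y,z\<rbrakk>\<^bsub>A\<^esub>\<rbrakk>\<^bsub>A\<^esub> \<oplus>\<^bsub>A\<^esub> \<lbrakk>y, \<lbrakk>z,x\<rbrakk>\<^bsub>A\<^esub>\<rbrakk>\<^bsub>A\<^esub> \<oplus>\<^bsub>A\<^esub> \<lbrakk>z, \<lbrakk>x,y\<rbrakk>\<^bsub>A\<^esub>\<rbrakk>\<^bsub>A\<^esub> = \<zero>\<^bsub>A\<^esub>"
  shows "lie_algebra K A"
proof -
  interpret bilinear_algebra K A by fact
  show ?thesis
    by unfold_locales
      (use assms(2,3) in \<open>auto simp: br_closed br_add_left br_add_right br_smult_left br_smult_right\<close>)
qed

lemma lie_idealD:
  assumes "lie_ideal K A I"
  shows "subspace K I A" "x \<in> carrier A \<Longrightarrow> y \<in> I \<Longrightarrow> \<lbrakk>x,y\<rbrakk>\<^bsub>A\<^esub> \<in> I"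
    "x \<in> carrier A \<Longrightarrow> y \<in> I \<Longrightarrow> \<lbrakk>y,x\<rbrakk>\<^bsub>A\<^esub> \<in> I"
  using assms by (auto simp: lie_ideal_def)

context bilinear_algebra
begin

lemma subspace_abelian_subgroup:
  assumes "subspace K W A"
  shows "abelian_subgroup W A"
proof -
  note D = subspaceD[OF assms]
  have "subgroup W (add_monoid A)"
    using D(1,2,3,5) by (unfold_locales) (auto simp flip: a_inv_def)
  then show ?thesis
    by (intro abelian_subgroupI3 additive_subgroupI abelian_group_axioms)
qed

lemma coset_eq_iff:
  assumes "subspace K W A" "x \<in> carrier A" "y \<in> carrier A"
  shows "W +>\<^bsub>A\<^esub> x = W +>\<^bsub>A\<^esub> y \<longleftrightarrow> x \<ominus>\<^bsub>A\<^esub> y \<in> W"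
proof -
  interpret W: abelian_subgroup W A using assms(1) by (rule subspace_abelian_subgroup)
  show ?thesis
    using W.a_rcos_module[of y x] W.a_repr_independence'[of x y] W.a_rcos_self[of x] assms(2,3)
    by (auto simp: a_minus_def)
qed

lemma mem_coset_iff: "x' \<in> W +>\<^bsub>A\<^esub> x \<longleftrightarrow> (\<exists>h\<in>W. x' = h \<oplus>\<^bsub>A\<^esub> x)"
  by (auto simp: a_r_coset_def')

lemma coset_add:
  assumes "subspace K W A" "x \<in> carrier A" "y \<in> carrier A"
  shows "(W +>\<^bsub>A\<^esub> x) <+>\<^bsub>A\<^esub> (W +>\<^bsub>A\<^esub> y) = W +>\<^bsub>A\<^esub> (x \<oplus>\<^bsub>A\<^esub> y)"
proof -
  interpret W: abelian_subgroup W A using assms(1) by (rule subspace_abelian_subgroup)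
  show ?thesis using assms by (simp add: W.a_rcos_sum)
qed

lemma UN_coset_const:
  assumes "X \<noteq> {}" "\<And>x. x \<in> X \<Longrightarrow> W +>\<^bsub>A\<^esub> f x = C"
  shows "(\<Union>x\<in>X. W +>\<^bsub>A\<^esub> f x) = C"
  using assms by auto

lemma add_minus_cancel:
  assumes "h \<in> carrier A" "x \<in> carrier A"
  shows "(h \<oplus>\<^bsub>A\<^esub> x) \<ominus>\<^bsub>A\<^esub> x = h"
  using assms by (simp add: a_minus_def M.add.m_assoc M.r_neg)

lemma minus_zero:
  assumes "x \<in> carrier A"
  shows "x \<ominus>\<^bsub>A\<^esub> \<zero>\<^bsub>A\<^esub> = x"
  using add_minus_cancel[OF assms M.zero_closed] assms by simp

lemma coset_smult_coset:
  assumes W: "subspace K W A" and x: "x \<in> carrier A" and a: "a \<in> carrier K"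
  shows "coset_smult A W a (W +>\<^bsub>A\<^esub> x) = W +>\<^bsub>A\<^esub> (a \<odot>\<^bsub>A\<^esub> x)"
  unfolding coset_smult_def
proof (rule UN_coset_const)
  note D = subspaceD[OF W]
  show "W +>\<^bsub>A\<^esub> x \<noteq> {}" using D(2) by (auto simp: mem_coset_iff simp flip: ex_in_conv)
  fix x' assume "x' \<in> W +>\<^bsub>A\<^esub> x"
  then obtain h where h: "h \<in> W" "x' = h \<oplus>\<^bsub>A\<^esub> x" by (auto simp: mem_coset_iff)
  then have hA: "h \<in> carrier A" using D(1) by auto
  have "a \<odot>\<^bsub>A\<^esub> x' \<ominus>\<^bsub>A\<^esub> a \<odot>\<^bsub>A\<^esub> x = a \<odot>\<^bsub>A\<^esub> h"
    using hA x a by (simp add: h(2) smult_r_distr add_minus_cancel)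
  then show "W +>\<^bsub>A\<^esub> (a \<odot>\<^bsub>A\<^esub> x') = W +>\<^bsub>A\<^esub> (a \<odot>\<^bsub>A\<^esub> x)"
    using D(4)[OF a h(1)] hA x a h(2) by (subst coset_eq_iff[OF W]) auto
qed

text \<open>
  Two different subspaces \<open>P\<close> and \<open>Q\<close> are allowed because the bracket of the associated graded
  algebra multiplies cosets of \<open>\<gg>\<^sup>i\<^sup>+\<^sup>1\<close> and \<open>\<gg>\<^sup>j\<^sup>+\<^sup>1\<close> into cosets of \<open>\<gg>\<^sup>i\<^sup>+\<^sup>j\<^sup>+\<^sup>1\<close>; for a quotient by an
  ideal all three subspaces coincide.
\<close>
lemma coset_bracket_coset:
  assumes W: "subspace K W A" and P: "subspace K P A" and Q: "subspace K Q A"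
    and x: "x \<in> carrier A" and y: "y \<in> carrier A"
    and PQ: "\<And>a b. a \<in> P \<Longrightarrow> b \<in> Q \<Longrightarrow> \<lbrakk>a,b\<rbrakk>\<^bsub>A\<^esub> \<in> W"
    and Py: "\<And>a. a \<in> P \<Longrightarrow> \<lbrakk>a,y\<rbrakk>\<^bsub>A\<^esub> \<in> W" and xQ: "\<And>b. b \<in> Q \<Longrightarrow> \<lbrakk>x,b\<rbrakk>\<^bsub>A\<^esub> \<in> W"
  shows "coset_bracket A W (P +>\<^bsub>A\<^esub> x) (Q +>\<^bsub>A\<^esub> y) = W +>\<^bsub>A\<^esub> \<lbrakk>x,y\<rbrakk>\<^bsub>A\<^esub>"
proof -
  have ne: "\<And>x. P +>\<^bsub>A\<^esub> x \<noteq> {}" "\<And>x. Q +>\<^bsub>A\<^esub> x \<noteq> {}"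
    using subspaceD(2)[OF P] subspaceD(2)[OF Q] by (auto simp: mem_coset_iff simp flip: ex_in_conv)
  have "W +>\<^bsub>A\<^esub> \<lbrakk>x',y'\<rbrakk>\<^bsub>A\<^esub> = W +>\<^bsub>A\<^esub> \<lbrakk>x,y\<rbrakk>\<^bsub>A\<^esub>" if xy: "x' \<in> P +>\<^bsub>A\<^esub> x" "y' \<in> Q +>\<^bsub>A\<^esub> y" for x' y'
  proof -
    obtain a b where ab: "a \<in> P" "x' = a \<oplus>\<^bsub>A\<^esub> x" "b \<in> Q" "y' = b \<oplus>\<^bsub>A\<^esub> y"
      using xy unfolding mem_coset_iff by blast
    then have c: "a \<in> carrier A" "b \<in> carrier A" using subspaceD(1)[OF P] subspaceD(1)[OF Q] by auto
    have "\<lbrakk>x',y'\<rbrakk>\<^bsub>A\<^esub> = (\<lbrakk>a,b\<rbrakk>\<^bsub>A\<^esub> \<oplus>\<^bsub>A\<^esub> \<lbrakk>a,y\<rbrakk>\<^bsub>A\<^esub> \<oplus>\<^bsub>A\<^esub> \<lbrakk>x,b\<rbrakk>\<^bsub>A\<^esub>) \<oplus>\<^bsub>A\<^esub> \<lbrakk>x,y\<rbrakk>\<^bsub>A\<^esub>"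
      using c x y by (simp add: ab br_add_left br_add_right br_closed M.a_ac)
    then have "\<lbrakk>x',y'\<rbrakk>\<^bsub>A\<^esub> \<ominus>\<^bsub>A\<^esub> \<lbrakk>x,y\<rbrakk>\<^bsub>A\<^esub> = \<lbrakk>a,b\<rbrakk>\<^bsub>A\<^esub> \<oplus>\<^bsub>A\<^esub> \<lbrakk>a,y\<rbrakk>\<^bsub>A\<^esub> \<oplus>\<^bsub>A\<^esub> \<lbrakk>x,b\<rbrakk>\<^bsub>A\<^esub>"
      using c x y by (simp add: add_minus_cancel br_closed)
    moreover have "\<dots> \<in> W" using ab PQ Py xQ by (intro subspaceD(3)[OF W]) auto
    ultimately show ?thesis using c x y ab by (subst coset_eq_iff[OF W]) (auto simp: br_closed)
  qed
  then show ?thesis unfolding coset_bracket_def using ne by auto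
qed

lemma lie_ideal_kernel:
  assumes "lie_hom K A B \<phi>" "bilinear_algebra K B"
  shows "lie_ideal K A {x \<in> carrier A. \<phi> x = \<zero>\<^bsub>B\<^esub>}"
proof -
  interpret B: bilinear_algebra K B by fact
  note hom = lie_homD[OF assms(1)]
  have "\<phi> \<zero>\<^bsub>A\<^esub> = \<zero>\<^bsub>B\<^esub>"
    using lie_homD(5)[OF assms(1)] vectorspace_axioms B.vectorspace_axioms by (rule module_hom_zero)
  then have "subspace K {x \<in> carrier A. \<phi> x = \<zero>\<^bsub>B\<^esub>} A"
    by (intro subspaceI) (auto simp: hom)
  then show ?thesis by (auto simp: lie_ideal_def hom br_closed)
qed

lemma lie_ideal_generated:
  assumes "S \<subseteq> carrier A"
  shows "lie_ideal K A (ideal_generated K A S)" "S \<subseteq> ideal_generated K A S"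
proof -
  let ?\<I> = "{I. lie_ideal K A I \<and> S \<subseteq> I}"
  have "carrier A \<in> ?\<I>" using assms subspace_carrier by (auto simp: lie_ideal_def br_closed)
  then have "subspace K (\<Inter>?\<I>) A"
    by (intro subspace_Inter) (auto simp: lie_ideal_def)
  then show "lie_ideal K A (ideal_generated K A S)"
    by (auto simp: lie_ideal_def ideal_generated_def)
  show "S \<subseteq> ideal_generated K A S" by (auto simp: ideal_generated_def)
qed

text \<open>
  The kernel is one of the ideals over which the intersection is taken.
\<close>
lemma ideal_generated_vanish:
  assumes "lie_hom K A B \<phi>" "bilinear_algebra K B" "S \<subseteq> carrier A"
    "\<And>x. x \<in> S \<Longrightarrow> \<phi> x = \<zero>\<^bsub>B\<^esub>" "x \<in> ideal_generated K A S"
  shows "\<phi> x = \<zero>\<^bsub>B\<^esub>"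
  using lie_ideal_kernel[OF assms(1,2)] assms(3-5) by (auto simp: ideal_generated_def)

end

locale bilinear_algebra_ideal = bilinear_algebra +
  fixes I
  assumes ideal: "lie_ideal K A I"
begin

lemmas ideal_subspace = lie_idealD(1)[OF ideal]

lemma carrier_quot: "carrier (lie_quot A I) = (\<lambda>x. I +>\<^bsub>A\<^esub> x) ` carrier A"
  by (auto simp: lie_quot_def A_RCOSETS_def')

lemma quot_eq_zero_iff:
  assumes "x \<in> carrier A"
  shows "I +>\<^bsub>A\<^esub> x = \<zero>\<^bsub>lie_quot A I\<^esub> \<longleftrightarrow> x \<in> I"
proof -
  have "I +>\<^bsub>A\<^esub> \<zero>\<^bsub>A\<^esub> = I"
    using subspaceD(1)[OF ideal_subspace] by (rule a_coset_add_zero)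
  then show ?thesis
    using coset_eq_iff[OF ideal_subspace assms M.zero_closed] assms
    by (simp add: lie_quot_def minus_zero)
qed

lemma quot_hom: "lie_hom K A (lie_quot A I) (\<lambda>x. I +>\<^bsub>A\<^esub> x)"
proof (rule lie_homI)
  fix x y assume "x \<in> carrier A" "y \<in> carrier A"
  then show "I +>\<^bsub>A\<^esub> \<lbrakk>x,y\<rbrakk>\<^bsub>A\<^esub> = \<lbrakk>I +>\<^bsub>A\<^esub> x, I +>\<^bsub>A\<^esub> y\<rbrakk>\<^bsub>lie_quot A I\<^esub>"
    using lie_idealD(2,3)[OF ideal] subspaceD(1)[OF ideal_subspace]
    by (simp add: lie_quot_def) (subst coset_bracket_coset[OF ideal_subspace ideal_subspace ideal_subspace], auto)
qed (auto simp: carrier_quot, auto simp: lie_quot_def coset_add coset_smult_coset ideal_subspace)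

lemma quot_bilinear_algebra: "bilinear_algebra K (lie_quot A I)"
  by (rule bilinear_algebra_surj_image[OF bilinear_algebra_axioms quot_hom carrier_quot])
    (simp add: quot_eq_zero_iff subspaceD(2)[OF ideal_subspace])

lemma quot_relations_lie_algebra:
  assumes "lie_relations A \<subseteq> I"
  shows "lie_algebra K (lie_quot A I)"
proof (rule lie_algebraI[OF quot_bilinear_algebra])
  note sym = lie_homD(2-4)[OF quot_hom, symmetric]
  fix X assume "X \<in> carrier (lie_quot A I)"
  then obtain x where x: "x \<in> carrier A" "X = I +>\<^bsub>A\<^esub> x" by (auto simp: carrier_quot)
  then have "\<lbrakk>x,x\<rbrakk>\<^bsub>A\<^esub> \<in> I" using assms by (auto simp: lie_relations_def)
  then show "\<lbrakk>X,X\<rbrakk>\<^bsub>lie_quot A I\<^esub> = \<zero>\<^bsub>lie_quot A I\<^esub>"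
    using x by (simp add: sym quot_eq_zero_iff br_closed)
  fix Y Z assume "Y \<in> carrier (lie_quot A I)" "Z \<in> carrier (lie_quot A I)"
  then obtain y z where yz: "y \<in> carrier A" "Y = I +>\<^bsub>A\<^esub> y" "z \<in> carrier A" "Z = I +>\<^bsub>A\<^esub> z"
    by (auto simp: carrier_quot)
  have "\<lbrakk>x, \<lbrakk>y,z\<rbrakk>\<^bsub>A\<^esub>\<rbrakk>\<^bsub>A\<^esub> \<oplus>\<^bsub>A\<^esub> \<lbrakk>y, \<lbrakk>z,x\<rbrakk>\<^bsub>A\<^esub>\<rbrakk>\<^bsub>A\<^esub> \<oplus>\<^bsub>A\<^esub> \<lbrakk>z, \<lbrakk>x,y\<rbrakk>\<^bsub>A\<^esub>\<rbrakk>\<^bsub>A\<^esub> \<in> I"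
    using assms x(1) yz(1,3) unfolding lie_relations_def by blast
  then show "\<lbrakk>X, \<lbrakk>Y,Z\<rbrakk>\<^bsub>lie_quot A I\<^esub>\<rbrakk>\<^bsub>lie_quot A I\<^esub> \<oplus>\<^bsub>lie_quot A I\<^esub>
      \<lbrakk>Y, \<lbrakk>Z,X\<rbrakk>\<^bsub>lie_quot A I\<^esub>\<rbrakk>\<^bsub>lie_quot A I\<^esub> \<oplus>\<^bsub>lie_quot A I\<^esub> \<lbrakk>Z, \<lbrakk>X,Y\<rbrakk>\<^bsub>lie_quot A I\<^esub>\<rbrakk>\<^bsub>lie_quot A I\<^esub>
      = \<zero>\<^bsub>lie_quot A I\<^esub>"
    using x yz by (simp add: sym quot_eq_zero_iff br_closed)
qed

lemma quot_factor:
  assumes "lie_hom K A B \<phi>" "bilinear_algebra K B" "\<And>x. x \<in> I \<Longrightarrow> \<phi> x = \<zero>\<^bsub>B\<^esub>"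
  obtains \<psi> where "lie_hom K (lie_quot A I) B \<psi>" "\<And>x. x \<in> carrier A \<Longrightarrow> \<psi> (I +>\<^bsub>A\<^esub> x) = \<phi> x"
proof -
  interpret B: bilinear_algebra K B by fact
  note sym = lie_homD(2-4)[OF quot_hom, symmetric] and hom' = lie_homD[OF assms(1)]
  have wd: "\<phi> x = \<phi> y" if "x \<in> carrier A" "y \<in> carrier A" "I +>\<^bsub>A\<^esub> x = I +>\<^bsub>A\<^esub> y" for x y
  proof -
    have "\<phi> x \<ominus>\<^bsub>B\<^esub> \<phi> y = \<zero>\<^bsub>B\<^esub>"
      using that assms(3) coset_eq_iff[OF ideal_subspace that(1,2)]
        module_hom_minus[OF lie_homD(5)[OF assms(1)] vectorspace_axioms B.vectorspace_axioms that(1,2)] by auto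
    then show ?thesis using that hom'(1) by auto
  qed
  define \<psi> where "\<psi> X = \<phi> (SOME x. x \<in> carrier A \<and> X = I +>\<^bsub>A\<^esub> x)" for X
  have \<psi>: "\<psi> (I +>\<^bsub>A\<^esub> x) = \<phi> x" if "x \<in> carrier A" for x
  proof -
    have "\<exists>y. y \<in> carrier A \<and> I +>\<^bsub>A\<^esub> x = I +>\<^bsub>A\<^esub> y" using that by auto
    from someI_ex[OF this] show ?thesis
      unfolding \<psi>_def using that by (intro wd) auto
  qed
  have "lie_hom K (lie_quot A I) B \<psi>"
    by (rule lie_homI) (auto simp: carrier_quot hom' \<psi> br_closed sym)
  then show thesis using \<psi> that by blast
qed

end

lemma (in lie_algebra) quot_lie_algebra:
  assumes "lie_ideal K L I"
  shows "lie_algebra K (lie_quot L I)"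
proof -
  interpret bilinear_algebra_ideal K L I by unfold_locales fact
  have "lie_relations L \<subseteq> {\<zero>\<^bsub>L\<^esub>}" by (auto simp: lie_relations_def bracket_self jacobi)
  then show ?thesis using subspaceD(2)[OF ideal_subspace] by (intro quot_relations_lie_algebra) auto
qed

section \<open>The lower central series\<close>

text \<open>
  The weight of a monomial: \<open>eval_monomial_lcs\<close> places its value in the corresponding term of
  the lower central series.
\<close>
primrec leaves :: "'v monomial \<Rightarrow> nat" where
  "leaves (Var v) = 1"
| "leaves (Prod s t) = leaves s + leaves t"

lemma leaves_pos: "1 \<le> leaves t"
  by (induction t) auto

lemma leaves_nonzero [simp]: "leaves t \<noteq> 0"
  using leaves_pos[of t] by simp
context lie_algebra
begin

lemma bracket_skew:
  assumes "x \<in> carrier L" "y \<in> carrier L"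
  shows "\<lbrakk>y,x\<rbrakk>\<^bsub>L\<^esub> = \<ominus>\<^bsub>L\<^esub> \<lbrakk>x,y\<rbrakk>\<^bsub>L\<^esub>"
proof -
  have "\<zero>\<^bsub>L\<^esub> = \<lbrakk>y \<oplus>\<^bsub>L\<^esub> x, y \<oplus>\<^bsub>L\<^esub> x\<rbrakk>\<^bsub>L\<^esub>" using assms by (simp add: bracket_self)
  also have "\<dots> = \<lbrakk>y,x\<rbrakk>\<^bsub>L\<^esub> \<oplus>\<^bsub>L\<^esub> \<lbrakk>x,y\<rbrakk>\<^bsub>L\<^esub>"
    using assms by (simp add: bracket_add_left bracket_add_right bracket_closed
        bracket_self[OF assms(1)] bracket_self[OF assms(2)] M.add.m_comm)
  finally show ?thesis using assms by (intro M.minus_equality[symmetric]) (simp_all add: bracket_closed)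
qed

lemma lcs_subspace: "subspace K (lcs K L n) L"
proof (induction n rule: induct_nat_012)
  case (ge2 n)
  then show ?case
    using subspaceD(1)[OF ge2(2)]
    by (auto simp: bracket_space_def bracket_closed intro!: lspan_subspace)
qed (simp_all add: subspace_carrier)

lemma lcs_closed: "x \<in> lcs K L n \<Longrightarrow> x \<in> carrier L"
  using subspaceD(1)[OF lcs_subspace] by auto

lemma bracket_space_least:
  assumes "subspace K W L" "\<And>x y. x \<in> P \<Longrightarrow> y \<in> Q \<Longrightarrow> \<lbrakk>x,y\<rbrakk>\<^bsub>L\<^esub> \<in> W"
  shows "bracket_space K L P Q \<subseteq> W"
  unfolding bracket_space_def using assms by (intro lspan_least) auto

lemma lcs_Suc_mem:
  assumes "1 \<le> n" "x \<in> carrier L" "y \<in> lcs K L n"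
  shows "\<lbrakk>x,y\<rbrakk>\<^bsub>L\<^esub> \<in> lcs K L (Suc n)"
proof -
  obtain m where m: "n = Suc m" using assms(1) by (cases n) auto
  have "{\<lbrakk>x,y\<rbrakk>\<^bsub>L\<^esub> |x y. x \<in> carrier L \<and> y \<in> lcs K L (Suc m)} \<subseteq> carrier L"
    using lcs_closed by (auto simp: bracket_closed)
  from lspan_superset[OF this] show ?thesis using assms(2,3)
    by (auto simp: m bracket_space_def)
qed

lemma lcs_Suc_least:
  assumes "1 \<le> n" "subspace K W L"
    "\<And>x y. x \<in> carrier L \<Longrightarrow> y \<in> lcs K L n \<Longrightarrow> \<lbrakk>x,y\<rbrakk>\<^bsub>L\<^esub> \<in> W"
  shows "lcs K L (Suc n) \<subseteq> W"
  using assms by (cases n) (auto dest: bracket_space_least)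

lemma lcs_Suc_subset: "lcs K L (Suc n) \<subseteq> lcs K L n"
proof (induction n)
  case (Suc n)
  show ?case
  proof (rule lcs_Suc_least[OF _ lcs_subspace])
    fix x y assume "x \<in> carrier L" "y \<in> lcs K L (Suc n)"
    then show "\<lbrakk>x,y\<rbrakk>\<^bsub>L\<^esub> \<in> lcs K L (Suc n)"
      using Suc lcs_Suc_mem[of n x y] by (cases "n = 0") (auto simp: bracket_closed)
  qed simp
qed simp

lemma lcs_antimono: "m \<le> n \<Longrightarrow> lcs K L n \<subseteq> lcs K L m"
  by (rule lift_Suc_antimono_le) (rule lcs_Suc_subset)

lemma lcs_ideal: "lie_ideal K L (lcs K L n)"
proof -
  have "\<lbrakk>x,y\<rbrakk>\<^bsub>L\<^esub> \<in> lcs K L n" if "x \<in> carrier L" "y \<in> lcs K L n" for x y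
  proof (cases "n = 0")
    case False
    then show ?thesis using lcs_Suc_mem[of n x y] that lcs_Suc_subset[of n] by auto
  qed (use that in \<open>simp add: bracket_closed\<close>)
  moreover from this have "\<lbrakk>y,x\<rbrakk>\<^bsub>L\<^esub> \<in> lcs K L n" if "x \<in> carrier L" "y \<in> lcs K L n" for x y
    using that bracket_skew[OF that(1) lcs_closed[OF that(2)]] subspaceD(5)[OF lcs_subspace] by simp
  ultimately show ?thesis unfolding lie_ideal_def using lcs_subspace by blast
qed

lemma jacobi_left:
  assumes "x \<in> carrier L" "y \<in> carrier L" "z \<in> carrier L"
  shows "\<lbrakk>\<lbrakk>x,y\<rbrakk>\<^bsub>L\<^esub>, z\<rbrakk>\<^bsub>L\<^esub> = \<lbrakk>x, \<lbrakk>y,z\<rbrakk>\<^bsub>L\<^esub>\<rbrakk>\<^bsub>L\<^esub> \<ominus>\<^bsub>L\<^esub> \<lbrakk>y, \<lbrakk>x,z\<rbrakk>\<^bsub>L\<^esub>\<rbrakk>\<^bsub>L\<^esub>"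
proof -
  have 1: "\<lbrakk>y, \<lbrakk>z,x\<rbrakk>\<^bsub>L\<^esub>\<rbrakk>\<^bsub>L\<^esub> = \<ominus>\<^bsub>L\<^esub> \<lbrakk>y, \<lbrakk>x,z\<rbrakk>\<^bsub>L\<^esub>\<rbrakk>\<^bsub>L\<^esub>"
    using assms bracket_skew[of x z] by (simp add: br_neg bracket_closed)
  have "\<lbrakk>\<lbrakk>x,y\<rbrakk>\<^bsub>L\<^esub>, z\<rbrakk>\<^bsub>L\<^esub> = \<ominus>\<^bsub>L\<^esub> \<lbrakk>z, \<lbrakk>x,y\<rbrakk>\<^bsub>L\<^esub>\<rbrakk>\<^bsub>L\<^esub>"
    using assms by (intro bracket_skew) (auto simp: bracket_closed)
  also have "\<ominus>\<^bsub>L\<^esub> \<lbrakk>z, \<lbrakk>x,y\<rbrakk>\<^bsub>L\<^esub>\<rbrakk>\<^bsub>L\<^esub> = \<lbrakk>x, \<lbrakk>y,z\<rbrakk>\<^bsub>L\<^esub>\<rbrakk>\<^bsub>L\<^esub> \<oplus>\<^bsub>L\<^esub> \<lbrakk>y, \<lbrakk>z,x\<rbrakk>\<^bsub>L\<^esub>\<rbrakk>\<^bsub>L\<^esub>"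
    using jacobi[OF assms] assms by (intro M.minus_equality) (auto simp: bracket_closed)
  finally show ?thesis by (simp add: 1 a_minus_def)
qed

text \<open>
  Induction on \<open>i\<close>: a generator \<open>[u, v]\<close> of \<open>\<gg>\<^sup>i\<^sup>+\<^sup>1\<close> satisfies
  \<open>[[u, v], y] = [u, [v, y]] - [v, [u, y]]\<close>, and both terms are covered by the case \<open>i\<close>, applied
  to \<open>y\<close> and to \<open>[u, y]\<close>.
\<close>
lemma lcs_bracket_lcs:
  assumes "1 \<le> i" "1 \<le> j" "x \<in> lcs K L i" "y \<in> lcs K L j"
  shows "\<lbrakk>x,y\<rbrakk>\<^bsub>L\<^esub> \<in> lcs K L (i + j)"
  using assms
proof (induction i arbitrary: j x y rule: dec_induct)
  case base
  then show ?case using lcs_Suc_mem by auto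
next
  case (step n)
  let ?W = "{x \<in> carrier L. \<forall>j\<ge>1. \<forall>y\<in>lcs K L j. \<lbrakk>x,y\<rbrakk>\<^bsub>L\<^esub> \<in> lcs K L (Suc n + j)}"
  have "subspace K ?W L"
    by (rule subspaceI)
      (use lcs_closed subspaceD(2-4)[OF lcs_subspace] in
        \<open>auto simp: bracket_add_left bracket_smult_left\<close>)
  then have "lcs K L (Suc n) \<subseteq> ?W"
  proof (rule lcs_Suc_least[OF step(1)])
    fix u v assume uv: "u \<in> carrier L" "v \<in> lcs K L n"
    have "\<lbrakk>\<lbrakk>u,v\<rbrakk>\<^bsub>L\<^esub>,y\<rbrakk>\<^bsub>L\<^esub> \<in> lcs K L (Suc n + j)" if j: "1 \<le> (j::nat)" "y \<in> lcs K L j" for j y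
    proof -
    have c: "v \<in> carrier L" "y \<in> carrier L" using uv j lcs_closed by auto
    have "\<lbrakk>v,y\<rbrakk>\<^bsub>L\<^esub> \<in> lcs K L (n + j)" using step.IH[of j v y] uv j by auto
    then have 1: "\<lbrakk>u,\<lbrakk>v,y\<rbrakk>\<^bsub>L\<^esub>\<rbrakk>\<^bsub>L\<^esub> \<in> lcs K L (Suc n + j)"
      using uv j lcs_Suc_mem[of "n + j" u] by simp
    have "\<lbrakk>u,y\<rbrakk>\<^bsub>L\<^esub> \<in> lcs K L (Suc j)" using lcs_Suc_mem uv j by auto
    then have 2: "\<lbrakk>v,\<lbrakk>u,y\<rbrakk>\<^bsub>L\<^esub>\<rbrakk>\<^bsub>L\<^esub> \<in> lcs K L (Suc n + j)"
      using step.IH[of "Suc j" v] uv j by auto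
    show ?thesis
      using jacobi_left[OF uv(1) c] subspaceD(6)[OF lcs_subspace 1 2] by simp
    qed
    then show "\<lbrakk>u,v\<rbrakk>\<^bsub>L\<^esub> \<in> ?W" using uv lcs_closed by (auto simp: bracket_closed)
  qed
  then show ?case using step by auto
qed

lemma eval_monomial_lcs:
  assumes "g ` vars t \<subseteq> carrier L"
  shows "eval_monomial L g t \<in> lcs K L (leaves t)"
  using assms
proof (induction t)
  case (Prod s u)
  then show ?case
    using lcs_bracket_lcs[OF leaves_pos[of s] leaves_pos[of u]] by (simp add: image_Un)
qed simp

end

section \<open>Carnot gradings and the associated graded algebra\<close>

context lie_algebra
begin

text \<open>
  Let \<open>p\<^sub>i\<close> be the projection to \<open>W\<^sub>i\<close>.  The isomorphism sends \<open>x\<close> to the family of the cosets of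
  \<open>p\<^sub>i x\<close>.  It is bijective because \<open>\<gg>\<^sup>n\<close> consists of the elements with \<open>p\<^sub>i x = 0\<close> for all
  \<open>i < n\<close>, so that \<open>W\<^sub>i\<close> represents \<open>\<gg>\<^sup>i / \<gg>\<^sup>i\<^sup>+\<^sup>1\<close>, and it respects brackets because
  \<open>p\<^sub>n [x, y]\<close> is the sum of the \<open>[p\<^sub>i x, p\<^sub>n\<^sub>-\<^sub>i y]\<close>.
\<close>
theorem carnot_grading_naturally_graded:
  assumes carnot: "carnot_grading K L k W"
  shows "naturally_graded K L"
proof -
  note One_nat_def [simp del]
  have Wsub: "subspace K (W i) L" if "i \<in> {1..k}" for i
    using carnot that by (auto simp: carnot_grading_def is_direct_sum_def)
  have bij: "bij_betw (\<lambda>x. finsum L x {1..k}) (\<Pi>\<^sub>E i\<in>{1..k}. W i) (carrier L)"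
    using carnot by (auto simp: carnot_grading_def is_direct_sum_def)
  have Wbr: "bracket_space K L (W i) (W j) \<subseteq> (if i + j \<le> k then W (i + j) else {\<zero>\<^bsub>L\<^esub>})"
    if "i \<in> {1..k}" "j \<in> {1..k}" for i j
    using carnot that unfolding carnot_grading_def by blast
  have lcsW: "bij_betw (\<lambda>x. finsum L x {n..k}) (\<Pi>\<^sub>E i\<in>{n..k}. W i) (lcs K L n)" if "1 \<le> n" for n
    using carnot that unfolding carnot_grading_def is_direct_sum_def by blast
  have Wc: "x \<in> carrier L" if "x \<in> W i" "i \<in> {1..k}" for i x
    using subspaceD(1)[OF Wsub[OF that(2)]] that by auto
  define c where "c = inv_into (\<Pi>\<^sub>E i\<in>{1..k}. W i) (\<lambda>x. finsum L x {1..k})"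
  define p where "p i x = (if i \<in> {1..k} then c x i else \<zero>\<^bsub>L\<^esub>)" for i x
  have pW: "p i x \<in> W i" if "x \<in> carrier L" "i \<in> {1..k}" for i x
  proof -
    have "c x \<in> (\<Pi>\<^sub>E i\<in>{1..k}. W i)"
      unfolding c_def using bij that(1) by (intro inv_into_into) (auto simp: bij_betw_def)
    then show ?thesis unfolding p_def using that(2) by (auto dest: PiE_mem)
  qed
  have p0: "p i x = \<zero>\<^bsub>L\<^esub>" if "i \<notin> {1..k}" for i x unfolding p_def using that by (rule if_not_P)
  have pc [simp]: "p i x \<in> carrier L" if "x \<in> carrier L" for i x
    using pW[OF that] Wc p0 by (cases "i \<in> {1..k}") auto
  have psum: "finsum L (\<lambda>i. p i x) {1..k} = x" if "x \<in> carrier L" for x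
  proof -
    have "c x i = p i x" if "i \<in> {1..k}" for i using that by (simp add: p_def)
    then have "finsum L (\<lambda>i. p i x) {1..k} = finsum L (c x) {1..k}"
      using pc[OF that] by (intro M.finsum_cong'[symmetric]) auto
    also have "\<dots> = x"
      unfolding c_def using bij that by (intro f_inv_into_f[of x "\<lambda>x. finsum L x {1..k}"]) (auto simp: bij_betw_def)
    finally show ?thesis .
  qed
  have uniq: "p i (finsum L f {1..k}) = f i" if "\<And>i. i \<in> {1..k} \<Longrightarrow> f i \<in> W i" "i \<in> {1..k}" for f i
  proof -
    have r: "restrict f {1..k} \<in> (\<Pi>\<^sub>E i\<in>{1..k}. W i)" using that by auto
    have "finsum L f {1..k} = finsum L (restrict f {1..k}) {1..k}"
      using Wc[OF that(1)] by (intro M.finsum_cong') auto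
    then have "c (finsum L f {1..k}) = restrict f {1..k}"
      unfolding c_def using inv_into_f_f[OF bij_betw_imp_inj_on[OF bij] r] by simp
    then show ?thesis using that(2) by (simp add: p_def)
  qed
  have p_add: "p i (x \<oplus>\<^bsub>L\<^esub> y) = p i x \<oplus>\<^bsub>L\<^esub> p i y" if xy: "x \<in> carrier L" "y \<in> carrier L" for i x y
  proof (cases "i \<in> {1..k}")
    case True
    have "x \<oplus>\<^bsub>L\<^esub> y = finsum L (\<lambda>i. p i x \<oplus>\<^bsub>L\<^esub> p i y) {1..k}"
      using xy by (subst M.finsum_addf) (auto simp: psum)
    then show ?thesis using uniq[of "\<lambda>i. p i x \<oplus>\<^bsub>L\<^esub> p i y" i] True pW subspaceD(3)[OF Wsub] xy by simp
  qed (simp add: p0)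
  have p_smult: "p i (a \<odot>\<^bsub>L\<^esub> x) = a \<odot>\<^bsub>L\<^esub> p i x" if xy: "x \<in> carrier L" "a \<in> carrier K" for i x a
  proof (cases "i \<in> {1..k}")
    case True
    have "a \<odot>\<^bsub>L\<^esub> x = finsum L (\<lambda>i. a \<odot>\<^bsub>L\<^esub> p i x) {1..k}"
      using xy finsum_smult[of a "\<lambda>i. p i x" "{1..k}"] by (auto simp: psum)
    then show ?thesis using uniq[of "\<lambda>i. a \<odot>\<^bsub>L\<^esub> p i x" i] True pW subspaceD(4)[OF Wsub] xy by simp
  qed (use xy in \<open>simp add: p0\<close>)
  have phom: "p i \<in> module_hom K L L" for i
    by (auto simp: module_hom_def p_add p_smult)
  have pzero [simp]: "p i \<zero>\<^bsub>L\<^esub> = \<zero>\<^bsub>L\<^esub>" for i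
    by (rule module_hom_zero[OF phom]) unfold_locales
  have phomog: "p n x = (if n = i then x else \<zero>\<^bsub>L\<^esub>)" if x: "x \<in> W i" "i \<in> {1..k}" for n i x
  proof (cases "n \<in> {1..k}")
    case True
    have xc: "x \<in> carrier L" using Wc x by auto
    have "finsum L (\<lambda>j. if j = i then x else \<zero>\<^bsub>L\<^esub>) {1..k} = x"
      using M.add.finprod_singleton_swap[of i "{1..k}" "\<lambda>_. x"] x(2) xc by auto
    then show ?thesis
      using uniq[of "\<lambda>j. if j = i then x else \<zero>\<^bsub>L\<^esub>" n] True x subspaceD(2)[OF Wsub] by auto
  qed (use x in \<open>auto simp: p0\<close>)
  have pbr: "p n \<lbrakk>x,y\<rbrakk>\<^bsub>L\<^esub> = (if n = i + j then \<lbrakk>x,y\<rbrakk>\<^bsub>L\<^esub> else \<zero>\<^bsub>L\<^esub>)"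
    if xy: "x \<in> W i" "i \<in> {1..k}" "y \<in> W j" "j \<in> {1..k}" for n i j x y
  proof -
    have "{\<lbrakk>x,y\<rbrakk>\<^bsub>L\<^esub> |x y. x \<in> W i \<and> y \<in> W j} \<subseteq> carrier L"
      using Wc xy by (auto intro!: bracket_closed)
    then have "\<lbrakk>x,y\<rbrakk>\<^bsub>L\<^esub> \<in> bracket_space K L (W i) (W j)"
      unfolding bracket_space_def using lspan_superset xy by blast
    then have *: "\<lbrakk>x,y\<rbrakk>\<^bsub>L\<^esub> \<in> (if i + j \<le> k then W (i + j) else {\<zero>\<^bsub>L\<^esub>})"
      using Wbr xy by blast
    show ?thesis
    proof (cases "i + j \<le> k")
      case True
      then show ?thesis using * xy by (intro phomog) auto
    qed (use * in auto)
  qed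
  have pbracket: "p n \<lbrakk>x,y\<rbrakk>\<^bsub>L\<^esub> = finsum L (\<lambda>i. \<lbrakk>p i x, p (n - i) y\<rbrakk>\<^bsub>L\<^esub>) {1..<n}"
    if xy: "x \<in> carrier L" "y \<in> carrier L" for n x y
  proof -
    \<comment> \<open>only the component of degree \<open>n - i\<close> of \<open>y\<close> contributes\<close>
    have inner: "p n \<lbrakk>p i x, y\<rbrakk>\<^bsub>L\<^esub> = (if i < n then \<lbrakk>p i x, p (n - i) y\<rbrakk>\<^bsub>L\<^esub> else \<zero>\<^bsub>L\<^esub>)"
      if i: "i \<in> {1..k}" for i
    proof -
      have "p n \<lbrakk>p i x, y\<rbrakk>\<^bsub>L\<^esub> = p n \<lbrakk>p i x, finsum L (\<lambda>j. p j y) {1..k}\<rbrakk>\<^bsub>L\<^esub>"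
        using xy by (simp add: psum)
      also have "\<dots> = p n (finsum L (\<lambda>j. \<lbrakk>p i x, p j y\<rbrakk>\<^bsub>L\<^esub>) {1..k})"
        using xy by (subst br_finsum_right) auto
      also have "\<dots> = finsum L (\<lambda>j. p n \<lbrakk>p i x, p j y\<rbrakk>\<^bsub>L\<^esub>) {1..k}"
        using xy by (intro module_hom_finsum[OF phom]) (auto simp: bracket_closed vectorspace_axioms)
      also have "\<dots> = finsum L (\<lambda>j. if j = n - i then (if i < n then \<lbrakk>p i x, p j y\<rbrakk>\<^bsub>L\<^esub> else \<zero>\<^bsub>L\<^esub>) else \<zero>\<^bsub>L\<^esub>) {1..k}"
        using xy i pbr[OF pW _ pW]
        by (intro M.finsum_cong') (auto simp: bracket_closed)
      also have "\<dots> = (if i < n then \<lbrakk>p i x, p (n - i) y\<rbrakk>\<^bsub>L\<^esub> else \<zero>\<^bsub>L\<^esub>)"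
      proof (cases "n - i \<in> {1..k}")
        case True
        then show ?thesis using xy
          M.add.finprod_singleton_swap[of "n - i" "{1..k}" "\<lambda>j. if i < n then \<lbrakk>p i x, p j y\<rbrakk>\<^bsub>L\<^esub> else \<zero>\<^bsub>L\<^esub>"]
          by (auto simp: bracket_closed)
      next
        case False
        then have "finsum L (\<lambda>j. if j = n - i then (if i < n then \<lbrakk>p i x, p j y\<rbrakk>\<^bsub>L\<^esub> else \<zero>\<^bsub>L\<^esub>) else \<zero>\<^bsub>L\<^esub>) {1..k} = \<zero>\<^bsub>L\<^esub>"
          by (intro M.add.finprod_one_eqI) auto
        then show ?thesis using False xy p0[of "n - i" y] by simp
      qed
      finally show ?thesis .
    qed
    have "p n \<lbrakk>x,y\<rbrakk>\<^bsub>L\<^esub> = p n \<lbrakk>finsum L (\<lambda>i. p i x) {1..k}, y\<rbrakk>\<^bsub>L\<^esub>"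
      using xy by (simp add: psum)
    also have "\<dots> = p n (finsum L (\<lambda>i. \<lbrakk>p i x, y\<rbrakk>\<^bsub>L\<^esub>) {1..k})"
      using xy by (subst br_finsum_left) auto
    also have "\<dots> = finsum L (\<lambda>i. p n \<lbrakk>p i x, y\<rbrakk>\<^bsub>L\<^esub>) {1..k}"
      using xy by (intro module_hom_finsum[OF phom]) (auto simp: bracket_closed vectorspace_axioms)
    also have "\<dots> = finsum L (\<lambda>i. \<lbrakk>p i x, p (n - i) y\<rbrakk>\<^bsub>L\<^esub>) {1..<n}"
      using xy by (intro M.add.finprod_mono_neutral_cong) (auto simp: bracket_closed inner p0)
    finally show ?thesis .
  qed
  have lcs_iff: "x \<in> lcs K L n \<longleftrightarrow> x \<in> carrier L \<and> (\<forall>i<n. p i x = \<zero>\<^bsub>L\<^esub>)" if n: "1 \<le> n" for n x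
  proof
    assume x: "x \<in> lcs K L n"
    then have "x \<in> (\<lambda>x. finsum L x {n..k}) ` (\<Pi>\<^sub>E i\<in>{n..k}. W i)"
      by (simp only: bij_betw_imp_surj_on[OF lcsW[OF n]])
    then obtain f where f: "f \<in> (\<Pi>\<^sub>E i\<in>{n..k}. W i)" "finsum L f {n..k} = x"
      by (elim imageE) simp
    \<comment> \<open>padding with zeros turns the decomposition of \<open>\<gg>\<^sup>n\<close> into the one that defines \<open>p\<close>\<close>
    let ?f = "\<lambda>i. if i < n then \<zero>\<^bsub>L\<^esub> else f i"
    have fW: "?f i \<in> W i" if "i \<in> {1..k}" for i
      using PiE_mem[OF f(1), of i] that subspaceD(2)[OF Wsub[OF that]] by simp
    have fc: "?f i \<in> carrier L" if "i \<in> {1..k}" for i using Wc[OF fW[OF that] that] .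
    have "finsum L ?f {1..k} = finsum L f {n..k}"
    proof (rule M.add.finprod_mono_neutral_cong)
      show "f \<in> {n..k} \<rightarrow> carrier L" using Wc[OF PiE_mem[OF f(1)]] n by auto
      show "?f \<in> {1..k} \<rightarrow> carrier L" using fc by blast
    qed (use n in auto)
    then have "p i x = \<zero>\<^bsub>L\<^esub>" if "i < n" for i
      using uniq[of ?f i] fW f(2) that p0[of i] by (cases "i \<in> {1..k}") auto
    then show "x \<in> carrier L \<and> (\<forall>i<n. p i x = \<zero>\<^bsub>L\<^esub>)" using lcs_closed[OF x] by simp
  next
    assume x: "x \<in> carrier L \<and> (\<forall>i<n. p i x = \<zero>\<^bsub>L\<^esub>)"
    have r: "restrict (\<lambda>i. p i x) {n..k} \<in> (\<Pi>\<^sub>E i\<in>{n..k}. W i)" using pW x n by auto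
    have "finsum L (restrict (\<lambda>i. p i x) {n..k}) {n..k} = finsum L (\<lambda>i. p i x) {1..k}"
      using x n by (intro M.add.finprod_mono_neutral_cong) auto
    also have "\<dots> = x" using x psum by simp
    finally have "finsum L (restrict (\<lambda>i. p i x) {n..k}) {n..k} = x" .
    then show "x \<in> lcs K L n"
      unfolding bij_betw_imp_surj_on[OF lcsW[OF n], symmetric] by (rule rev_image_eqI[OF r sym])
  qed
  have p_lcs: "p i x \<in> lcs K L i" if "x \<in> carrier L" "1 \<le> i" for i x
  proof (cases "i \<in> {1..k}")
    case True
    then show ?thesis unfolding lcs_iff[OF that(2)] using that phomog[OF pW] by simp
  qed (simp add: p0 subspaceD(2)[OF lcs_subspace])
  have pp: "p i (p i x) = p i x" if "x \<in> carrier L" for i x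
    using that phomog[OF pW] p0[of i] by (cases "i \<in> {1..k}") auto
  define \<psi> where "\<psi> x = (\<lambda>i\<in>{1..}. lcs K L (i + 1) +>\<^bsub>L\<^esub> p i x)" for x
  have coset_zero: "lcs K L n +>\<^bsub>L\<^esub> \<zero>\<^bsub>L\<^esub> = lcs K L n" for n
    using subspaceD(1)[OF lcs_subspace] by (rule a_coset_add_zero)
  have fin: "finite {i \<in> {1..}. \<psi> x i \<noteq> lcs K L (i + 1)}" for x
    by (rule finite_subset[of _ "{1..k}"]) (auto simp: \<psi>_def coset_zero p0)
  have \<psi>_gr: "\<psi> x \<in> carrier (gr K L)" if "x \<in> carrier L" for x
    using fin[of x] p_lcs[OF that] unfolding gr_def Let_def by (auto simp: \<psi>_def)
  have "lie_iso K L (gr K L) \<psi>"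
    unfolding lie_iso_def module_hom_def
  proof (intro conjI CollectI ballI allI impI)
    show "\<psi> \<in> carrier L \<rightarrow> carrier (gr K L)" using \<psi>_gr by auto
  next
    fix x y assume "x \<in> carrier L \<and> y \<in> carrier L"
    then show "\<psi> (x \<oplus>\<^bsub>L\<^esub> y) = \<psi> x \<oplus>\<^bsub>gr K L\<^esub> \<psi> y"
      by (auto simp: \<psi>_def gr_def Let_def p_add coset_add[OF lcs_subspace] fun_eq_iff)
  next
    fix a x assume "a \<in> carrier K \<and> x \<in> carrier L"
    then show "\<psi> (a \<odot>\<^bsub>L\<^esub> x) = a \<odot>\<^bsub>gr K L\<^esub> \<psi> x"
      by (auto simp: \<psi>_def gr_def Let_def p_smult coset_smult_coset[OF lcs_subspace] fun_eq_iff)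
  next
    show "bij_betw \<psi> (carrier L) (carrier (gr K L))"
    proof (rule bij_betw_imageI)
      show "inj_on \<psi> (carrier L)"
      proof (rule inj_onI)
        fix x y assume xy: "x \<in> carrier L" "y \<in> carrier L" "\<psi> x = \<psi> y"
        have "p i x = p i y" if i: "i \<in> {1..k}" for i
        proof -
          have "lcs K L (i + 1) +>\<^bsub>L\<^esub> p i x = lcs K L (i + 1) +>\<^bsub>L\<^esub> p i y"
            using fun_cong[OF xy(3), of i] i by (simp add: \<psi>_def)
          then have "p i x \<ominus>\<^bsub>L\<^esub> p i y \<in> lcs K L (i + 1)"
            using xy by (subst (asm) coset_eq_iff[OF lcs_subspace]) auto
          then have "p i (p i x \<ominus>\<^bsub>L\<^esub> p i y) = \<zero>\<^bsub>L\<^esub>"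
            by (subst (asm) lcs_iff) auto
          moreover have "p i (p i x \<ominus>\<^bsub>L\<^esub> p i y) = p i x \<ominus>\<^bsub>L\<^esub> p i y"
            using phomog[of "p i x \<ominus>\<^bsub>L\<^esub> p i y" i i] i pW xy subspaceD(6)[OF Wsub[OF i]] by simp
          ultimately show ?thesis using xy by simp
        qed
        then have "finsum L (\<lambda>i. p i x) {1..k} = finsum L (\<lambda>i. p i y) {1..k}"
          using xy by (intro M.finsum_cong') auto
        then show "x = y" using xy by (simp add: psum)
      qed
      have "F \<in> \<psi> ` carrier L" if F: "F \<in> carrier (gr K L)" for F
      proof -
        have FE: "F \<in> (\<Pi>\<^sub>E i\<in>{1..}. {lcs K L (i + 1) +>\<^bsub>L\<^esub> x |x. x \<in> lcs K L i})"
          using F by (simp add: gr_def Let_def)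
        have "\<exists>z. z \<in> lcs K L i \<and> F i = lcs K L (i + 1) +>\<^bsub>L\<^esub> z" if "1 \<le> i" for i
          using PiE_mem[OF FE, of i] that by auto
        then obtain z where z: "\<And>i. 1 \<le> i \<Longrightarrow> z i \<in> lcs K L i"
          "\<And>i. 1 \<le> i \<Longrightarrow> F i = lcs K L (i + 1) +>\<^bsub>L\<^esub> z i" by metis
        have zc: "z i \<in> carrier L" if "1 \<le> i" for i using z(1)[OF that] lcs_closed by auto
        \<comment> \<open>keep of each representative \<open>z i\<close> only its leading part, of degree \<open>i\<close>\<close>
        define x where "x = finsum L (\<lambda>i. p i (z i)) {1..k}"
        have x: "x \<in> carrier L" unfolding x_def using zc by (intro M.finsum_closed) auto
        have px: "p i x = p i (z i)" if "1 \<le> i" for i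
          using uniq[of "\<lambda>i. p i (z i)" i] pW zc p0[of i] that
          by (cases "i \<in> {1..k}") (auto simp: x_def)
        have "\<psi> x i = F i" if i: "1 \<le> i" for i
        proof -
          have "p i x \<ominus>\<^bsub>L\<^esub> z i \<in> lcs K L (i + 1)"
          proof (subst lcs_iff, simp, intro conjI allI impI)
            show "p i x \<ominus>\<^bsub>L\<^esub> z i \<in> carrier L" using x zc i by simp
            fix j assume j: "j < i + 1"
            have "p j (p i x \<ominus>\<^bsub>L\<^esub> z i) = p j (p i (z i)) \<ominus>\<^bsub>L\<^esub> p j (z i)"
              using module_hom_minus[OF phom vectorspace_axioms vectorspace_axioms] px[OF i] zc[OF i] by simp
            also have "\<dots> = \<zero>\<^bsub>L\<^esub>"
            proof (cases "j = i")
              case True then show ?thesis using pp zc[OF i] by simp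
            next
              case False
              then have "p j (z i) = \<zero>\<^bsub>L\<^esub>" "p j (p i (z i)) = \<zero>\<^bsub>L\<^esub>"
                using z(1)[OF i] p_lcs[OF zc[OF i] i] j unfolding lcs_iff[OF i] by auto
              then show ?thesis by (simp add: minus_zero)
            qed
            finally show "p j (p i x \<ominus>\<^bsub>L\<^esub> z i) = \<zero>\<^bsub>L\<^esub>" .
          qed
          then have "lcs K L (i + 1) +>\<^bsub>L\<^esub> p i x = lcs K L (i + 1) +>\<^bsub>L\<^esub> z i"
            using x zc[OF i] by (subst coset_eq_iff[OF lcs_subspace]) auto
          then show ?thesis using z(2)[OF i] i by (simp add: \<psi>_def)
        qed
        moreover have "\<psi> x i = F i" if "\<not> 1 \<le> i" for i
          using that PiE_arb[OF FE, of i] by (simp add: \<psi>_def)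
        ultimately have "\<psi> x = F" by blast
        then show ?thesis using x by blast
      qed
      then show "\<psi> ` carrier L = carrier (gr K L)" using \<psi>_gr by blast
    qed
  next
    fix x y assume xy: "x \<in> carrier L" "y \<in> carrier L"
    have "lcs K L (n + 1) +>\<^bsub>L\<^esub> p n \<lbrakk>x,y\<rbrakk>\<^bsub>L\<^esub> =
        finsum (lie_quot L (lcs K L (n + 1)))
          (\<lambda>i. coset_bracket L (lcs K L (n + 1)) (\<psi> x i) (\<psi> y (n - i))) {1..<n}" for n
    proof -
      let ?I = "lcs K L (n + 1)"
      interpret I: bilinear_algebra_ideal K L ?I by unfold_locales (rule lcs_ideal)
      interpret Q: bilinear_algebra K "lie_quot L ?I" by (rule I.quot_bilinear_algebra)
      have br: "coset_bracket L ?I (\<psi> x i) (\<psi> y (n - i)) = ?I +>\<^bsub>L\<^esub> \<lbrakk>p i x, p (n - i) y\<rbrakk>\<^bsub>L\<^esub>"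
        if i: "i \<in> {1..<n}" for i
      proof -
        have e: "i + 1 + (n - i) = n + 1" "i + (n - i + 1) = n + 1" using i by auto
        have g: "\<lbrakk>a,b\<rbrakk>\<^bsub>L\<^esub> \<in> ?I"
          if "a \<in> lcs K L (i + 1) \<and> b \<in> lcs K L (n - i) \<or> a \<in> lcs K L i \<and> b \<in> lcs K L (n - i + 1)"
          for a b
          using that i lcs_bracket_lcs[of "i + 1" "n - i" a b] lcs_bracket_lcs[of i "n - i + 1" a b]
          unfolding e by auto
        have "lcs K L (n - i + 1) \<subseteq> lcs K L (n - i)" by (rule lcs_antimono) simp
        then have "coset_bracket L ?I (lcs K L (i + 1) +>\<^bsub>L\<^esub> p i x) (lcs K L (n - i + 1) +>\<^bsub>L\<^esub> p (n - i) y)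
            = ?I +>\<^bsub>L\<^esub> \<lbrakk>p i x, p (n - i) y\<rbrakk>\<^bsub>L\<^esub>"
          using xy p_lcs i g
          by (intro coset_bracket_coset lcs_subspace) (auto simp del: lcs.simps)
        moreover have "1 \<le> n - i" using i by auto
        ultimately show ?thesis using i by (simp add: \<psi>_def del: lcs.simps)
      qed
      have "?I +>\<^bsub>L\<^esub> p n \<lbrakk>x,y\<rbrakk>\<^bsub>L\<^esub> = ?I +>\<^bsub>L\<^esub> finsum L (\<lambda>i. \<lbrakk>p i x, p (n - i) y\<rbrakk>\<^bsub>L\<^esub>) {1..<n}"
        by (simp only: pbracket[OF xy])
      also have "\<dots> = finsum (lie_quot L ?I) (\<lambda>i. ?I +>\<^bsub>L\<^esub> \<lbrakk>p i x, p (n - i) y\<rbrakk>\<^bsub>L\<^esub>) {1..<n}"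
        using xy by (intro module_hom_finsum[OF lie_homD(5)[OF I.quot_hom] vectorspace_axioms Q.vectorspace_axioms])
          (auto simp: bracket_closed)
      also have "\<dots> = finsum (lie_quot L ?I)
          (\<lambda>i. coset_bracket L ?I (\<psi> x i) (\<psi> y (n - i))) {1..<n}"
        using xy lie_homD(1)[OF I.quot_hom]
        by (intro Q.M.finsum_cong'[symmetric]) (auto simp: br bracket_closed simp del: lcs.simps)
      finally show ?thesis .
    qed
    then show "\<psi> \<lbrakk>x,y\<rbrakk>\<^bsub>L\<^esub> = \<lbrakk>\<psi> x, \<psi> y\<rbrakk>\<^bsub>gr K L\<^esub>"
      by (simp add: \<psi>_def[of "\<lbrakk>x,y\<rbrakk>\<^bsub>L\<^esub>"] gr_def Let_def del: lcs.simps cong: restrict_cong)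
  qed
  then show ?thesis unfolding naturally_graded_def by blast
qed

end

section \<open>The free algebra and the algebra of combs\<close>

definition monomial_fun :: "('a, 'k) ring_scheme \<Rightarrow> 'v monomial \<Rightarrow> 'v monomial \<Rightarrow> 'a" where
  "monomial_fun K t = (\<lambda>s. if s = t then \<one>\<^bsub>K\<^esub> else \<zero>\<^bsub>K\<^esub>)"

text \<open>
  This is the coefficient of the comb \<open>t\<close> in the image of \<open>f\<close> in a Lie algebra where only combs
  survive: the monomials that contribute to \<open>[s, u]\<close> are \<open>[x, u]\<close> and, with a minus sign,
  \<open>[u, x]\<close>, where \<open>x\<close> in turn contributes to \<open>s\<close>.
\<close>
primrec comb_coeff :: "('a, 'k) ring_scheme \<Rightarrow> 'v monomial \<Rightarrow> ('v monomial \<Rightarrow> 'a) \<Rightarrow> 'a" where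
  "comb_coeff K (Var v) f = f (Var v)"
| "comb_coeff K (Prod s u) f =
     comb_coeff K s (\<lambda>x. f (Prod x u)) \<ominus>\<^bsub>K\<^esub> comb_coeff K s (\<lambda>x. f (Prod u x))"

definition comb_algebra ::
  "('a, 'k) ring_scheme \<Rightarrow> 'v monomial set \<Rightarrow> ('a, 'v monomial \<Rightarrow> 'a) bracket_algebra" where
  "comb_algebra K T =
     \<lparr>carrier = {f. range f \<subseteq> carrier K \<and> (\<forall>t. t \<notin> T \<longrightarrow> f t = \<zero>\<^bsub>K\<^esub>)},
      mult = (\<lambda>f g t. \<zero>\<^bsub>K\<^esub>), one = (\<lambda>t. \<zero>\<^bsub>K\<^esub>), zero = (\<lambda>t. \<zero>\<^bsub>K\<^esub>),
      add = (\<lambda>f g t. f t \<oplus>\<^bsub>K\<^esub> g t),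
      smult = (\<lambda>a f t. a \<otimes>\<^bsub>K\<^esub> f t),
      bracket = (\<lambda>f g t. case t of Var v \<Rightarrow> \<zero>\<^bsub>K\<^esub> | Prod s u \<Rightarrow>
         if Prod s u \<in> T then f s \<otimes>\<^bsub>K\<^esub> g u \<ominus>\<^bsub>K\<^esub> f u \<otimes>\<^bsub>K\<^esub> g s else \<zero>\<^bsub>K\<^esub>)\<rparr>"

text \<open>
  The shape of a set of combs that contains every left factor of its members: right factors are
  variables, and the same variable along each comb.
\<close>
definition comb_closed :: "'v monomial set \<Rightarrow> bool" where
  "comb_closed T \<longleftrightarrow> (\<forall>s u. Prod s u \<in> T \<longrightarrow>
     s \<in> T \<and> u \<in> T \<and> (\<exists>j. u = Var j) \<and> ((\<exists>i. s = Var i) \<or> (\<exists>s'. s = Prod s' u)))"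

context field
begin

lemma function_space_vectorspace:
  fixes L :: "('a, 'c \<Rightarrow> 'a, 'm) module_scheme"
  assumes "add L = (\<lambda>f g t. f t \<oplus> g t)" "zero L = (\<lambda>t. \<zero>)" "smult L = (\<lambda>a f t. a \<otimes> f t)"
    and range: "\<And>f. f \<in> carrier L \<Longrightarrow> range f \<subseteq> carrier R"
    and closed: "\<zero>\<^bsub>L\<^esub> \<in> carrier L" "\<And>f g. f \<in> carrier L \<Longrightarrow> g \<in> carrier L \<Longrightarrow> f \<oplus>\<^bsub>L\<^esub> g \<in> carrier L"
      "\<And>a f. a \<in> carrier R \<Longrightarrow> f \<in> carrier L \<Longrightarrow> a \<odot>\<^bsub>L\<^esub> f \<in> carrier L"
  shows "vectorspace R L"
proof (rule vs_criteria)
  have c [simp]: "f t \<in> carrier R" if "f \<in> carrier L" for f t using range[OF that] by auto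
  note [simp] = assms(1-3)
  show "field R" by (rule field_axioms)
  show "\<zero>\<^bsub>L\<^esub> \<in> carrier L" by (rule closed)
  show "\<forall>v\<in>carrier L. \<exists>neg_v\<in>carrier L. v \<oplus>\<^bsub>L\<^esub> neg_v = \<zero>\<^bsub>L\<^esub>"
  proof
    fix v assume v: "v \<in> carrier L"
    have "\<ominus> \<one> \<otimes> x = \<ominus> x" if "x \<in> carrier R" for x using that by (simp add: l_minus)
    then have "v \<oplus>\<^bsub>L\<^esub> ((\<ominus> \<one>) \<odot>\<^bsub>L\<^esub> v) = \<zero>\<^bsub>L\<^esub>" using v by (simp add: r_neg)
    moreover have "(\<ominus> \<one>) \<odot>\<^bsub>L\<^esub> v \<in> carrier L" using v by (intro closed) auto
    ultimately show "\<exists>neg_v\<in>carrier L. v \<oplus>\<^bsub>L\<^esub> neg_v = \<zero>\<^bsub>L\<^esub>" by blast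
  qed
qed (use closed range in \<open>auto simp: assms(1-3) fun_eq_iff a_ac m_assoc l_distr r_distr image_subset_iff\<close>)

lemma free_algebra_bilinear: "bilinear_algebra R (free_algebra R V)"
proof -
  let ?F = "free_algebra R V"
  note [simp] = free_algebra_def
  have c: "f t \<in> carrier R" if "f \<in> carrier ?F" for f t using that by auto
  have "vectorspace R ?F"
  proof (rule function_space_vectorspace)
    fix f g assume fg: "f \<in> carrier ?F" "g \<in> carrier ?F"
    have "{t. (f \<oplus>\<^bsub>?F\<^esub> g) t \<noteq> \<zero>} \<subseteq> {t. f t \<noteq> \<zero>} \<union> {t. g t \<noteq> \<zero>}" using fg by auto
    then have fin: "finite {t. (f \<oplus>\<^bsub>?F\<^esub> g) t \<noteq> \<zero>}" by (rule finite_subset) (use fg in auto)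
    have "vars t \<subseteq> V" if "(f \<oplus>\<^bsub>?F\<^esub> g) t \<noteq> \<zero>" for t
    proof -
      have "f t \<noteq> \<zero> \<or> g t \<noteq> \<zero>" using that fg by auto
      then show ?thesis using fg by auto
    qed
    with fin show "f \<oplus>\<^bsub>?F\<^esub> g \<in> carrier ?F" using fg by (auto simp: image_subset_iff)
  next
    fix a f assume af: "a \<in> carrier R" "f \<in> carrier ?F"
    have "{t. (a \<odot>\<^bsub>?F\<^esub> f) t \<noteq> \<zero>} \<subseteq> {t. f t \<noteq> \<zero>}" using af by auto
    then have fin: "finite {t. (a \<odot>\<^bsub>?F\<^esub> f) t \<noteq> \<zero>}" by (rule finite_subset) (use af in auto)
    have "vars t \<subseteq> V" if "(a \<odot>\<^bsub>?F\<^esub> f) t \<noteq> \<zero>" for t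
    proof -
      have "f t \<noteq> \<zero>" using that af by auto
      then show ?thesis using af by auto
    qed
    with fin show "a \<odot>\<^bsub>?F\<^esub> f \<in> carrier ?F" using af by (auto simp: image_subset_iff)
  qed auto
  moreover have "bilinear_algebra_axioms R ?F"
  proof
    fix f g assume fg: "f \<in> carrier ?F" "g \<in> carrier ?F"
    have "{t. \<lbrakk>f,g\<rbrakk>\<^bsub>?F\<^esub> t \<noteq> \<zero>} \<subseteq> (\<lambda>(s, u). Prod s u) ` ({t. f t \<noteq> \<zero>} \<times> {t. g t \<noteq> \<zero>})"
    proof
      fix t assume t: "t \<in> {t. \<lbrakk>f,g\<rbrakk>\<^bsub>?F\<^esub> t \<noteq> \<zero>}"
      then obtain s u where su: "t = Prod s u" by (cases t) auto
      then have "f s \<noteq> \<zero>" "g u \<noteq> \<zero>" using t fg c[OF fg(1)] c[OF fg(2)] by auto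
      then show "t \<in> (\<lambda>(s, u). Prod s u) ` ({t. f t \<noteq> \<zero>} \<times> {t. g t \<noteq> \<zero>})" using su by auto
    qed
    then have fin: "finite {t. \<lbrakk>f,g\<rbrakk>\<^bsub>?F\<^esub> t \<noteq> \<zero>}"
      by (rule finite_subset) (use fg in auto)
    have "vars t \<subseteq> V" if t: "\<lbrakk>f,g\<rbrakk>\<^bsub>?F\<^esub> t \<noteq> \<zero>" for t
    proof -
      obtain s u where su: "t = Prod s u" using t by (cases t) auto
      then have "f s \<noteq> \<zero>" "g u \<noteq> \<zero>" using t fg c[OF fg(1)] c[OF fg(2)] by auto
      then show ?thesis using fg su by auto
    qed
    with fin show "\<lbrakk>f,g\<rbrakk>\<^bsub>?F\<^esub> \<in> carrier ?F"
      using fg by (auto simp: image_subset_iff split: monomial.splits)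
  qed (auto simp: fun_eq_iff image_subset_iff l_distr r_distr m_assoc m_lcomm split: monomial.splits)
  ultimately show ?thesis by (rule bilinear_algebra.intro)
qed

lemma monomial_fun_free: "vars t \<subseteq> V \<Longrightarrow> monomial_fun R t \<in> carrier (free_algebra R V)"
  by (auto simp: monomial_fun_def free_algebra_def)

lemma eval_monomial_free:
  "eval_monomial (free_algebra R V) (free_algebra_gen R) t = monomial_fun R t"
  by (induction t)
    (auto simp: monomial_fun_def free_algebra_gen_def free_algebra_def fun_eq_iff split: monomial.splits)

text \<open>
  The induction is on a finite set that contains the support, one monomial being split off at a
  time.
\<close>
lemma free_algebra_spanned:
  assumes U: "subspace R U (free_algebra R V)"
    and mono: "\<And>t. vars t \<subseteq> V \<Longrightarrow> monomial_fun R t \<in> U"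
  shows "carrier (free_algebra R V) \<subseteq> U"
proof
  interpret bilinear_algebra R "free_algebra R V" by (rule free_algebra_bilinear)
  fix f assume "f \<in> carrier (free_algebra R V)"
  moreover have "finite S \<Longrightarrow> f \<in> carrier (free_algebra R V) \<Longrightarrow> {t. f t \<noteq> \<zero>} \<subseteq> S \<Longrightarrow> f \<in> U" for S f
  proof (induction S arbitrary: f rule: finite_induct)
    case empty
    then have "f = \<zero>\<^bsub>free_algebra R V\<^esub>" by (auto simp: free_algebra_def)
    then show ?case using subspaceD(2)[OF U] by simp
  next
    case (insert t S)
    let ?h = "\<lambda>s. if s = t then \<zero> else f s"
    have fr: "f s \<in> carrier R" for s using insert.prems by (auto simp: free_algebra_def)
    have "finite {s. ?h s \<noteq> \<zero>}"
      by (rule finite_subset[of _ S]) (use insert in auto)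
    then have "?h \<in> carrier (free_algebra R V)"
      using insert.prems by (auto simp: free_algebra_def)
    then have h: "?h \<in> U" using insert by (intro insert.IH) auto
    show ?case
    proof (cases "f t = \<zero>")
      case True
      then have "?h = f" by auto
      then show ?thesis using h by simp
    next
      case False
      then have "vars t \<subseteq> V" using insert.prems by (auto simp: free_algebra_def)
      then have "f t \<odot>\<^bsub>free_algebra R V\<^esub> monomial_fun R t \<in> U"
        using mono fr by (intro subspaceD(4)[OF U])
      moreover have "f = ?h \<oplus>\<^bsub>free_algebra R V\<^esub> (f t \<odot>\<^bsub>free_algebra R V\<^esub> monomial_fun R t)"
        using fr by (auto simp: free_algebra_def monomial_fun_def)
      ultimately show ?thesis using subspaceD(3)[OF U h] by metis
    qed
  qed
  ultimately show "f \<in> U" by (auto simp: free_algebra_def)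
qed

lemma comb_coeff_closed: "range f \<subseteq> carrier R \<Longrightarrow> comb_coeff R t f \<in> carrier R"
  by (induction t arbitrary: f) (auto simp: image_subset_iff intro!: minus_closed)

lemma minus_add_minus:
  assumes "a \<in> carrier R" "b \<in> carrier R" "c \<in> carrier R" "d \<in> carrier R"
  shows "(a \<oplus> b) \<ominus> (c \<oplus> d) = (a \<ominus> c) \<oplus> (b \<ominus> d)"
  using assms by (simp add: a_minus_def minus_add a_ac)

lemma comb_coeff_add:
  "range f \<subseteq> carrier R \<Longrightarrow> range g \<subseteq> carrier R \<Longrightarrow>
    comb_coeff R t (\<lambda>x. f x \<oplus> g x) = comb_coeff R t f \<oplus> comb_coeff R t g"
proof (induction t arbitrary: f g)
  case (Prod s u)
  have "range (\<lambda>x. f (Prod x u)) \<subseteq> carrier R" "range (\<lambda>x. g (Prod x u)) \<subseteq> carrier R"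
    "range (\<lambda>x. f (Prod u x)) \<subseteq> carrier R" "range (\<lambda>x. g (Prod u x)) \<subseteq> carrier R"
    using Prod.prems by auto
  then show ?case by (simp add: Prod.IH minus_add_minus comb_coeff_closed)
qed simp

lemma comb_coeff_smult:
  "range f \<subseteq> carrier R \<Longrightarrow> a \<in> carrier R \<Longrightarrow>
    comb_coeff R t (\<lambda>x. a \<otimes> f x) = a \<otimes> comb_coeff R t f"
proof (induction t arbitrary: f)
  case (Prod s u)
  have "range (\<lambda>x. f (Prod x u)) \<subseteq> carrier R" "range (\<lambda>x. f (Prod u x)) \<subseteq> carrier R"
    using Prod.prems by auto
  then show ?case using Prod.prems
    by (simp add: Prod.IH a_minus_def comb_coeff_closed r_distr r_minus)
qed simp

text \<open>
  In a triple bracket only the value at a variable \<open>Var j\<close> of the outer factor and the value at \<open>s\<close>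
  of the inner bracket survive, since brackets vanish at variables.  If \<open>s\<close> is itself a variable,
  everything is zero; otherwise \<open>s = Prod s' (Var j)\<close> with the same \<open>j\<close>, and the six products
  \<open>x\<^sub>j y\<^sub>j z\<^sub>s\<^sub>'\<close> and so on cancel in pairs because scalars commute.
\<close>
lemma comb_algebra_lie:
  assumes T: "comb_closed T"
  shows "lie_algebra R (comb_algebra R T)"
proof (rule lie_algebraI)
  let ?M = "comb_algebra R T"
  note M = comb_algebra_def
  have c: "f t \<in> carrier R" if "f \<in> carrier ?M" for f t using that by (auto simp: M)
  have "vectorspace R ?M"
    by (rule function_space_vectorspace) (auto simp: M image_subset_iff)
  moreover have "bilinear_algebra_axioms R ?M"
  proof
    fix x y assume "x \<in> carrier ?M" "y \<in> carrier ?M"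
    then show "\<lbrakk>x,y\<rbrakk>\<^bsub>?M\<^esub> \<in> carrier ?M"
      by (auto simp: M image_subset_iff split: monomial.splits)
  next
    fix x y z assume xyz: "x \<in> carrier ?M" "y \<in> carrier ?M" "z \<in> carrier ?M"
    show "\<lbrakk>x \<oplus>\<^bsub>?M\<^esub> y, z\<rbrakk>\<^bsub>?M\<^esub> = \<lbrakk>x,z\<rbrakk>\<^bsub>?M\<^esub> \<oplus>\<^bsub>?M\<^esub> \<lbrakk>y,z\<rbrakk>\<^bsub>?M\<^esub>"
      using xyz[THEN c] by (auto simp: M fun_eq_iff l_distr minus_add_minus split: monomial.splits)
    show "\<lbrakk>x, y \<oplus>\<^bsub>?M\<^esub> z\<rbrakk>\<^bsub>?M\<^esub> = \<lbrakk>x,y\<rbrakk>\<^bsub>?M\<^esub> \<oplus>\<^bsub>?M\<^esub> \<lbrakk>x,z\<rbrakk>\<^bsub>?M\<^esub>"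
      using xyz[THEN c] by (auto simp: M fun_eq_iff r_distr minus_add_minus split: monomial.splits)
  next
    fix a x y assume a: "a \<in> carrier R" and xyz: "x \<in> carrier ?M" "y \<in> carrier ?M"
    have d: "a \<otimes> (p \<ominus> q) = a \<otimes> p \<ominus> a \<otimes> q" if "p \<in> carrier R" "q \<in> carrier R" for p q
      using a that by (simp add: a_minus_def r_distr r_minus)
    show "\<lbrakk>a \<odot>\<^bsub>?M\<^esub> x, y\<rbrakk>\<^bsub>?M\<^esub> = a \<odot>\<^bsub>?M\<^esub> \<lbrakk>x,y\<rbrakk>\<^bsub>?M\<^esub>"
      using a xyz[THEN c] by (auto simp: M fun_eq_iff d m_assoc split: monomial.splits)
    show "\<lbrakk>x, a \<odot>\<^bsub>?M\<^esub> y\<rbrakk>\<^bsub>?M\<^esub> = a \<odot>\<^bsub>?M\<^esub> \<lbrakk>x,y\<rbrakk>\<^bsub>?M\<^esub>"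
      using a xyz[THEN c] by (auto simp: M fun_eq_iff d m_lcomm split: monomial.splits)
  qed
  ultimately show "bilinear_algebra R ?M" by (rule bilinear_algebra.intro)
  fix x assume x: "x \<in> carrier ?M"
  show "\<lbrakk>x,x\<rbrakk>\<^bsub>?M\<^esub> = \<zero>\<^bsub>?M\<^esub>"
    using x[THEN c] by (auto simp: M fun_eq_iff m_comm split: monomial.splits)
  fix y z assume yz: "y \<in> carrier ?M" "z \<in> carrier ?M"
  note c = x[THEN c] yz[THEN c]
  show "\<lbrakk>x, \<lbrakk>y,z\<rbrakk>\<^bsub>?M\<^esub>\<rbrakk>\<^bsub>?M\<^esub> \<oplus>\<^bsub>?M\<^esub> \<lbrakk>y, \<lbrakk>z,x\<rbrakk>\<^bsub>?M\<^esub>\<rbrakk>\<^bsub>?M\<^esub> \<oplus>\<^bsub>?M\<^esub> \<lbrakk>z, \<lbrakk>x,y\<rbrakk>\<^bsub>?M\<^esub>\<rbrakk>\<^bsub>?M\<^esub> = \<zero>\<^bsub>?M\<^esub>"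
  proof
    fix t
    show "(\<lbrakk>x, \<lbrakk>y,z\<rbrakk>\<^bsub>?M\<^esub>\<rbrakk>\<^bsub>?M\<^esub> \<oplus>\<^bsub>?M\<^esub> \<lbrakk>y, \<lbrakk>z,x\<rbrakk>\<^bsub>?M\<^esub>\<rbrakk>\<^bsub>?M\<^esub> \<oplus>\<^bsub>?M\<^esub> \<lbrakk>z, \<lbrakk>x,y\<rbrakk>\<^bsub>?M\<^esub>\<rbrakk>\<^bsub>?M\<^esub>) t = \<zero>\<^bsub>?M\<^esub> t"
    proof (cases "\<exists>s u. t = Prod s u \<and> t \<in> T")
      case True
      then obtain s j where t: "t = Prod s (Var j)" "t \<in> T" and "s \<in> T"
        and s: "(\<exists>i. s = Var i) \<or> (\<exists>s'. s = Prod s' (Var j))"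
        using T unfolding comb_closed_def by blast
      from s show ?thesis
      proof
        assume "\<exists>i. s = Var i"
        then show ?thesis using t c by (auto simp: M a_minus_def)
      next
        assume "\<exists>s'. s = Prod s' (Var j)"
        then obtain s' where s': "s = Prod s' (Var j)" by blast
        let ?a = "x (Var j)" and ?b = "y (Var j)" and ?c = "z (Var j)"
        have "\<ominus> (?a \<otimes> (y s' \<otimes> ?c \<ominus> ?b \<otimes> z s')) \<oplus> \<ominus> (?b \<otimes> (z s' \<otimes> ?a \<ominus> ?c \<otimes> x s'))
            \<oplus> \<ominus> (?c \<otimes> (x s' \<otimes> ?b \<ominus> ?a \<otimes> y s')) = \<zero>"
        proof -
          have "p \<oplus> q \<oplus> r = \<zero>" if "p = u \<ominus> v" "q = w \<ominus> u" "r = v \<ominus> w"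
            "u \<in> carrier R" "v \<in> carrier R" "w \<in> carrier R" for p q r u v w
            using that by (simp add: a_minus_def a_ac r_neg r_neg1 r_neg2)
          note * = this
          show ?thesis
            by (rule *[of _ "?a \<otimes> ?b \<otimes> z s'" "?a \<otimes> ?c \<otimes> y s'" _ "?b \<otimes> ?c \<otimes> x s'"])
              (use c in \<open>simp_all add: a_minus_def r_distr r_minus minus_add m_ac a_ac\<close>)
        qed
        then show ?thesis using t s' c \<open>s \<in> T\<close> by (simp add: M a_minus_def)
      qed
    qed (auto simp: M split: monomial.splits)
  qed
qed

text \<open>
  Compatibility with brackets is checked at \<open>Prod s (Var j)\<close>: there the two terms of the recursion
  for \<open>comb_coeff\<close> freeze one factor of the bracket at \<open>Var j\<close>, and linearity of
  \<open>comb_coeff\<close> at \<open>s\<close> takes it out as a scalar.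
\<close>
lemma comb_coeff_hom:
  assumes T: "comb_closed T"
  shows "lie_hom R (free_algebra R V) (comb_algebra R T)
    (\<lambda>f t. if t \<in> T then comb_coeff R t f else \<zero>)"
proof (rule lie_homI)
  let ?F = "free_algebra R V" and ?M = "comb_algebra R T"
  let ?\<pi> = "\<lambda>f t. if t \<in> T then comb_coeff R t f else \<zero>"
  have r: "range f \<subseteq> carrier R" if "f \<in> carrier ?F" for f using that by (auto simp: free_algebra_def)
  fix f assume f: "f \<in> carrier ?F"
  show "?\<pi> f \<in> carrier ?M" using comb_coeff_closed[OF r[OF f]] by (auto simp: comb_algebra_def)
  show "?\<pi> (a \<odot>\<^bsub>?F\<^esub> f) = a \<odot>\<^bsub>?M\<^esub> ?\<pi> f" if "a \<in> carrier R" for a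
    using that r f by (auto simp: free_algebra_def comb_algebra_def fun_eq_iff comb_coeff_smult)
  fix g assume g: "g \<in> carrier ?F"
  show "?\<pi> (f \<oplus>\<^bsub>?F\<^esub> g) = ?\<pi> f \<oplus>\<^bsub>?M\<^esub> ?\<pi> g"
    using r[OF f] r[OF g] by (simp add: free_algebra_def comb_algebra_def fun_eq_iff comb_coeff_add)
  have v: "f t \<in> carrier R" "g t \<in> carrier R" for t using r[OF f] r[OF g] by auto
  show "?\<pi> \<lbrakk>f,g\<rbrakk>\<^bsub>?F\<^esub> = \<lbrakk>?\<pi> f, ?\<pi> g\<rbrakk>\<^bsub>?M\<^esub>"
  proof
    fix t
    show "?\<pi> \<lbrakk>f,g\<rbrakk>\<^bsub>?F\<^esub> t = \<lbrakk>?\<pi> f, ?\<pi> g\<rbrakk>\<^bsub>?M\<^esub> t"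
    proof (cases "\<exists>s u. t = Prod s u \<and> t \<in> T")
      case True
      then obtain s j where t: "t = Prod s (Var j)" "t \<in> T" "s \<in> T" "Var j \<in> T"
        using T unfolding comb_closed_def by blast
      have 1: "comb_coeff R s (\<lambda>x. f x \<otimes> g (Var j)) = comb_coeff R s f \<otimes> g (Var j)"
        using comb_coeff_smult[OF r[OF f] v(2)[of "Var j"], of s] v comb_coeff_closed[OF r[OF f]]
        by (simp add: m_comm)
      have 2: "comb_coeff R s (\<lambda>x. f (Var j) \<otimes> g x) = f (Var j) \<otimes> comb_coeff R s g"
        using comb_coeff_smult[OF r[OF g] v(1)[of "Var j"], of s] by simp
      show ?thesis using t by (simp add: free_algebra_def comb_algebra_def 1 2)
    qed (auto simp: free_algebra_def comb_algebra_def split: monomial.splits)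
  qed
qed

end

section \<open>Algebras with comb coordinates\<close>

context field
begin

lemma monomial_fun_comb_algebra: "t \<in> T \<Longrightarrow> monomial_fun R t \<in> carrier (comb_algebra R T)"
  by (auto simp: monomial_fun_def comb_algebra_def)

lemma comb_algebra_bracket_monomials:
  assumes T: "comb_closed T"
  shows "\<lbrakk>monomial_fun R x, monomial_fun R y\<rbrakk>\<^bsub>comb_algebra R T\<^esub> t =
    (if t \<in> T \<and> t = Prod x y then \<one> else \<zero>) \<ominus> (if t \<in> T \<and> t = Prod y x then \<one> else \<zero>)"
proof (cases t)
  case (Prod s u)
  then show ?thesis by (cases "s = x"; cases "u = y"; cases "s = y"; cases "u = x")
      (simp_all add: comb_algebra_def monomial_fun_def a_minus_def)
qed (simp add: comb_algebra_def a_minus_def)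

end

text \<open>
  An isomorphism with the algebra of combs, together with the elements \<open>b t\<close> that it sends to the
  indicator functions.  The antisymmetry of \<open>T\<close> says that \<open>[b x, b y]\<close> never involves two combs,
  \<open>Prod x y\<close> and \<open>Prod y x\<close>, at once.
\<close>
locale comb_coordinates = lie_algebra K L
  for K (structure) and L :: "('a, 'b, 'm) bracket_algebra_scheme" (structure) +
  fixes T :: "'v monomial set" and \<phi> :: "'b \<Rightarrow> 'v monomial \<Rightarrow> 'a" and b :: "'v monomial \<Rightarrow> 'b"
  assumes T_closed: "comb_closed T" and T_finite: "finite T"
    and T_antisym: "Prod x y \<in> T \<Longrightarrow> Prod y x \<notin> T"
    and \<phi>_hom: "lie_hom K L (comb_algebra K T) \<phi>" and \<phi>_bij: "bij_betw \<phi> (carrier L) (carrier (comb_algebra K T))"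
    and b_closed: "t \<in> T \<Longrightarrow> b t \<in> carrier L" and \<phi>_b: "t \<in> T \<Longrightarrow> \<phi> (b t) = monomial_fun K t"
begin

lemma \<phi>_closed: "x \<in> carrier L \<Longrightarrow> \<phi> x t \<in> carrier K"
  using lie_homD(1)[OF \<phi>_hom, of x] by (auto simp: comb_algebra_def)

lemma \<phi>_outside: "x \<in> carrier L \<Longrightarrow> t \<notin> T \<Longrightarrow> \<phi> x t = \<zero>\<^bsub>K\<^esub>"
  using lie_homD(1)[OF \<phi>_hom, of x] by (auto simp: comb_algebra_def)

lemma \<phi>_add: "x \<in> carrier L \<Longrightarrow> y \<in> carrier L \<Longrightarrow> \<phi> (x \<oplus>\<^bsub>L\<^esub> y) t = \<phi> x t \<oplus>\<^bsub>K\<^esub> \<phi> y t"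
  using lie_homD(2)[OF \<phi>_hom, of x y] by (simp add: comb_algebra_def)

lemma \<phi>_smult: "a \<in> carrier K \<Longrightarrow> x \<in> carrier L \<Longrightarrow> \<phi> (a \<odot>\<^bsub>L\<^esub> x) t = a \<otimes>\<^bsub>K\<^esub> \<phi> x t"
  using lie_homD(3)[OF \<phi>_hom, of a x] by (simp add: comb_algebra_def)

lemma \<phi>_zero: "\<phi> \<zero>\<^bsub>L\<^esub> t = \<zero>\<^bsub>K\<^esub>"
  using \<phi>_smult[of "\<zero>\<^bsub>K\<^esub>" "\<zero>\<^bsub>L\<^esub>" t] \<phi>_closed[of "\<zero>\<^bsub>L\<^esub>" t] by simp

lemma \<phi>_eqI:
  assumes "x \<in> carrier L" "y \<in> carrier L" "\<And>t. t \<in> T \<Longrightarrow> \<phi> x t = \<phi> y t"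
  shows "x = y"
proof -
  have "\<phi> x = \<phi> y"
  proof
    fix t show "\<phi> x t = \<phi> y t" using assms \<phi>_outside by (cases "t \<in> T") auto
  qed
  then show ?thesis using \<phi>_bij assms(1,2) by (auto simp: bij_betw_def dest: inj_onD)
qed

lemma \<phi>_finsum:
  assumes "f \<in> J \<rightarrow> carrier L"
  shows "\<phi> (finsum L f J) t = finsum K (\<lambda>i. \<phi> (f i) t) J"
  using assms
proof (induction J rule: infinite_finite_induct)
  case (insert i J)
  then have "f \<in> J \<rightarrow> carrier L" "f i \<in> carrier L" by auto
  moreover from this have "(\<lambda>i. \<phi> (f i) t) \<in> J \<rightarrow> carrier K" "\<phi> (f i) t \<in> carrier K"
    using \<phi>_closed by auto
  ultimately show ?case using insert.IH insert.hyps
    by (simp add: \<phi>_add R.finsum_insert)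
qed (simp_all add: \<phi>_zero)

lemma \<phi>_bracket:
  assumes "x \<in> carrier L" "y \<in> carrier L"
  shows "\<phi> \<lbrakk>x,y\<rbrakk>\<^bsub>L\<^esub> (Var v) = \<zero>\<^bsub>K\<^esub>"
    "Prod s u \<in> T \<Longrightarrow> \<phi> \<lbrakk>x,y\<rbrakk>\<^bsub>L\<^esub> (Prod s u) = \<phi> x s \<otimes>\<^bsub>K\<^esub> \<phi> y u \<ominus>\<^bsub>K\<^esub> \<phi> x u \<otimes>\<^bsub>K\<^esub> \<phi> y s"
  using lie_homD(4)[OF \<phi>_hom assms] by (simp_all add: comb_algebra_def)

lemma b_bracket:
  assumes "x \<in> T" "y \<in> T"
  shows "Prod x y \<in> T \<Longrightarrow> \<lbrakk>b x, b y\<rbrakk>\<^bsub>L\<^esub> = b (Prod x y)"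
    "Prod x y \<notin> T \<Longrightarrow> Prod y x \<notin> T \<Longrightarrow> \<lbrakk>b x, b y\<rbrakk>\<^bsub>L\<^esub> = \<zero>\<^bsub>L\<^esub>"
proof -
  have *: "\<phi> \<lbrakk>b x, b y\<rbrakk>\<^bsub>L\<^esub> t =
    (if t \<in> T \<and> t = Prod x y then \<one>\<^bsub>K\<^esub> else \<zero>\<^bsub>K\<^esub>) \<ominus>\<^bsub>K\<^esub> (if t \<in> T \<and> t = Prod y x then \<one>\<^bsub>K\<^esub> else \<zero>\<^bsub>K\<^esub>)" for t
    using comb_algebra_bracket_monomials[OF T_closed, of x y t]
    by (simp only: lie_homD(4)[OF \<phi>_hom b_closed[OF assms(1)] b_closed[OF assms(2)]]
        \<phi>_b[OF assms(1)] \<phi>_b[OF assms(2)])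
  have c: "\<lbrakk>b x, b y\<rbrakk>\<^bsub>L\<^esub> \<in> carrier L" using assms by (simp add: b_closed bracket_closed)
  show "\<lbrakk>b x, b y\<rbrakk>\<^bsub>L\<^esub> = b (Prod x y)" if "Prod x y \<in> T"
    using that T_antisym[OF that] c b_closed[OF that]
    by (intro \<phi>_eqI) (auto simp: * \<phi>_b monomial_fun_def a_minus_def)
  show "\<lbrakk>b x, b y\<rbrakk>\<^bsub>L\<^esub> = \<zero>\<^bsub>L\<^esub>" if "Prod x y \<notin> T" "Prod y x \<notin> T"
  proof (rule \<phi>_eqI[OF c])
    fix t assume "t \<in> T"
    then have "t \<noteq> Prod x y" "t \<noteq> Prod y x" using that by auto
    then show "\<phi> \<lbrakk>b x, b y\<rbrakk>\<^bsub>L\<^esub> t = \<phi> \<zero>\<^bsub>L\<^esub> t" unfolding * \<phi>_zero by (simp add: a_minus_def)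
  qed simp
qed

lemma b_nonzero: "t \<in> T \<Longrightarrow> b t \<noteq> \<zero>\<^bsub>L\<^esub>"
  using \<phi>_b[of t] \<phi>_zero[of t] by (auto simp: monomial_fun_def)

lemma b_inj: "inj_on b T"
proof (rule inj_onI)
  fix s t assume "s \<in> T" "t \<in> T" "b s = b t"
  then have "monomial_fun K s = monomial_fun K t" using \<phi>_b by metis
  from fun_cong[OF this, of s] show "s = t" by (auto simp: monomial_fun_def split: if_splits)
qed

lemma support_subspace: "subspace K {x \<in> carrier L. \<forall>t. P t \<longrightarrow> \<phi> x t = \<zero>\<^bsub>K\<^esub>} L"
  by (rule subspaceI) (auto simp: \<phi>_zero \<phi>_add \<phi>_smult)

lemma expansion:
  assumes "x \<in> carrier L" "S \<subseteq> T" "\<And>t. t \<notin> S \<Longrightarrow> \<phi> x t = \<zero>\<^bsub>K\<^esub>"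
  shows "finsum L (\<lambda>t. \<phi> x t \<odot>\<^bsub>L\<^esub> b t) S = x"
proof (rule \<phi>_eqI)
  have c: "(\<lambda>t. \<phi> x t \<odot>\<^bsub>L\<^esub> b t) \<in> S \<rightarrow> carrier L" using assms(1,2) b_closed \<phi>_closed by auto
  then show "finsum L (\<lambda>t. \<phi> x t \<odot>\<^bsub>L\<^esub> b t) S \<in> carrier L" by simp
  have fin: "finite S" using assms(2) T_finite by (rule finite_subset)
  fix t assume "t \<in> T"
  have "\<phi> (finsum L (\<lambda>t. \<phi> x t \<odot>\<^bsub>L\<^esub> b t) S) t = finsum K (\<lambda>s. \<phi> (\<phi> x s \<odot>\<^bsub>L\<^esub> b s) t) S"
    by (rule \<phi>_finsum[OF c])
  also have "\<dots> = finsum K (\<lambda>s. if s = t then \<phi> x s else \<zero>\<^bsub>K\<^esub>) S"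
    using assms(1,2) b_closed \<phi>_closed \<phi>_b
    by (intro R.finsum_cong') (auto simp: \<phi>_smult monomial_fun_def subset_iff)
  also have "\<dots> = \<phi> x t"
  proof (cases "t \<in> S")
    case True
    then show ?thesis
      using R.add.finprod_singleton_swap[of t S "\<phi> x"] fin \<phi>_closed[OF assms(1)] by auto
  next
    case False
    then show ?thesis using assms(3)[OF False] R.add.finprod_one_eqI[of S "\<lambda>s. if s = t then \<phi> x s else \<zero>\<^bsub>K\<^esub>"] by auto
  qed
  finally show "\<phi> (finsum L (\<lambda>t. \<phi> x t \<odot>\<^bsub>L\<^esub> b t) S) t = \<phi> x t" .
qed (rule assms)

lemma subspace_finsum:
  assumes "subspace K W L" "f \<in> J \<rightarrow> W"
  shows "finsum L f J \<in> W"
  using assms(2)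
proof (induction J rule: infinite_finite_induct)
  case (insert i J)
  then have "f \<in> J \<rightarrow> W" "f i \<in> W" by auto
  moreover from this have "f \<in> J \<rightarrow> carrier L" "f i \<in> carrier L"
    using subspaceD(1)[OF assms(1)] by auto
  ultimately show ?case using insert subspaceD(3)[OF assms(1)] by simp
qed (simp_all add: subspaceD(2)[OF assms(1)])

lemma lspan_b:
  assumes "S \<subseteq> T"
  shows "lspan K L (b ` S) = {x \<in> carrier L. \<forall>t. t \<notin> S \<longrightarrow> \<phi> x t = \<zero>\<^bsub>K\<^esub>}"
proof
  have c: "b ` S \<subseteq> carrier L" using assms b_closed by auto
  show "lspan K L (b ` S) \<subseteq> {x \<in> carrier L. \<forall>t. t \<notin> S \<longrightarrow> \<phi> x t = \<zero>\<^bsub>K\<^esub>}"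
    using c \<phi>_b assms by (intro lspan_least support_subspace) (auto simp: monomial_fun_def)
  show "{x \<in> carrier L. \<forall>t. t \<notin> S \<longrightarrow> \<phi> x t = \<zero>\<^bsub>K\<^esub>} \<subseteq> lspan K L (b ` S)"
  proof safe
    fix x assume x: "x \<in> carrier L" "\<forall>t. t \<notin> S \<longrightarrow> \<phi> x t = \<zero>\<^bsub>K\<^esub>"
    have "finsum L (\<lambda>t. \<phi> x t \<odot>\<^bsub>L\<^esub> b t) S \<in> lspan K L (b ` S)"
      using lspan_superset[OF c] \<phi>_closed[OF x(1)] subspaceD(4)[OF lspan_subspace[OF c]]
      by (intro subspace_finsum lspan_subspace c) auto
    then show "x \<in> lspan K L (b ` S)" using expansion[OF x(1) assms] x(2) by simp
  qed
qed

lemma basis_b: "basis (b ` T)"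
proof -
  have c: "b ` T \<subseteq> carrier L" using b_closed by auto
  have "lspan K L (b ` T) = carrier L" unfolding lspan_b[OF order_refl] using \<phi>_outside by auto
  moreover have "lin_indpt (b ` T)"
  proof (rule finite_lin_indpt2)
    fix a assume a: "a \<in> b ` T \<rightarrow> carrier K" "lincomb a (b ` T) = \<zero>\<^bsub>L\<^esub>"
    have "a (b t) = \<zero>\<^bsub>K\<^esub>" if t: "t \<in> T" for t
    proof -
      have ac: "a (b s) \<in> carrier K" if "s \<in> T" for s using a(1) that by auto
      have "lincomb a (b ` T) = finsum L (\<lambda>s. a (b s) \<odot>\<^bsub>L\<^esub> b s) T"
        unfolding lincomb_def using b_inj ac b_closed by (subst M.add.finprod_reindex) auto
      then have "\<zero>\<^bsub>K\<^esub> = \<phi> (finsum L (\<lambda>s. a (b s) \<odot>\<^bsub>L\<^esub> b s) T) t" using a(2) \<phi>_zero by simp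
      also have "\<dots> = finsum K (\<lambda>s. \<phi> (a (b s) \<odot>\<^bsub>L\<^esub> b s) t) T"
        using ac b_closed by (intro \<phi>_finsum) auto
      also have "\<dots> = finsum K (\<lambda>s. if s = t then a (b s) else \<zero>\<^bsub>K\<^esub>) T"
        using ac b_closed \<phi>_b by (intro R.finsum_cong') (auto simp: \<phi>_smult monomial_fun_def)
      also have "\<dots> = a (b t)"
        using R.add.finprod_singleton_swap[of t T "\<lambda>s. a (b s)"] T_finite ac t by auto
      finally show ?thesis by simp
    qed
    then show "\<forall>x\<in>b ` T. a x = \<zero>\<^bsub>K\<^esub>" by auto
  qed (use T_finite c in auto)
  ultimately show ?thesis using c by (simp add: basis_def)
qed

text \<open>
  The values of \<open>[x, y]\<close> at a comb of weight at most \<open>n\<close> only use values of \<open>y\<close> at combs of smaller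
  weight, which gives one inclusion.  For the other one, a comb of weight greater than \<open>n\<close> is the
  bracket of a comb of weight at least \<open>n\<close> with a variable.
\<close>
lemma lcs_coordinates:
  assumes "1 \<le> n"
  shows "lcs K L n = {x \<in> carrier L. \<forall>t. leaves t < n \<longrightarrow> \<phi> x t = \<zero>\<^bsub>K\<^esub>}"
  using assms
proof (induction n rule: dec_induct)
  case base
  show ?case by simp
next
  case (step n)
  let ?C = "\<lambda>n. {x \<in> carrier L. \<forall>t. leaves t < n \<longrightarrow> \<phi> x t = \<zero>\<^bsub>K\<^esub>}"
  have "lcs K L (Suc n) \<subseteq> ?C (Suc n)"
  proof (rule lcs_Suc_least[OF step(1) support_subspace])
    fix x y assume x: "x \<in> carrier L" and "y \<in> lcs K L n"
    then have y: "y \<in> carrier L" "\<And>t. leaves t < n \<Longrightarrow> \<phi> y t = \<zero>\<^bsub>K\<^esub>" using step.IH by auto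
    have "\<phi> \<lbrakk>x,y\<rbrakk>\<^bsub>L\<^esub> t = \<zero>\<^bsub>K\<^esub>" if t: "leaves t < Suc n" for t
    proof (cases t)
      case (Prod s u)
      have "leaves s < n" "leaves u < n" using t Prod leaves_pos[of s] leaves_pos[of u] by auto
      then have "\<phi> y s = \<zero>\<^bsub>K\<^esub>" "\<phi> y u = \<zero>\<^bsub>K\<^esub>" using y by auto
      then show ?thesis
        using Prod x y \<phi>_closed[OF x] \<phi>_bracket[OF x y(1)] \<phi>_outside[OF bracket_closed[OF x y(1)], of t]
        by (cases "t \<in> T") (auto simp: a_minus_def)
    qed (simp add: \<phi>_bracket x y)
    then show "\<lbrakk>x,y\<rbrakk>\<^bsub>L\<^esub> \<in> ?C (Suc n)" using x y by (simp add: bracket_closed)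
  qed
  moreover have "?C (Suc n) \<subseteq> lcs K L (Suc n)"
  proof -
    let ?S = "{t \<in> T. Suc n \<le> leaves t}"
    have "?C (Suc n) \<subseteq> lspan K L (b ` ?S)"
      by (subst lspan_b) (use \<phi>_outside in \<open>auto simp: not_le\<close>)
    also have "\<dots> \<subseteq> lcs K L (Suc n)"
    proof (rule lspan_least[OF _ lcs_subspace], safe)
      fix t assume t: "t \<in> T" "Suc n \<le> leaves t"
      then obtain s u where su: "t = Prod s u" using step(1) by (cases t) auto
      with t T_closed obtain j where j: "u = Var j" "s \<in> T" "u \<in> T" unfolding comb_closed_def by blast
      have "b s \<in> lcs K L n"
        unfolding step.IH using j su t b_closed by (auto simp: \<phi>_b monomial_fun_def)
      then have "\<lbrakk>b s, b u\<rbrakk>\<^bsub>L\<^esub> \<in> lcs K L (Suc n)"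
        using lcs_Suc_mem[OF step(1) b_closed[OF j(3)]] subspaceD(5)[OF lcs_subspace]
          bracket_skew[OF b_closed[OF j(3)] b_closed[OF j(2)]] by simp
      then show "b t \<in> lcs K L (Suc n)" using b_bracket(1)[OF j(2,3)] t(1) su by simp
    qed
    finally show ?thesis .
  qed
  ultimately show ?case by (rule equalityI)
qed

lemma step_nilpotent_coordinates:
  assumes "1 \<le> k" "\<And>t. t \<in> T \<Longrightarrow> leaves t \<le> k" "t \<in> T" "leaves t = k"
  shows "step_nilpotent K L k"
proof -
  have "x = \<zero>\<^bsub>L\<^esub>" if "x \<in> lcs K L (k + 1)" for x
    using that assms(2) lcs_coordinates[of "k + 1"]
    by (intro \<phi>_eqI) (auto simp: \<phi>_zero less_Suc_eq_le simp del: lcs.simps)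
  moreover have "b t \<in> lcs K L k"
    unfolding lcs_coordinates[OF assms(1)] using b_closed assms(3,4)
    by (auto simp: \<phi>_b monomial_fun_def)
  ultimately show ?thesis
    unfolding step_nilpotent_def using b_nonzero[OF assms(3)] subspaceD(2)[OF lcs_subspace] by blast
qed

text \<open>
  Functions decompose uniquely according to any partition of their domain, here by weight.
\<close>
lemma direct_sum_coordinates:
  assumes "finite J" and W: "\<And>i. i \<in> J \<Longrightarrow> W i = {x \<in> carrier L. \<forall>t. leaves t \<noteq> i \<longrightarrow> \<phi> x t = \<zero>\<^bsub>K\<^esub>}"
  shows "is_direct_sum K L {x \<in> carrier L. \<forall>t. leaves t \<notin> J \<longrightarrow> \<phi> x t = \<zero>\<^bsub>K\<^esub>} W J"
  unfolding is_direct_sum_def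
proof (intro conjI ballI)
  show "subspace K (W i) L" if "i \<in> J" for i unfolding W[OF that] by (rule support_subspace)
  let ?D = "{x \<in> carrier L. \<forall>t. leaves t \<notin> J \<longrightarrow> \<phi> x t = \<zero>\<^bsub>K\<^esub>}"
  have coord: "\<phi> (finsum L f J) t = (if leaves t \<in> J then \<phi> (f (leaves t)) t else \<zero>\<^bsub>K\<^esub>)"
    if f: "\<And>i. i \<in> J \<Longrightarrow> f i \<in> W i" for f t
  proof -
    have fc: "f i \<in> carrier L" if "i \<in> J" for i using f[OF that] W[OF that] by auto
    have fz: "\<phi> (f i) t = \<zero>\<^bsub>K\<^esub>" if "i \<in> J" "i \<noteq> leaves t" for i using f W that by auto
    have "\<phi> (finsum L f J) t = finsum K (\<lambda>i. \<phi> (f i) t) J" using fc by (intro \<phi>_finsum) auto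
    also have "\<dots> = finsum K (\<lambda>i. if i = leaves t then \<phi> (f i) t else \<zero>\<^bsub>K\<^esub>) J"
      using fc fz \<phi>_closed by (intro R.finsum_cong') auto
    also have "\<dots> = (if leaves t \<in> J then \<phi> (f (leaves t)) t else \<zero>\<^bsub>K\<^esub>)"
    proof (cases "leaves t \<in> J")
      case True
      then show ?thesis
        using R.add.finprod_singleton_swap[of "leaves t" J "\<lambda>i. \<phi> (f i) t"] fc \<phi>_closed assms(1) by auto
    next
      case False
      then have "finsum K (\<lambda>i. if i = leaves t then \<phi> (f i) t else \<zero>\<^bsub>K\<^esub>) J = \<zero>\<^bsub>K\<^esub>"
        by (intro R.add.finprod_one_eqI) auto
      then show ?thesis using False by simp
    qed
    finally show ?thesis .
  qed
  show "bij_betw (\<lambda>x. finsum L x J) (\<Pi>\<^sub>E i\<in>J. W i) ?D"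
  proof (rule bij_betw_imageI)
    show "inj_on (\<lambda>x. finsum L x J) (\<Pi>\<^sub>E i\<in>J. W i)"
    proof (rule inj_onI)
      fix f g assume fg: "f \<in> (\<Pi>\<^sub>E i\<in>J. W i)" "g \<in> (\<Pi>\<^sub>E i\<in>J. W i)" "finsum L f J = finsum L g J"
      have m: "f i \<in> W i" "g i \<in> W i" if "i \<in> J" for i
        using PiE_mem[OF fg(1) that] PiE_mem[OF fg(2) that] by auto
      show "f = g"
      proof (rule PiE_ext[OF fg(1,2)])
        fix i assume i: "i \<in> J"
        show "f i = g i"
        proof (rule \<phi>_eqI)
          show "f i \<in> carrier L" "g i \<in> carrier L" using m[OF i] W[OF i] by auto
          fix t
          show "\<phi> (f i) t = \<phi> (g i) t"
            using coord[of f t] coord[of g t] m fg(3) i m[OF i] W[OF i] by (cases "leaves t = i") auto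
        qed
      qed
    qed
    show "(\<lambda>x. finsum L x J) ` (\<Pi>\<^sub>E i\<in>J. W i) = ?D"
    proof
      show "(\<lambda>x. finsum L x J) ` (\<Pi>\<^sub>E i\<in>J. W i) \<subseteq> ?D"
      proof (rule image_subsetI)
        fix f assume f: "f \<in> (\<Pi>\<^sub>E i\<in>J. W i)"
        have m: "f i \<in> W i" if "i \<in> J" for i using PiE_mem[OF f that] by auto
        then have "finsum L f J \<in> carrier L" using W by (intro M.finsum_closed) auto
        then show "finsum L f J \<in> ?D" using coord[OF m] by simp
      qed
      show "?D \<subseteq> (\<lambda>x. finsum L x J) ` (\<Pi>\<^sub>E i\<in>J. W i)"
      proof
        fix x assume x: "x \<in> ?D"
        have "\<exists>y\<in>carrier L. \<phi> y = (\<lambda>t. if leaves t = i then \<phi> x t else \<zero>\<^bsub>K\<^esub>)" for i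
        proof -
          have "(\<lambda>t. if leaves t = i then \<phi> x t else \<zero>\<^bsub>K\<^esub>) \<in> carrier (comb_algebra K T)"
            using x \<phi>_closed \<phi>_outside by (auto simp: comb_algebra_def)
          then show ?thesis
            unfolding bij_betw_imp_surj_on[OF \<phi>_bij, symmetric] by (elim imageE) (metis (no_types))
        qed
        then obtain p where p: "\<And>i. p i \<in> carrier L"
          "\<And>i. \<phi> (p i) = (\<lambda>t. if leaves t = i then \<phi> x t else \<zero>\<^bsub>K\<^esub>)" by metis
        have m: "restrict p J i \<in> W i" if "i \<in> J" for i unfolding W[OF that] using p that by simp
        then have r: "restrict p J \<in> (\<Pi>\<^sub>E i\<in>J. W i)" by auto
        have "x = finsum L (restrict p J) J"
        proof (rule \<phi>_eqI)
          show "finsum L (restrict p J) J \<in> carrier L" using p by (intro M.finsum_closed) auto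
          fix t show "\<phi> x t = \<phi> (finsum L (restrict p J) J) t"
            using coord[of "restrict p J" t, OF m] x p(2) by simp
        qed (use x in auto)
        then show "x \<in> (\<lambda>x. finsum L x J) ` (\<Pi>\<^sub>E i\<in>J. W i)" using r by (rule image_eqI)
      qed
    qed
  qed
qed

lemma carnot_grading_coordinates:
  assumes T_le: "\<And>t. t \<in> T \<Longrightarrow> leaves t \<le> k"
    and W: "\<And>l. l \<in> {1..k} \<Longrightarrow> W l = lspan K L (b ` {t \<in> T. leaves t = l})"
  shows "carnot_grading K L k W"
proof -
  have W': "W l = {x \<in> carrier L. \<forall>t. leaves t \<noteq> l \<longrightarrow> \<phi> x t = \<zero>\<^bsub>K\<^esub>}" if "l \<in> {1..k}" for l
    unfolding W[OF that] by (subst lspan_b) (use \<phi>_outside in auto)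
  have lcs_eq: "lcs K L i = {x \<in> carrier L. \<forall>t. leaves t \<notin> {i..k} \<longrightarrow> \<phi> x t = \<zero>\<^bsub>K\<^esub>}" if "1 \<le> i" for i
  proof -
    have "\<phi> x t = \<zero>\<^bsub>K\<^esub>" if "x \<in> carrier L" "\<not> leaves t \<le> k" for x t
      using \<phi>_outside[OF that(1)] T_le that(2) by blast
    then show ?thesis unfolding lcs_coordinates[OF that] by (auto simp: not_le)
  qed
  have ds: "is_direct_sum K L (lcs K L i) W {i..k}" if "1 \<le> i" for i
    unfolding lcs_eq[OF that] by (rule direct_sum_coordinates) (use W' that in auto)
  have br: "bracket_space K L (W i) (W j) \<subseteq> (if i + j \<le> k then W (i + j) else {\<zero>\<^bsub>L\<^esub>})"
    if ij: "i \<in> {1..k}" "j \<in> {1..k}" for i j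
  proof -
    let ?D = "{x \<in> carrier L. \<forall>t. leaves t \<noteq> i + j \<longrightarrow> \<phi> x t = \<zero>\<^bsub>K\<^esub>}"
    have "bracket_space K L (W i) (W j) \<subseteq> ?D"
    proof (rule bracket_space_least[OF support_subspace])
      fix x y assume "x \<in> W i" "y \<in> W j"
      then have x: "x \<in> carrier L" "\<And>t. leaves t \<noteq> i \<Longrightarrow> \<phi> x t = \<zero>\<^bsub>K\<^esub>"
        and y: "y \<in> carrier L" "\<And>t. leaves t \<noteq> j \<Longrightarrow> \<phi> y t = \<zero>\<^bsub>K\<^esub>" using W' ij by auto
      have "\<phi> \<lbrakk>x,y\<rbrakk>\<^bsub>L\<^esub> t = \<zero>\<^bsub>K\<^esub>" if t: "leaves t \<noteq> i + j" for t
      proof (cases t)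
        case (Prod s u)
        have "\<phi> x s \<otimes>\<^bsub>K\<^esub> \<phi> y u = \<zero>\<^bsub>K\<^esub>" "\<phi> x u \<otimes>\<^bsub>K\<^esub> \<phi> y s = \<zero>\<^bsub>K\<^esub>"
          using x(2)[of s] x(2)[of u] y(2)[of s] y(2)[of u] t Prod \<phi>_closed[OF x(1)] \<phi>_closed[OF y(1)]
          by (cases "leaves s = i"; cases "leaves u = i"; auto)+
        then show ?thesis
          using Prod \<phi>_bracket(2)[OF x(1) y(1), of s u] \<phi>_outside[OF bracket_closed[OF x(1) y(1)], of t]
          by (cases "t \<in> T") (auto simp: a_minus_def)
      qed (simp add: \<phi>_bracket x y)
      then show "\<lbrakk>x,y\<rbrakk>\<^bsub>L\<^esub> \<in> ?D" using x y by (simp add: bracket_closed)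
    qed
    also have "?D \<subseteq> (if i + j \<le> k then W (i + j) else {\<zero>\<^bsub>L\<^esub>})"
    proof (cases "i + j \<le> k")
      case True
      then show ?thesis using W'[of "i + j"] ij by simp
    next
      case False
      have "x = \<zero>\<^bsub>L\<^esub>" if "x \<in> ?D" for x
        using that False T_le by (intro \<phi>_eqI) (force simp: \<phi>_zero)+
      then show ?thesis using False by auto
    qed
    finally show ?thesis .
  qed
  show ?thesis unfolding carnot_grading_def using ds[of 1] ds br by simp
qed

end

section \<open>Evaluation of monomials in a Lie algebra\<close>

text \<open>
  The index counts brackets, so \<open>comb i j n\<close> is the monomial behind \<open>w\<^sub>i\<^sub>j\<^sup>n\<^sup>+\<^sup>1\<close>.
\<close>
primrec comb :: "'v \<Rightarrow> 'v \<Rightarrow> nat \<Rightarrow> 'v monomial" where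
  "comb i j 0 = Var i"
| "comb i j (Suc n) = Prod (comb i j n) (Var j)"

lemma leaves_comb [simp]: "leaves (comb i j n) = Suc n"
  by (induction n) auto

lemma iter_bracket_comb: "iter_bracket A (g i) (g j) (Suc n) = eval_monomial A g (comb i j n)"
  by (induction n) auto

lemma comb_inject:
  "comb i j (Suc n) = comb i' j' (Suc m) \<longleftrightarrow> i = i' \<and> j = j' \<and> n = m"
proof
  assume *: "comb i j (Suc n) = comb i' j' (Suc m)"
  then have "leaves (comb i j (Suc n)) = leaves (comb i' j' (Suc m))" by (rule arg_cong)
  then have "n = m" by (simp only: leaves_comb nat.inject)
  moreover have "comb i j n = comb i' j' n \<Longrightarrow> i = i'" for n by (induction n) auto
  ultimately show "i = i' \<and> j = j' \<and> n = m" using * by auto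
qed simp
lemma vars_comb: "vars (comb i j n) \<subseteq> {i, j}"
  by (induction n) auto

lemma multideg_comb: "multideg (comb i j n) = (\<lambda>u. unit_deg i u + n * unit_deg j u)"
  by (induction n) (auto simp: fun_eq_iff)

lemma multideg_eq_0_iff: "multideg t v = 0 \<longleftrightarrow> v \<notin> vars t"
  by (induction t) (auto simp: unit_deg_def)

lemma sum_multideg: "finite V \<Longrightarrow> vars t \<subseteq> V \<Longrightarrow> (\<Sum>u\<in>V. multideg t u) = leaves t"
  by (induction t) (auto simp: unit_deg_def sum.distrib)

lemma leaves_1_iff: "leaves t = 1 \<longleftrightarrow> (\<exists>v. t = Var v)"
proof (cases t)
  case (Prod s u)
  then show ?thesis using leaves_pos[of s] leaves_pos[of u] by auto
qed auto

definition comb_monomials :: "'v set \<Rightarrow> ('v \<times> 'v) set \<Rightarrow> ('v \<times> 'v \<Rightarrow> nat) \<Rightarrow> 'v monomial set" where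
  "comb_monomials V E \<kappa> = Var ` V \<union> {comb i j n |i j n. (i, j) \<in> E \<and> 1 \<le> n \<and> n < \<kappa> (i, j)}"

context lie_algebra
begin

text \<open>
  The innermost bracket of such a monomial is \<open>[v\<^sub>j, v\<^sub>j]\<close>.
\<close>
lemma eval_monomial_one_var:
  assumes "vars t \<subseteq> {j}" "2 \<le> leaves t" "g j \<in> carrier L"
  shows "eval_monomial L g t = \<zero>\<^bsub>L\<^esub>"
  using assms(1,2)
proof (induction t)
  case (Prod s u)
  have c: "eval_monomial L g s \<in> carrier L" "eval_monomial L g u \<in> carrier L"
    using Prod.prems assms(3) by (auto intro!: eval_monomial_closed)
  show ?case
  proof (cases "2 \<le> leaves s \<or> 2 \<le> leaves u")
    case True
    then show ?thesis using Prod c by auto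
  next
    case False
    then have "leaves s = 1" "leaves u = 1" using leaves_pos[of s] leaves_pos[of u] by auto
    then have "s = Var j" "u = Var j" using Prod.prems unfolding leaves_1_iff by auto
    then show ?thesis using assms(3) by (simp add: bracket_self)
  qed
qed simp

text \<open>
  Of the two factors of the monomial, one is linear in \<open>v\<^sub>i\<close> and, by induction, a multiple of a
  comb; the other only contains \<open>v\<^sub>j\<close>, so it is \<open>v\<^sub>j\<close> itself or vanishes.  A factor \<open>v\<^sub>j\<close> on
  the left is moved to the right by skew-symmetry.
\<close>
lemma eval_monomial_comb:
  assumes "i \<noteq> j" "g i \<in> carrier L" "g j \<in> carrier L" "vars t \<subseteq> {i, j}" "multideg t i = 1"
  shows "\<exists>a\<in>carrier K. eval_monomial L g t = a \<odot>\<^bsub>L\<^esub> eval_monomial L g (comb i j (leaves t - 1))"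
  using assms(4,5)
proof (induction t)
  case (Var v)
  then have "v = i" by (auto simp: unit_deg_def split: if_splits)
  then show ?case using assms(2) by (intro bexI[of _ "\<one>\<^bsub>K\<^esub>"]) auto
next
  case (Prod s u)
  have zero: "\<exists>a\<in>carrier K. \<zero>\<^bsub>L\<^esub> = a \<odot>\<^bsub>L\<^esub> eval_monomial L g (comb i j n)" for n
  proof -
    have "g ` vars (comb i j n) \<subseteq> carrier L" using vars_comb[of i j n] assms(2,3) by auto
    from eval_monomial_closed[OF this] show ?thesis by (intro bexI[of _ "\<zero>\<^bsub>K\<^esub>"]) auto
  qed
  have c: "eval_monomial L g x \<in> carrier L" if "vars x \<subseteq> {i, j}" for x
    using that assms(2,3) by (intro eval_monomial_closed) auto
  have main: "\<exists>a\<in>carrier K. \<lbrakk>eval_monomial L g x, eval_monomial L g y\<rbrakk>\<^bsub>L\<^esub>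
      = a \<odot>\<^bsub>L\<^esub> eval_monomial L g (comb i j (leaves x + leaves y - 1))"
    if xy: "vars x \<subseteq> {i, j}" "vars y \<subseteq> {j}"
      "\<exists>a\<in>carrier K. eval_monomial L g x = a \<odot>\<^bsub>L\<^esub> eval_monomial L g (comb i j (leaves x - 1))" for x y
  proof (cases "leaves y = 1")
    case True
    then have y: "y = Var j" using xy(2) unfolding leaves_1_iff by auto
    obtain n where n: "leaves x = Suc n" using leaves_pos[of x] by (cases "leaves x") auto
    obtain a where a: "a \<in> carrier K" "eval_monomial L g x = a \<odot>\<^bsub>L\<^esub> eval_monomial L g (comb i j n)"
      using xy(3) n by auto
    show ?thesis
      using a assms(3) c[OF vars_comb[of i j n]]
      by (intro bexI[of _ a]) (simp_all add: n y bracket_smult_left)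
  next
    case False
    then have "eval_monomial L g y = \<zero>\<^bsub>L\<^esub>"
      using xy(2) assms(3) leaves_pos[of y] by (intro eval_monomial_one_var) auto
    then show ?thesis using zero c[OF xy(1)] by simp
  qed
  show ?case
  proof (cases "multideg u i = 0")
    case True
    then have "multideg s i = 1" using Prod.prems by simp
    moreover have "i \<notin> vars u" using True by (simp add: multideg_eq_0_iff)
    moreover from this have "vars u \<subseteq> {j}" using Prod.prems by auto
    ultimately show ?thesis using main[of s u] Prod by simp
  next
    case False
    then have u: "multideg s i = 0" "multideg u i = 1" using Prod.prems by auto
    then have s: "vars s \<subseteq> {j}" using Prod.prems by (auto simp: multideg_eq_0_iff)
    obtain a where a: "a \<in> carrier K" "\<lbrakk>eval_monomial L g u, eval_monomial L g s\<rbrakk>\<^bsub>L\<^esub>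
        = a \<odot>\<^bsub>L\<^esub> eval_monomial L g (comb i j (leaves s + leaves u - 1))"
      using main[of u s] Prod s u by (auto simp: add.commute)
    have "\<lbrakk>eval_monomial L g s, eval_monomial L g u\<rbrakk>\<^bsub>L\<^esub>
        = (\<ominus>\<^bsub>K\<^esub> a) \<odot>\<^bsub>L\<^esub> eval_monomial L g (comb i j (leaves s + leaves u - 1))"
      using bracket_skew[of "eval_monomial L g u" "eval_monomial L g s"] a c[OF vars_comb] c[of s] c[of u]
        Prod.prems smult_l_minus[of a] by simp
    then show ?thesis using a(1) by (intro bexI[of _ "\<ominus>\<^bsub>K\<^esub> a"]) simp_all
  qed
qed

end

lemma lie_hom_lcs:
  assumes "lie_hom K A B \<phi>" "lie_algebra K A" "lie_algebra K B" "x \<in> lcs K A n"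
  shows "\<phi> x \<in> lcs K B n"
proof -
  interpret A: lie_algebra K A by fact
  interpret B: lie_algebra K B by fact
  note hom = lie_homD[OF assms(1)]
  have z: "\<phi> \<zero>\<^bsub>A\<^esub> = \<zero>\<^bsub>B\<^esub>"
    using hom(5) A.vectorspace_axioms B.vectorspace_axioms by (rule module_hom_zero)
  show ?thesis using assms(4)
  proof (induction n arbitrary: x)
    case 0
    then show ?case using hom(1) by simp
  next
    case (Suc n)
    show ?case
    proof (cases "n = 0")
      case True
      then show ?thesis using Suc.prems hom(1) by simp
    next
      case False
      let ?W = "{x \<in> carrier A. \<phi> x \<in> lcs K B (Suc n)}"
      have "subspace K ?W A"
        using B.subspaceD(2-4)[OF B.lcs_subspace[of "Suc n"]]
        by (intro A.subspaceI) (simp_all add: hom z del: lcs.simps)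
      then have "lcs K A (Suc n) \<subseteq> ?W"
        using False Suc.IH hom A.lcs_closed B.lcs_Suc_mem[of n] A.bracket_closed
        by (intro A.lcs_Suc_least) (auto simp del: lcs.simps)
      then show ?thesis using Suc.prems by blast
    qed
  qed
qed

text \<open>
  Stated by means of subspaces, so that it passes to quotients by taking preimages and can be used
  directly as an induction principle.
\<close>
definition monomials_span ::
  "('a, 'k) ring_scheme \<Rightarrow> ('a, 'b, 'm) bracket_algebra_scheme \<Rightarrow> 'v set \<Rightarrow> ('v \<Rightarrow> 'b) \<Rightarrow> bool" where
  "monomials_span K A V g \<longleftrightarrow> (\<forall>U. subspace K U A \<longrightarrow>
     (\<forall>t. vars t \<subseteq> V \<longrightarrow> eval_monomial A g t \<in> U) \<longrightarrow> carrier A \<subseteq> U)"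

lemma (in bilinear_algebra) subspace_vimage:
  assumes "lie_hom K A B \<phi>" "bilinear_algebra K B" "subspace K U B"
  shows "subspace K {x \<in> carrier A. \<phi> x \<in> U} A"
proof -
  interpret B: bilinear_algebra K B by fact
  note hom = lie_homD[OF assms(1)]
  have "\<phi> \<zero>\<^bsub>A\<^esub> = \<zero>\<^bsub>B\<^esub>"
    using hom(5) vectorspace_axioms B.vectorspace_axioms by (rule module_hom_zero)
  then show ?thesis using B.subspaceD(2-4)[OF assms(3)] by (intro subspaceI) (auto simp: hom)
qed

lemma (in bilinear_algebra_ideal) quot_monomials_span:
  assumes "monomials_span K A V g" "g ` V \<subseteq> carrier A"
  shows "monomials_span K (lie_quot A I) V (\<lambda>v. I +>\<^bsub>A\<^esub> g v)"
  unfolding monomials_span_def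
proof (intro allI impI)
  fix U assume U: "subspace K U (lie_quot A I)"
    "\<forall>t. vars t \<subseteq> V \<longrightarrow> eval_monomial (lie_quot A I) (\<lambda>v. I +>\<^bsub>A\<^esub> g v) t \<in> U"
  have "carrier A \<subseteq> {x \<in> carrier A. I +>\<^bsub>A\<^esub> x \<in> U}"
    using assms(1) subspace_vimage[OF quot_hom quot_bilinear_algebra U(1)]
    unfolding monomials_span_def
  proof (elim allE[of _ "{x \<in> carrier A. I +>\<^bsub>A\<^esub> x \<in> U}"] impE)
    show "\<forall>t. vars t \<subseteq> V \<longrightarrow> eval_monomial A g t \<in> {x \<in> carrier A. I +>\<^bsub>A\<^esub> x \<in> U}"
    proof (intro allI impI)
      fix t assume t: "vars t \<subseteq> V"
      then have c: "g ` vars t \<subseteq> carrier A" using assms(2) by auto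
      show "eval_monomial A g t \<in> {x \<in> carrier A. I +>\<^bsub>A\<^esub> x \<in> U}"
        using U(2) t eval_monomial_closed[OF c] eval_monomial_hom[OF quot_hom bilinear_algebra_axioms c] by simp
    qed
  qed auto
  then show "carrier (lie_quot A I) \<subseteq> U" unfolding carrier_quot by auto
qed

section \<open>From the free algebra to the graph algebra\<close>

locale chain_digraph_algebra = chain_digraph V E \<kappa> + field K
  for V :: "'v set" and E :: "('v \<times> 'v) set" and \<kappa> :: "'v \<times> 'v \<Rightarrow> nat"
    and K :: "('a, 'r) ring_scheme" (structure) +
  assumes nonempty: "E \<noteq> {}"
begin

abbreviation "k \<equiv> chain_step E \<kappa>"
abbreviation "T \<equiv> comb_monomials V E \<kappa>"
abbreviation "model \<equiv> comb_algebra K T"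
abbreviation "graph_alg \<equiv> graph_lie K k V E"
abbreviation "gen \<equiv> graph_gen K k V E"

lemma finite_edges: "finite E"
  using edges finite_vertices by (meson finite_SigmaI finite_subset)

lemma kappa_le: "e \<in> E \<Longrightarrow> \<kappa> e \<le> k"
  using finite_edges by (simp add: chain_step_def)

lemma kappa_attained: "\<exists>e\<in>E. \<kappa> e = k"
proof -
  have "Max (\<kappa> ` E) \<in> \<kappa> ` E" using finite_edges nonempty by (intro Max_in) auto
  then show ?thesis unfolding chain_step_def by force
qed

lemma k_ge_2: "2 \<le> k"
  using kappa_attained kappa_ge_2 by fastforce

lemma comb_in_T: "(i, j) \<in> E \<Longrightarrow> n < \<kappa> (i, j) \<Longrightarrow> comb i j n \<in> T"
  using edges by (cases n) (force simp: comb_monomials_def)+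

lemma Var_in_T: "v \<in> V \<Longrightarrow> Var v \<in> T"
  by (simp add: comb_monomials_def)

lemma T_cases:
  assumes "t \<in> T"
  obtains v where "v \<in> V" "t = Var v"
    | i j n where "(i, j) \<in> E" "Suc n < \<kappa> (i, j)" "t = comb i j (Suc n)"
proof -
  consider "t \<in> Var ` V" | "t \<in> {comb i j n |i j n. (i, j) \<in> E \<and> 1 \<le> n \<and> n < \<kappa> (i, j)}"
    using assms by (auto simp: comb_monomials_def)
  then show thesis
  proof cases
    case 2
    then obtain i j n where "(i, j) \<in> E" "1 \<le> n" "n < \<kappa> (i, j)" "t = comb i j n" by blast
    then show thesis using that(2)[of i j "n - 1"] by simp
  qed (use that in auto)
qed

lemma finite_T: "finite T"
proof -
  have "{comb i j n |i j n. (i, j) \<in> E \<and> 1 \<le> n \<and> n < \<kappa> (i, j)} \<subseteq> (\<lambda>((i, j), n). comb i j n) ` (E \<times> {..k})"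
  proof safe
    fix i j n assume "(i, j) \<in> E" "n < \<kappa> (i, j)"
    then have "((i, j), n) \<in> E \<times> {..k}" using kappa_le[of "(i, j)"] by auto
    then show "comb i j n \<in> (\<lambda>((i, j), n). comb i j n) ` (E \<times> {..k})"
      by (rule rev_image_eqI) simp
  qed
  then have "finite {comb i j n |i j n. (i, j) \<in> E \<and> 1 \<le> n \<and> n < \<kappa> (i, j)}"
    by (rule finite_subset) (simp add: finite_edges)
  then show ?thesis using finite_vertices by (simp add: comb_monomials_def)
qed

lemma leaves_T: "t \<in> T \<Longrightarrow> leaves t \<le> k"
proof (erule T_cases)
  fix i j n assume "(i, j) \<in> E" "Suc n < \<kappa> (i, j)" "t = comb i j (Suc n)"
  then show ?thesis using kappa_le[of "(i, j)"] by simp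
qed (use k_ge_2 in simp)

lemma vars_T: "t \<in> T \<Longrightarrow> vars t \<subseteq> V"
proof (erule T_cases)
  fix i j n assume "(i, j) \<in> E" "t = comb i j (Suc n)"
  then show ?thesis using vars_comb[of i j "Suc n"] edges by auto
qed simp

lemma Prod_in_T:
  assumes "Prod s u \<in> T"
  obtains i j n where "(i, j) \<in> E" "Suc n < \<kappa> (i, j)" "s = comb i j n" "u = Var j"
  using assms by (auto elim: T_cases)

lemma T_closed: "comb_closed T"
  unfolding comb_closed_def
proof (intro allI impI)
  fix s u assume "Prod s u \<in> T"
  then obtain i j n where *: "(i, j) \<in> E" "Suc n < \<kappa> (i, j)" "s = comb i j n" "u = Var j"
    by (rule Prod_in_T)
  have "(\<exists>i. s = Var i) \<or> (\<exists>s'. s = Prod s' u)" using * by (cases n) auto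
  then show "s \<in> T \<and> u \<in> T \<and> (\<exists>j. u = Var j) \<and> ((\<exists>i. s = Var i) \<or> (\<exists>s'. s = Prod s' u))"
    using * comb_in_T[of i j n] edges by (auto intro: Var_in_T)
qed

lemma T_antisym:
  assumes "Prod x y \<in> T"
  shows "Prod y x \<notin> T"
proof
  assume "Prod y x \<in> T"
  from this obtain i j n where 1: "(i, j) \<in> E" "y = comb i j n" "x = Var j" by (rule Prod_in_T)
  from assms obtain i' j' n' where 2: "(i', j') \<in> E" "x = comb i' j' n'" "y = Var j'" by (rule Prod_in_T)
  have "i = j'" "i' = j" using 1 2 by (cases n; cases n'; simp)+
  then show False using 1 2 oriented by blast
qed

interpretation model: lie_algebra K model
  by (rule comb_algebra_lie[OF T_closed])

text \<open>
  The algebra of combs has itself as coordinates; its nilpotency is thus an instance of the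
  description of the lower central series.
\<close>
interpretation model: comb_coordinates K model T "\<lambda>x. x" "monomial_fun K"
  by unfold_locales
    (auto simp: T_closed finite_T T_antisym monomial_fun_comb_algebra bij_betw_def intro: lie_homI)

lemma model_nilpotent:
  assumes "f \<in> lcs K model (k + 1)"
  shows "f = \<zero>\<^bsub>model\<^esub>"
proof (rule model.\<phi>_eqI)
  have f: "f \<in> carrier model" "\<And>t. leaves t < k + 1 \<Longrightarrow> f t = \<zero>"
    using assms model.lcs_coordinates[of "k + 1"] by auto
  then show "f \<in> carrier model" by simp
  show "f t = \<zero>\<^bsub>model\<^esub> t" if "t \<in> T" for t
    using f(2)[of t] leaves_T[OF that] by (simp add: model.\<phi>_zero)
qed simp

interpretation F: bilinear_algebra K "free_algebra K V"
  by (rule free_algebra_bilinear)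

lemma lie_relations_closed: "lie_relations (free_algebra K V) \<subseteq> carrier (free_algebra K V)"
  by (auto simp: lie_relations_def F.br_closed)

interpretation F: bilinear_algebra_ideal K "free_algebra K V" "free_lie_ideal K V"
  by unfold_locales (simp add: free_lie_ideal_def F.lie_ideal_generated lie_relations_closed)

interpretation FL: lie_algebra K "free_lie K V"
  unfolding free_lie_def
  by (rule F.quot_relations_lie_algebra)
    (simp add: free_lie_ideal_def F.lie_ideal_generated lie_relations_closed)

interpretation FL: bilinear_algebra_ideal K "free_lie K V" "lcs K (free_lie K V) (k + 1)"
  by unfold_locales (rule FL.lcs_ideal)

interpretation N: lie_algebra K "free_nilpotent K k V"
  unfolding free_nilpotent_def by (rule FL.quot_lie_algebra) (rule FL.lcs_ideal)

lemma free_algebra_gen_closed: "v \<in> V \<Longrightarrow> free_algebra_gen K v \<in> carrier (free_algebra K V)"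
  using monomial_fun_free[of "Var v" V] by (simp add: monomial_fun_def free_algebra_gen_def)

lemma free_lie_gen_closed: "v \<in> V \<Longrightarrow> free_lie_gen K V v \<in> carrier (free_lie K V)"
  using lie_homD(1)[OF F.quot_hom free_algebra_gen_closed] by (simp add: free_lie_gen_def free_lie_def)

lemma free_nilpotent_gen_closed:
  "v \<in> V \<Longrightarrow> free_nilpotent_gen K k V v \<in> carrier (free_nilpotent K k V)"
  using lie_homD(1)[OF FL.quot_hom free_lie_gen_closed]
  by (simp add: free_nilpotent_gen_def free_nilpotent_def)

definition nonedge_brackets :: "('v monomial \<Rightarrow> 'a) set set set" where
  "nonedge_brackets = {\<lbrakk>free_nilpotent_gen K k V u, free_nilpotent_gen K k V v\<rbrakk>\<^bsub>free_nilpotent K k V\<^esub>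
        |u v. u \<in> V \<and> v \<in> V \<and> (u, v) \<notin> E \<and> (v, u) \<notin> E}"

lemma graph_ideal_eq:
  "graph_ideal K k V E = ideal_generated K (free_nilpotent K k V) nonedge_brackets"
  by (simp add: graph_ideal_def nonedge_brackets_def)

lemma nonedge_brackets_closed: "nonedge_brackets \<subseteq> carrier (free_nilpotent K k V)"
  by (auto simp: nonedge_brackets_def intro!: N.bracket_closed free_nilpotent_gen_closed)

interpretation N: bilinear_algebra_ideal K "free_nilpotent K k V" "graph_ideal K k V E"
  by unfold_locales
    (unfold graph_ideal_eq, rule N.lie_ideal_generated(1)[OF nonedge_brackets_closed])

lemma graph_lie_algebra: "lie_algebra K graph_alg"
  unfolding graph_lie_def by (rule N.quot_lie_algebra) (rule N.ideal)

interpretation G: lie_algebra K graph_alg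
  by (rule graph_lie_algebra)

lemma gen_closed: "v \<in> V \<Longrightarrow> gen v \<in> carrier graph_alg"
  using lie_homD(1)[OF N.quot_hom free_nilpotent_gen_closed]
  by (simp add: graph_gen_def graph_lie_def)

lemma gen_nonedge:
  assumes "u \<in> V" "v \<in> V" "(u, v) \<notin> E" "(v, u) \<notin> E"
  shows "\<lbrakk>gen u, gen v\<rbrakk>\<^bsub>graph_alg\<^esub> = \<zero>\<^bsub>graph_alg\<^esub>"
proof -
  let ?x = "\<lbrakk>free_nilpotent_gen K k V u, free_nilpotent_gen K k V v\<rbrakk>\<^bsub>free_nilpotent K k V\<^esub>"
  have "?x \<in> nonedge_brackets" using assms unfolding nonedge_brackets_def by blast
  then have x: "?x \<in> graph_ideal K k V E" "?x \<in> carrier (free_nilpotent K k V)"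
    using nonedge_brackets_closed N.lie_ideal_generated(2)[OF nonedge_brackets_closed]
    unfolding graph_ideal_eq by auto
  show ?thesis
    unfolding graph_gen_def graph_lie_def
    using lie_homD(4)[OF N.quot_hom free_nilpotent_gen_closed free_nilpotent_gen_closed, OF assms(1,2)]
      x(1) N.quot_eq_zero_iff[OF x(2)] by simp
qed

lemma eval_monomial_nilpotent:
  assumes t: "vars t \<subseteq> V" "k < leaves t"
  shows "eval_monomial graph_alg gen t = \<zero>\<^bsub>graph_alg\<^esub>"
proof -
  have 1: "free_lie_gen K V ` vars t \<subseteq> carrier (free_lie K V)" using t free_lie_gen_closed by auto
  have 2: "free_nilpotent_gen K k V ` vars t \<subseteq> carrier (free_nilpotent K k V)"
    using t free_nilpotent_gen_closed by auto
  have "eval_monomial (free_lie K V) (free_lie_gen K V) t \<in> lcs K (free_lie K V) (leaves t)"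
    by (rule FL.eval_monomial_lcs[OF 1])
  then have "eval_monomial (free_lie K V) (free_lie_gen K V) t \<in> lcs K (free_lie K V) (k + 1)"
    using FL.lcs_antimono[of "k + 1" "leaves t"] t(2) by auto
  then have "eval_monomial (free_nilpotent K k V) (free_nilpotent_gen K k V) t = \<zero>\<^bsub>free_nilpotent K k V\<^esub>"
    using eval_monomial_hom[OF FL.quot_hom FL.bilinear_algebra_axioms 1]
      FL.quot_eq_zero_iff[OF FL.eval_monomial_closed[OF 1]]
    by (simp add: free_nilpotent_def free_nilpotent_gen_def[abs_def])
  then show ?thesis
    using eval_monomial_hom[OF N.quot_hom N.bilinear_algebra_axioms 2]
      N.quot_eq_zero_iff[OF N.M.zero_closed] N.subspaceD(2)[OF N.ideal_subspace]
    by (simp add: graph_lie_def graph_gen_def[abs_def])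
qed

lemma graph_monomials_span: "monomials_span K graph_alg V gen"
proof -
  have "monomials_span K (free_algebra K V) V (free_algebra_gen K)"
    unfolding monomials_span_def eval_monomial_free
    by (intro allI impI) (rule free_algebra_spanned, auto)
  then have "monomials_span K (free_lie K V) V (free_lie_gen K V)"
    unfolding free_lie_def free_lie_gen_def[abs_def]
    by (rule F.quot_monomials_span) (auto simp: free_algebra_gen_closed)
  then have "monomials_span K (free_nilpotent K k V) V (free_nilpotent_gen K k V)"
    unfolding free_nilpotent_def free_nilpotent_gen_def[abs_def]
    by (rule FL.quot_monomials_span) (auto simp: free_lie_gen_closed)
  then show ?thesis
    unfolding graph_lie_def graph_gen_def[abs_def]
    by (rule N.quot_monomials_span) (auto simp: free_nilpotent_gen_closed)
qed

text \<open>
  Each of the three quotients is by an ideal on which the map into the model vanishes: the Lie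
  relations hold in the model, its lower central series is zero from \<open>k + 1\<close> on, and none of its combs starts with a
  non-edge.
\<close>
lemma graph_lie_hom_model:
  obtains \<phi> where "lie_hom K graph_alg model \<phi>" "\<And>v. v \<in> V \<Longrightarrow> \<phi> (gen v) = monomial_fun K (Var v)"
proof -
  let ?\<pi> = "\<lambda>f t. if t \<in> T then comb_coeff K t f else \<zero>"
  have h0: "lie_hom K (free_algebra K V) model ?\<pi>" by (rule comb_coeff_hom[OF T_closed])
  note hom0 = lie_homD[OF h0]
  have g0: "?\<pi> (free_algebra_gen K v) = monomial_fun K (Var v)" if v: "v \<in> V" for v
  proof
    fix t
    have z: "comb_coeff K s (\<lambda>x. free_algebra_gen K v (Prod x u)) = \<zero>"
      "comb_coeff K s (\<lambda>x. free_algebra_gen K v (Prod u x)) = \<zero>" for s u :: "'v monomial"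
      using comb_coeff_smult[of "\<lambda>_. \<zero>" \<zero> s] comb_coeff_closed[of "\<lambda>_. \<zero>" s]
      by (simp_all add: free_algebra_gen_def image_subset_iff)
    show "?\<pi> (free_algebra_gen K v) t = monomial_fun K (Var v) t"
      using Var_in_T[OF v]
      by (cases t) (auto simp: z monomial_fun_def a_minus_def, simp_all add: free_algebra_gen_def)
  qed
  have rel: "?\<pi> x = \<zero>\<^bsub>model\<^esub>" if "x \<in> lie_relations (free_algebra K V)" for x
    using that unfolding lie_relations_def
    by (auto simp: hom0(2,4) F.br_closed hom0(1) model.bracket_self model.jacobi)
  obtain \<phi>1 where h1: "lie_hom K (free_lie K V) model \<phi>1"
    and e1: "\<And>x. x \<in> carrier (free_algebra K V) \<Longrightarrow> \<phi>1 (free_lie_ideal K V +>\<^bsub>free_algebra K V\<^esub> x) = ?\<pi> x"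
    unfolding free_lie_def
    by (rule F.quot_factor[OF h0 model.bilinear_algebra_axioms])
      (use F.ideal_generated_vanish[OF h0 model.bilinear_algebra_axioms lie_relations_closed rel]
        in \<open>auto simp: free_lie_ideal_def\<close>)
  obtain \<phi>2 where h2: "lie_hom K (free_nilpotent K k V) model \<phi>2"
    and e2: "\<And>x. x \<in> carrier (free_lie K V) \<Longrightarrow>
      \<phi>2 (lcs K (free_lie K V) (k + 1) +>\<^bsub>free_lie K V\<^esub> x) = \<phi>1 x"
    unfolding free_nilpotent_def
    by (rule FL.quot_factor[OF h1 model.bilinear_algebra_axioms])
      (use model_nilpotent lie_hom_lcs[OF h1 FL.lie_algebra_axioms model.lie_algebra_axioms] in auto)
  have g2: "\<phi>2 (free_nilpotent_gen K k V v) = monomial_fun K (Var v)" if "v \<in> V" for v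
    unfolding free_nilpotent_gen_def
    using e2[OF free_lie_gen_closed[OF that]] e1[OF free_algebra_gen_closed[OF that]] g0[OF that]
    by (simp add: free_lie_gen_def)
  have van: "\<phi>2 x = \<zero>\<^bsub>model\<^esub>" if x: "x \<in> nonedge_brackets" for x
  proof -
    obtain u v where uv: "u \<in> V" "v \<in> V" "(u, v) \<notin> E" "(v, u) \<notin> E"
      "x = \<lbrakk>free_nilpotent_gen K k V u, free_nilpotent_gen K k V v\<rbrakk>\<^bsub>free_nilpotent K k V\<^esub>"
      using x unfolding nonedge_brackets_def by blast
    have "Prod (Var a) (Var b) \<notin> T" if "(a, b) \<notin> E" for a b :: 'v
    proof
      assume "Prod (Var a) (Var b) \<in> T"
      then obtain i j n where "(i, j) \<in> E" "Var a = comb i j n" "Var b = Var j" by (rule Prod_in_T)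
      then show False using that by (cases n) auto
    qed
    then show ?thesis
      using uv model.b_bracket(2)[OF Var_in_T[OF uv(1)] Var_in_T[OF uv(2)]]
        lie_homD(4)[OF h2 free_nilpotent_gen_closed[OF uv(1)] free_nilpotent_gen_closed[OF uv(2)]]
      by (simp add: g2)
  qed
  obtain \<phi>3 where h3: "lie_hom K graph_alg model \<phi>3"
    and e3: "\<And>x. x \<in> carrier (free_nilpotent K k V) \<Longrightarrow>
      \<phi>3 (graph_ideal K k V E +>\<^bsub>free_nilpotent K k V\<^esub> x) = \<phi>2 x"
    unfolding graph_lie_def
    by (rule N.quot_factor[OF h2 model.bilinear_algebra_axioms])
      (use N.ideal_generated_vanish[OF h2 model.bilinear_algebra_axioms nonedge_brackets_closed van]
        in \<open>auto simp: graph_ideal_eq\<close>)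
  show thesis
    using that[OF h3] e3[OF free_nilpotent_gen_closed] g2 by (simp add: graph_gen_def)
qed

section \<open>The chain ideal as a kernel\<close>

abbreviation "model_eval \<equiv> eval_monomial model (\<lambda>v. monomial_fun K (Var v))"
abbreviation "graph_eval \<equiv> eval_monomial graph_alg gen"

definition edge_degs :: "'v \<Rightarrow> 'v \<Rightarrow> nat \<Rightarrow> ('v \<Rightarrow> nat) set" where
  "edge_degs i j c =
     {unit_deg j} \<union> {(\<lambda>u. unit_deg i u + (l - 1) * unit_deg j u) |l. 1 \<le> l \<and> l \<le> c}"

lemma model_eval_closed: "vars t \<subseteq> V \<Longrightarrow> model_eval t \<in> carrier model"
  by (rule model.eval_monomial_closed) (auto intro!: monomial_fun_comb_algebra Var_in_T)

lemma graph_eval_closed: "vars t \<subseteq> V \<Longrightarrow> graph_eval t \<in> carrier graph_alg"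
  by (rule G.eval_monomial_closed) (auto intro: gen_closed)

lemma model_eval_T: "t \<in> T \<Longrightarrow> model_eval t = monomial_fun K t"
proof (induction t)
  case (Prod s u)
  have "s \<in> T" "u \<in> T" using Prod.prems T_closed unfolding comb_closed_def by blast+
  then show ?case using Prod model.b_bracket(1) by simp
qed simp

text \<open>
  Both terms of a bracket at \<open>Prod p q\<close> pair a value at \<open>p\<close> with a value at \<open>q\<close>, and
  multidegrees add.
\<close>
lemma model_eval_homogeneous:
  "vars t \<subseteq> V \<Longrightarrow> model_eval t s \<noteq> \<zero> \<Longrightarrow> multideg s = multideg t"
proof (induction t arbitrary: s)
  case (Var v)
  then show ?case by (auto simp: monomial_fun_def split: if_splits)
next
  case (Prod t1 t2)
  have v: "vars t1 \<subseteq> V" "vars t2 \<subseteq> V" using Prod.prems by auto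
  note c = model_eval_closed[OF v(1)] model_eval_closed[OF v(2)]
  note cc = model.\<phi>_closed[OF c(1)] model.\<phi>_closed[OF c(2)]
  have "s \<in> T" using Prod.prems(2) model.\<phi>_outside[OF model_eval_closed[OF Prod.prems(1)]] by blast
  moreover obtain p q where s: "s = Prod p q"
    using Prod.prems(2) model.\<phi>_bracket(1)[OF c] by (cases s) auto
  ultimately have "model_eval t1 p \<otimes> model_eval t2 q \<ominus> model_eval t1 q \<otimes> model_eval t2 p \<noteq> \<zero>"
    using Prod.prems(2) model.\<phi>_bracket(2)[OF c] by simp
  then have "model_eval t1 p \<otimes> model_eval t2 q \<noteq> \<zero> \<or> model_eval t1 q \<otimes> model_eval t2 p \<noteq> \<zero>"
    by (auto simp: a_minus_def)
  then have "model_eval t1 p \<noteq> \<zero> \<and> model_eval t2 q \<noteq> \<zero> \<or> model_eval t1 q \<noteq> \<zero> \<and> model_eval t2 p \<noteq> \<zero>"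
    using cc by (metis l_null r_null)
  then show ?case using Prod.IH v s by (auto simp: fun_eq_iff add.commute)
qed

lemma multideg_in_multidegs: "vars t \<subseteq> V \<Longrightarrow> multideg t \<in> multidegs V"
  by (auto simp: multidegs_def multideg_eq_0_iff)

lemma multi_component_closed:
  assumes "d \<in> multidegs V"
  shows "multi_component K k V E d \<subseteq> carrier graph_alg"
  unfolding multi_component_def
  by (rule G.lspan_least[OF _ G.subspace_carrier]) (auto intro: graph_eval_closed)

lemma sum_components_subspace:
  "D \<subseteq> multidegs V \<Longrightarrow> subspace K (sum_components K k V E D) graph_alg"
  unfolding sum_components_def using multi_component_closed by (intro G.lspan_subspace) auto

lemma graph_eval_sum_components:
  assumes "vars t \<subseteq> V" "multideg t \<in> D" "D \<subseteq> multidegs V"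
  shows "graph_eval t \<in> sum_components K k V E D"
proof -
  have "{graph_eval s |s. vars s \<subseteq> V \<and> multideg s = multideg t} \<subseteq> carrier graph_alg"
    by (auto intro: graph_eval_closed)
  from G.lspan_superset[OF this] have "graph_eval t \<in> multi_component K k V E (multideg t)"
    unfolding multi_component_def using assms(1) by blast
  moreover have "(\<Union>d\<in>D. multi_component K k V E d) \<subseteq> carrier graph_alg"
    using multi_component_closed assms(3) by auto
  ultimately show ?thesis
    unfolding sum_components_def using G.lspan_superset assms(2) by blast
qed

lemma chain_ideal_iff:
  "x \<in> chain_ideal K V E \<kappa> \<longleftrightarrow>
    (\<forall>(i, j)\<in>E. x \<in> sum_components K k V E (multidegs V - edge_degs i j (\<kappa> (i, j)))) \<and>
    x \<in> lspan K graph_alg (\<Union>n\<in>{3..k}. total_component K k V E n)"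
  by (auto simp: chain_ideal_def Let_def edge_ideal_def edge_degs_def)

lemma total_component_closed: "total_component K k V E n \<subseteq> carrier graph_alg"
  unfolding total_component_def
  by (rule G.subspaceD(1)[OF sum_components_subspace]) auto

lemma chain_ideal_subspace: "subspace K (chain_ideal K V E \<kappa>) graph_alg"
proof -
  let ?S = "lspan K graph_alg (\<Union>n\<in>{3..k}. total_component K k V E n)"
  let ?D = "\<lambda>(i, j). sum_components K k V E (multidegs V - edge_degs i j (\<kappa> (i, j)))"
  have "chain_ideal K V E \<kappa> = \<Inter>(insert ?S (?D ` E))"
    by (auto simp: chain_ideal_iff)
  moreover have "subspace K ?S graph_alg"
    using total_component_closed by (intro G.lspan_subspace) auto
  moreover have "subspace K (?D e) graph_alg" for e
    by (simp add: sum_components_subspace split: prod.splits)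
  ultimately show ?thesis by (simp only:) (rule G.subspace_Inter, auto)
qed

text \<open>
  A case distinction by weight: in weight 1 and 2 a monomial is zero or a multiple of a comb by the
  relations of the graph algebra, and beyond weight \<open>k\<close> it vanishes.  In between it belongs to the
  chain ideal unless its multidegree is one of those kept for some edge \<open>(i, j)\<close>; then it is linear
  in \<open>v\<^sub>i\<close> and \<open>eval_monomial_comb\<close> applies.
\<close>
lemma graph_eval_cases:
  assumes t: "vars t \<subseteq> V"
  shows "graph_eval t \<in> chain_ideal K V E \<kappa> \<or>
    (\<exists>s\<in>T. \<exists>a\<in>carrier K. graph_eval t = a \<odot>\<^bsub>graph_alg\<^esub> graph_eval s)"
proof -
  have zero: "\<zero>\<^bsub>graph_alg\<^esub> \<in> chain_ideal K V E \<kappa>"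
    using G.subspaceD(2)[OF chain_ideal_subspace] .
  have self: ?thesis if "t \<in> T"
    using that graph_eval_closed[OF t] by (intro disjI2 bexI[of _ t] bexI[of _ "\<one>"]) auto
  consider "leaves t = 1" | "leaves t = 2" | "3 \<le> leaves t" "leaves t \<le> k" | "k < leaves t"
    using leaves_pos[of t] by linarith
  then show ?thesis
  proof cases
    case 1
    then obtain v where "t = Var v" unfolding leaves_1_iff by auto
    then show ?thesis using self Var_in_T t by simp
  next
    case 2
    then obtain s u where su: "t = Prod s u" by (cases t) auto
    then have "leaves s = 1" "leaves u = 1" using 2 leaves_pos[of s] leaves_pos[of u] by auto
    then obtain a b where ab: "t = Prod (Var a) (Var b)" using su unfolding leaves_1_iff by auto
    then have c: "a \<in> V" "b \<in> V" "gen a \<in> carrier graph_alg" "gen b \<in> carrier graph_alg"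
      using t gen_closed by auto
    consider "(a, b) \<in> E" | "(b, a) \<in> E" | "(a, b) \<notin> E" "(b, a) \<notin> E" by blast
    then show ?thesis
    proof cases
      case 1
      then have "comb a b 1 \<in> T" using kappa_ge_2[OF 1] by (intro comb_in_T) auto
      then show ?thesis using self ab by simp
    next
      case 2
      then have "comb b a 1 \<in> T" using kappa_ge_2[OF 2] by (intro comb_in_T) auto
      moreover have "graph_eval t = (\<ominus> \<one>) \<odot>\<^bsub>graph_alg\<^esub> graph_eval (comb b a 1)"
        using c G.bracket_skew[OF c(4,3)] G.smult_minus_1[of "\<lbrakk>gen b, gen a\<rbrakk>\<^bsub>graph_alg\<^esub>"]
        by (simp add: ab G.bracket_closed)
      ultimately show ?thesis by (intro disjI2 bexI[of _ "comb b a 1"] bexI[of _ "\<ominus> \<one>"]) auto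
    next
      case 3
      then show ?thesis using gen_nonedge[OF c(1,2)] zero ab by simp
    qed
  next
    case 3
    show ?thesis
    proof (cases "\<exists>(i, j)\<in>E. \<exists>l. 1 \<le> l \<and> l \<le> \<kappa> (i, j) \<and> multideg t = (\<lambda>u. unit_deg i u + (l - 1) * unit_deg j u)")
      case True
      then obtain i j l where ij: "(i, j) \<in> E" "1 \<le> l" "l \<le> \<kappa> (i, j)"
        "multideg t = (\<lambda>u. unit_deg i u + (l - 1) * unit_deg j u)" by blast
      have ne: "i \<noteq> j" using ij(1) oriented by blast
      have V: "i \<in> V" "j \<in> V" using ij(1) edges by auto
      have vs: "vars t \<subseteq> {i, j}"
      proof
        fix u assume "u \<in> vars t"
        then have "multideg t u \<noteq> 0" by (simp add: multideg_eq_0_iff)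
        then show "u \<in> {i, j}" unfolding ij(4) by (auto simp: unit_deg_def split: if_splits)
      qed
      have "leaves t = (\<Sum>u\<in>{i, j}. multideg t u)" using sum_multideg[OF _ vs] by simp
      also have "\<dots> = l" using ne ij(2) by (simp add: ij(4) unit_deg_def)
      finally have l: "leaves t = l" .
      have "multideg t i = 1" using ne by (simp add: ij(4) unit_deg_def)
      then have "\<exists>a\<in>carrier K. graph_eval t = a \<odot>\<^bsub>graph_alg\<^esub> graph_eval (comb i j (l - 1))"
        using G.eval_monomial_comb[OF ne gen_closed[OF V(1)] gen_closed[OF V(2)] vs] l by simp
      moreover have "comb i j (l - 1) \<in> T" using ij by (intro comb_in_T) auto
      ultimately show ?thesis by blast
    next
      case False
      have deg: "(\<Sum>u\<in>V. multideg t u) = leaves t" by (rule sum_multideg[OF finite_vertices t])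
      have "multideg t \<notin> edge_degs i j (\<kappa> (i, j))" if "(i, j) \<in> E" for i j
      proof -
        have "multideg t \<noteq> unit_deg j"
        proof
          assume "multideg t = unit_deg j"
          then have "(\<Sum>u\<in>V. multideg t u) = (\<Sum>u\<in>V. if u = j then 1 else 0)" by (simp add: unit_deg_def)
          also have "\<dots> \<le> 1" using finite_vertices by simp
          finally show False using deg 3 by simp
        qed
        then show ?thesis using False that unfolding edge_degs_def by blast
      qed
      then have "graph_eval t \<in> sum_components K k V E (multidegs V - edge_degs i j (\<kappa> (i, j)))"
        if "(i, j) \<in> E" for i j
        using that t multideg_in_multidegs[OF t] by (intro graph_eval_sum_components) auto
      moreover have "graph_eval t \<in> total_component K k V E (leaves t)"
        unfolding total_component_def using t multideg_in_multidegs[OF t] deg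
        by (intro graph_eval_sum_components) auto
      then have "graph_eval t \<in> lspan K graph_alg (\<Union>n\<in>{3..k}. total_component K k V E n)"
        using 3 total_component_closed
          G.lspan_superset[of "\<Union>n\<in>{3..k}. total_component K k V E n"] by fastforce
      ultimately show ?thesis unfolding chain_ideal_iff by blast
    qed
  next
    case 4
    then show ?thesis using eval_monomial_nilpotent[OF t] zero by simp
  qed
qed

text \<open>
  From here on \<open>\<phi>\<close> is a homomorphism as provided by \<open>graph_lie_hom_model\<close>.
\<close>
context
  fixes \<phi>
  assumes \<phi>_hom: "lie_hom K graph_alg model \<phi>"
    and \<phi>_gen: "\<And>v. v \<in> V \<Longrightarrow> \<phi> (gen v) = monomial_fun K (Var v)"
begin

lemma \<phi>_eval:
  assumes "vars t \<subseteq> V"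
  shows "\<phi> (graph_eval t) = model_eval t"
proof -
  have "gen ` vars t \<subseteq> carrier graph_alg" using assms gen_closed by auto
  then have "\<phi> (graph_eval t) = eval_monomial model (\<lambda>v. \<phi> (gen v)) t"
    by (rule eval_monomial_hom[OF \<phi>_hom G.bilinear_algebra_axioms])
  also have "\<dots> = model_eval t" using assms \<phi>_gen by (intro eval_monomial_cong) auto
  finally show ?thesis .
qed

lemma support_subspace_graph:
  "subspace K {x \<in> carrier graph_alg. \<forall>t. P t \<longrightarrow> \<phi> x t = \<zero>} graph_alg"
proof -
  have "{x \<in> carrier graph_alg. \<forall>t. P t \<longrightarrow> \<phi> x t = \<zero>} =
      {x \<in> carrier graph_alg. \<phi> x \<in> {f \<in> carrier model. \<forall>t. P t \<longrightarrow> f t = \<zero>}}"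
    using lie_homD(1)[OF \<phi>_hom] by auto
  then show ?thesis
    using G.subspace_vimage[OF \<phi>_hom model.bilinear_algebra_axioms model.support_subspace, of P] by simp
qed

lemma sum_components_support:
  assumes "D \<subseteq> multidegs V" "x \<in> sum_components K k V E D" "multideg t \<notin> D"
  shows "\<phi> x t = \<zero>"
proof -
  have m: "multi_component K k V E d \<subseteq> {x \<in> carrier graph_alg. \<forall>t. multideg t \<notin> D \<longrightarrow> \<phi> x t = \<zero>}"
    if "d \<in> D" for d
    unfolding multi_component_def
  proof (rule G.lspan_least[OF _ support_subspace_graph], safe)
    fix s t assume "vars s \<subseteq> V" "multideg t \<notin> D" "d = multideg s"
    then show "\<phi> (graph_eval s) t = \<zero>"
      using model_eval_homogeneous[of s t] \<phi>_eval[of s] that by metis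
  qed (rule graph_eval_closed)
  have "sum_components K k V E D \<subseteq> {x \<in> carrier graph_alg. \<forall>t. multideg t \<notin> D \<longrightarrow> \<phi> x t = \<zero>}"
    unfolding sum_components_def
    by (rule G.lspan_least[OF _ support_subspace_graph]) (use m in blast)
  then show ?thesis using assms(2,3) by blast
qed

text \<open>
  The function \<open>\<phi> x\<close> is zero at each variable, since \<open>x\<close> has no component of total degree 1, and
  at each longer comb along an edge \<open>(i, j)\<close>, since its multidegree is excluded by the ideal that
  belongs to this edge.
\<close>
lemma \<phi>_chain_ideal:
  assumes "x \<in> chain_ideal K V E \<kappa>"
  shows "\<phi> x = \<zero>\<^bsub>model\<^esub>"
proof (rule model.\<phi>_eqI)
  have x: "x \<in> carrier graph_alg" using assms G.subspaceD(1)[OF chain_ideal_subspace] by auto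
  then show "\<phi> x \<in> carrier model" by (rule lie_homD(1)[OF \<phi>_hom])
  show "\<zero>\<^bsub>model\<^esub> \<in> carrier model" by simp
  fix t assume "t \<in> T"
  have "\<phi> x t = \<zero>"
  proof (rule T_cases[OF \<open>t \<in> T\<close>])
    fix v assume v: "v \<in> V" "t = Var v"
    let ?S = "{x \<in> carrier graph_alg. \<forall>s. s = t \<longrightarrow> \<phi> x s = \<zero>}"
    have "total_component K k V E n \<subseteq> ?S" if "n \<in> {3..k}" for n
    proof
      fix y assume y: "y \<in> total_component K k V E n"
      have "(\<Sum>u\<in>V. multideg t u) = 1" using sum_multideg[OF finite_vertices, of t] v by simp
      then have "\<phi> y t = \<zero>"
        using y that unfolding total_component_def by (intro sum_components_support) auto
      then show "y \<in> ?S" using y total_component_closed by auto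
    qed
    then have "(\<Union>n\<in>{3..k}. total_component K k V E n) \<subseteq> ?S" by (rule UN_least)
    then have "lspan K graph_alg (\<Union>n\<in>{3..k}. total_component K k V E n) \<subseteq> ?S"
      by (rule G.lspan_least[OF _ support_subspace_graph])
    then show ?thesis using assms unfolding chain_ideal_iff by blast
  next
    fix i j n assume ij: "(i, j) \<in> E" "Suc n < \<kappa> (i, j)" "t = comb i j (Suc n)"
    \<comment> \<open>this comb is \<open>w\<^sub>i\<^sub>j\<^sup>l\<close> for \<open>l = n + 2\<close>\<close>
    have "multideg t = (\<lambda>u. unit_deg i u + ((n + 2) - 1) * unit_deg j u)"
      by (simp add: ij(3) multideg_comb del: comb.simps)
    then have "multideg t \<in> edge_degs i j (\<kappa> (i, j))" using ij(2)
      unfolding edge_degs_def by (intro UnI2 CollectI exI[of _ "n + 2"]) simp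
    moreover have "x \<in> sum_components K k V E (multidegs V - edge_degs i j (\<kappa> (i, j)))"
      using assms ij(1) unfolding chain_ideal_iff by blast
    ultimately show ?thesis by (intro sum_components_support) auto
  qed
  then show "\<phi> x t = \<zero>\<^bsub>model\<^esub> t" by (simp add: model.\<phi>_zero)
qed

text \<open>
  A linear section of \<open>\<phi>\<close>.
\<close>
definition lift where
  "lift f = finsum graph_alg (\<lambda>t. f t \<odot>\<^bsub>graph_alg\<^esub> graph_eval t) T"

lemma T_eval_closed: "t \<in> T \<Longrightarrow> graph_eval t \<in> carrier graph_alg"
  by (intro graph_eval_closed vars_T)

lemma lift_closed: "f \<in> carrier model \<Longrightarrow> lift f \<in> carrier graph_alg"
  unfolding lift_def using T_eval_closed model.\<phi>_closed by (intro G.M.finsum_closed) auto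

lemma lift_add:
  assumes "f \<in> carrier model" "h \<in> carrier model"
  shows "lift (f \<oplus>\<^bsub>model\<^esub> h) = lift f \<oplus>\<^bsub>graph_alg\<^esub> lift h"
proof -
  have "lift (f \<oplus>\<^bsub>model\<^esub> h) = finsum graph_alg
      (\<lambda>t. f t \<odot>\<^bsub>graph_alg\<^esub> graph_eval t \<oplus>\<^bsub>graph_alg\<^esub> h t \<odot>\<^bsub>graph_alg\<^esub> graph_eval t) T"
    unfolding lift_def using assms T_eval_closed model.\<phi>_closed
    by (intro G.M.finsum_cong') (auto simp: model.\<phi>_add G.smult_l_distr)
  also have "\<dots> = lift f \<oplus>\<^bsub>graph_alg\<^esub> lift h"
    unfolding lift_def using assms T_eval_closed model.\<phi>_closed by (intro G.M.finsum_addf) auto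
  finally show ?thesis .
qed

lemma lift_smult:
  assumes "a \<in> carrier K" "f \<in> carrier model"
  shows "lift (a \<odot>\<^bsub>model\<^esub> f) = a \<odot>\<^bsub>graph_alg\<^esub> lift f"
proof -
  have "lift (a \<odot>\<^bsub>model\<^esub> f) =
      finsum graph_alg (\<lambda>t. a \<odot>\<^bsub>graph_alg\<^esub> (f t \<odot>\<^bsub>graph_alg\<^esub> graph_eval t)) T"
    unfolding lift_def using assms T_eval_closed model.\<phi>_closed
    by (intro G.M.finsum_cong') (auto simp: model.\<phi>_smult G.smult_assoc1)
  also have "\<dots> = a \<odot>\<^bsub>graph_alg\<^esub> lift f"
    unfolding lift_def using assms T_eval_closed model.\<phi>_closed
    by (intro G.finsum_smult[symmetric]) auto
  finally show ?thesis .
qed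

lemma lift_monomial_fun:
  assumes "t \<in> T"
  shows "lift (monomial_fun K t) = graph_eval t"
proof -
  have "lift (monomial_fun K t) = finsum graph_alg (\<lambda>s. if s = t then graph_eval s else \<zero>\<^bsub>graph_alg\<^esub>) T"
    unfolding lift_def using T_eval_closed
    by (intro G.M.finsum_cong') (auto simp: monomial_fun_def)
  also have "\<dots> = graph_eval t"
    using G.M.add.finprod_singleton_swap[of t T graph_eval] finite_T T_eval_closed assms by auto
  finally show ?thesis .
qed

lemma lift_zero: "lift \<zero>\<^bsub>model\<^esub> = \<zero>\<^bsub>graph_alg\<^esub>"
  unfolding lift_def using T_eval_closed
  by (intro G.M.add.finprod_one_eqI) (simp add: model.\<phi>_zero)

lemma \<phi>_lift:
  assumes "f \<in> carrier model"
  shows "\<phi> (lift f) = f"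
proof -
  have "\<phi> (lift f) = finsum model (\<lambda>t. \<phi> (f t \<odot>\<^bsub>graph_alg\<^esub> graph_eval t)) T"
    unfolding lift_def using assms T_eval_closed model.\<phi>_closed
    by (intro module_hom_finsum[OF lie_homD(5)[OF \<phi>_hom] G.vectorspace_axioms model.vectorspace_axioms]) auto
  also have "\<dots> = finsum model (\<lambda>t. f t \<odot>\<^bsub>model\<^esub> monomial_fun K t) T"
    using assms T_eval_closed model.\<phi>_closed model.b_closed
    by (intro model.M.finsum_cong')
      (auto simp: lie_homD(3)[OF \<phi>_hom] \<phi>_eval[OF vars_T] model_eval_T)
  also have "\<dots> = f" using assms model.\<phi>_outside by (intro model.expansion) auto
  finally show ?thesis .
qed

text \<open>
  The difference is linear in \<open>x\<close> and the chain ideal is a subspace, so it is enough to consider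
  monomials, for which \<open>graph_eval_cases\<close> leaves two cases.
\<close>
lemma minus_lift_in_chain_ideal:
  assumes "x \<in> carrier graph_alg"
  shows "x \<ominus>\<^bsub>graph_alg\<^esub> lift (\<phi> x) \<in> chain_ideal K V E \<kappa>"
proof -
  let ?I = "chain_ideal K V E \<kappa>"
  let ?U = "{x \<in> carrier graph_alg. x \<ominus>\<^bsub>graph_alg\<^esub> lift (\<phi> x) \<in> ?I}"
  note I = G.subspaceD[OF chain_ideal_subspace]
  note hom = lie_homD[OF \<phi>_hom]
  have \<phi>z: "\<phi> \<zero>\<^bsub>graph_alg\<^esub> = \<zero>\<^bsub>model\<^esub>"
    by (rule module_hom_zero[OF hom(5) G.vectorspace_axioms model.vectorspace_axioms])
  have U: "subspace K ?U graph_alg"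
  proof (rule G.subspaceI)
    show "\<zero>\<^bsub>graph_alg\<^esub> \<in> ?U" using I(2) by (simp add: \<phi>z lift_zero G.minus_zero)
  next
    fix x y assume xy: "x \<in> ?U" "y \<in> ?U"
    have "(x \<oplus>\<^bsub>graph_alg\<^esub> y) \<ominus>\<^bsub>graph_alg\<^esub> lift (\<phi> (x \<oplus>\<^bsub>graph_alg\<^esub> y))
      = (x \<ominus>\<^bsub>graph_alg\<^esub> lift (\<phi> x)) \<oplus>\<^bsub>graph_alg\<^esub> (y \<ominus>\<^bsub>graph_alg\<^esub> lift (\<phi> y))"
      using xy hom lift_closed by (simp add: lift_add a_minus_def G.M.minus_add G.M.a_ac)
    then show "x \<oplus>\<^bsub>graph_alg\<^esub> y \<in> ?U" using xy I(3) by simp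
  next
    fix a x assume ax: "a \<in> carrier K" "x \<in> ?U"
    have "(a \<odot>\<^bsub>graph_alg\<^esub> x) \<ominus>\<^bsub>graph_alg\<^esub> lift (\<phi> (a \<odot>\<^bsub>graph_alg\<^esub> x))
      = a \<odot>\<^bsub>graph_alg\<^esub> (x \<ominus>\<^bsub>graph_alg\<^esub> lift (\<phi> x))"
      using ax hom lift_closed by (simp add: lift_smult a_minus_def G.smult_r_distr G.smult_r_minus)
    then show "a \<odot>\<^bsub>graph_alg\<^esub> x \<in> ?U" using ax I(4) by simp
  qed auto
  have UT: "graph_eval t \<in> ?U" if "t \<in> T" for t
    using that T_eval_closed[OF that] I(2)
    by (simp add: \<phi>_eval[OF vars_T] model_eval_T lift_monomial_fun a_minus_def G.M.r_neg)
  have "graph_eval t \<in> ?U" if "vars t \<subseteq> V" for t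
    using graph_eval_cases[OF that]
  proof (elim disjE bexE)
    assume "graph_eval t \<in> ?I"
    then show ?thesis using I(1) by (auto simp: \<phi>_chain_ideal lift_zero G.minus_zero)
  next
    fix s a assume "s \<in> T" "a \<in> carrier K" "graph_eval t = a \<odot>\<^bsub>graph_alg\<^esub> graph_eval s"
    then show ?thesis using G.subspaceD(4)[OF U _ UT] by simp
  qed
  then have "carrier graph_alg \<subseteq> ?U"
    using graph_monomials_span U unfolding monomials_span_def by blast
  then show ?thesis using assms by blast
qed

text \<open>
  If \<open>\<phi> x = 0\<close> then \<open>x\<close> itself is the difference in \<open>minus_lift_in_chain_ideal\<close>.
\<close>
lemma chain_ideal_eq_kernel: "chain_ideal K V E \<kappa> = {x \<in> carrier graph_alg. \<phi> x = \<zero>\<^bsub>model\<^esub>}"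
proof
  show "chain_ideal K V E \<kappa> \<subseteq> {x \<in> carrier graph_alg. \<phi> x = \<zero>\<^bsub>model\<^esub>}"
    using \<phi>_chain_ideal G.subspaceD(1)[OF chain_ideal_subspace] by auto
  show "{x \<in> carrier graph_alg. \<phi> x = \<zero>\<^bsub>model\<^esub>} \<subseteq> chain_ideal K V E \<kappa>"
  proof safe
    fix x assume "x \<in> carrier graph_alg" "\<phi> x = \<zero>\<^bsub>model\<^esub>"
    then show "x \<in> chain_ideal K V E \<kappa>"
      using minus_lift_in_chain_ideal[of x] by (simp add: lift_zero G.minus_zero)
  qed
qed

end

text \<open>
  The map induced by \<open>\<phi>\<close> on the quotient is injective because the chain ideal is the kernel, and
  surjective because \<open>lift\<close> is a section.
\<close>
theorem chain_lie_coordinates: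
  obtains \<phi> where "comb_coordinates K (chain_lie K V E \<kappa>) T \<phi>
    (eval_monomial (chain_lie K V E \<kappa>) (chain_gen K V E \<kappa>))"
proof -
  obtain \<phi> where h: "lie_hom K graph_alg model \<phi>" and g: "\<And>v. v \<in> V \<Longrightarrow> \<phi> (gen v) = monomial_fun K (Var v)"
    using graph_lie_hom_model by blast
  let ?I = "chain_ideal K V E \<kappa>" and ?Q = "chain_lie K V E \<kappa>"
  have ker: "?I = {x \<in> carrier graph_alg. \<phi> x = \<zero>\<^bsub>model\<^esub>}" by (rule chain_ideal_eq_kernel[OF h g])
  have ideal: "lie_ideal K graph_alg ?I"
    unfolding ker by (rule G.lie_ideal_kernel[OF h model.bilinear_algebra_axioms])
  interpret GI: bilinear_algebra_ideal K graph_alg ?I by unfold_locales (rule ideal)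
  interpret Q: lie_algebra K ?Q
    unfolding chain_lie_def by (rule G.quot_lie_algebra[OF ideal])
  obtain \<psi> where \<psi>: "lie_hom K ?Q model \<psi>" "\<And>x. x \<in> carrier graph_alg \<Longrightarrow> \<psi> (?I +>\<^bsub>graph_alg\<^esub> x) = \<phi> x"
    unfolding chain_lie_def by (rule GI.quot_factor[OF h model.bilinear_algebra_axioms]) (use ker in auto)
  have carrier: "carrier ?Q = (\<lambda>x. ?I +>\<^bsub>graph_alg\<^esub> x) ` carrier graph_alg"
    unfolding chain_lie_def by (rule GI.carrier_quot)
  have "bij_betw \<psi> (carrier ?Q) (carrier model)"
  proof (rule bij_betw_imageI)
    show "inj_on \<psi> (carrier ?Q)"
    proof (rule inj_onI)
      fix X Y assume "X \<in> carrier ?Q" "Y \<in> carrier ?Q" and e: "\<psi> X = \<psi> Y"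
      then obtain x y where xy: "x \<in> carrier graph_alg" "y \<in> carrier graph_alg"
        "X = ?I +>\<^bsub>graph_alg\<^esub> x" "Y = ?I +>\<^bsub>graph_alg\<^esub> y" unfolding carrier by blast
      then have "\<phi> x = \<phi> y" using e \<psi>(2) by simp
      then have "\<phi> (x \<ominus>\<^bsub>graph_alg\<^esub> y) = \<zero>\<^bsub>model\<^esub>"
        using xy lie_homD(1)[OF h] module_hom_minus[OF lie_homD(5)[OF h] G.vectorspace_axioms model.vectorspace_axioms]
        by (simp add: a_minus_def model.M.r_neg)
      then show "X = Y" unfolding xy(3,4)
        using xy(1,2) by (subst G.coset_eq_iff[OF GI.ideal_subspace]) (auto simp: ker)
    qed
    have "f \<in> \<psi> ` carrier ?Q" if f: "f \<in> carrier model" for f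
    proof -
      have "\<psi> (?I +>\<^bsub>graph_alg\<^esub> lift f) = f"
        using \<psi>(2)[OF lift_closed[OF h g f]] \<phi>_lift[OF h g f] by simp
      moreover have "?I +>\<^bsub>graph_alg\<^esub> lift f \<in> carrier ?Q"
        unfolding carrier using lift_closed[OF h g f] by blast
      ultimately show ?thesis by (metis imageI)
    qed
    then show "\<psi> ` carrier ?Q = carrier model" using lie_homD(1)[OF \<psi>(1)] by blast
  qed
  moreover have eval: "eval_monomial ?Q (chain_gen K V E \<kappa>) t = ?I +>\<^bsub>graph_alg\<^esub> graph_eval t"
    if "vars t \<subseteq> V" for t
  proof -
    have "gen ` vars t \<subseteq> carrier graph_alg" using that gen_closed by auto
    from eval_monomial_hom[OF GI.quot_hom G.bilinear_algebra_axioms this] show ?thesis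
      by (simp add: chain_lie_def chain_gen_def[abs_def])
  qed
  ultimately have "comb_coordinates K ?Q T \<psi> (eval_monomial ?Q (chain_gen K V E \<kappa>))"
    using T_closed finite_T T_antisym \<psi>(1)
  proof unfold_locales
    fix t assume t: "t \<in> T"
    show "eval_monomial ?Q (chain_gen K V E \<kappa>) t \<in> carrier ?Q"
      unfolding eval[OF vars_T[OF t]] carrier using graph_eval_closed[OF vars_T[OF t]] by blast
    show "\<psi> (eval_monomial ?Q (chain_gen K V E \<kappa>) t) = monomial_fun K t"
      unfolding eval[OF vars_T[OF t]]
      using \<psi>(2)[OF graph_eval_closed[OF vars_T[OF t]]] \<phi>_eval[OF h g vars_T[OF t]] model_eval_T[OF t] by simp
  qed auto
  then show thesis by (rule that)
qed

section \<open>The structure of the chain algebra\<close>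

abbreviation "chain_eval \<equiv> eval_monomial (chain_lie K V E \<kappa>) (chain_gen K V E \<kappa>)"

lemma chain_word_eq: "chain_word K V E \<kappa> i j (Suc n) = chain_eval (comb i j n)"
  unfolding chain_word_def by (rule iter_bracket_comb)

lemma chain_basis_eq:
  assumes "1 \<le> l"
  shows "chain_basis K V E \<kappa> l = chain_eval ` {t \<in> T. leaves t = l}"
proof (cases "l = 1")
  case True
  have "{t \<in> T. leaves t = 1} = Var ` V"
    by (auto simp: Var_in_T elim!: T_cases)
  then show ?thesis using True by (simp add: chain_basis_def image_image)
next
  case False
  then obtain n where n: "l = Suc (Suc n)" using assms by (metis One_nat_def Suc_le_D not0_implies_Suc)
  have "{t \<in> T. leaves t = l} = {comb i j (Suc n) |i j. (i, j) \<in> E \<and> l \<le> \<kappa> (i, j)}"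
    (is "_ = ?R")
  proof (intro equalityI subsetI)
    fix t assume "t \<in> {t \<in> T. leaves t = l}"
    then have t: "t \<in> T" "leaves t = Suc (Suc n)" using n by auto
    from t(1) show "t \<in> ?R"
    proof (rule T_cases)
      fix i j m assume m: "(i, j) \<in> E" "Suc m < \<kappa> (i, j)" "t = comb i j (Suc m)"
      then have "m = n" using t(2) by (simp only: leaves_comb nat.inject)
      then show ?thesis using m n by (auto simp: Suc_le_eq simp del: comb.simps)
    qed (use t(2) in simp)
  qed (auto simp: n Suc_le_eq comb_in_T simp del: comb.simps)
  then show ?thesis unfolding chain_basis_def n using chain_word_eq[of _ _ "Suc n"]
    by (auto simp del: comb.simps)
qed

lemma chain_basis_union:
  "chain_basis K V E \<kappa> 1 \<union> (\<Union>l\<in>{2..k}. chain_basis K V E \<kappa> l) = chain_eval ` T"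
proof -
  have "T = {t \<in> T. leaves t = 1} \<union> (\<Union>l\<in>{2..k}. {t \<in> T. leaves t = l})"
  proof (intro equalityI subsetI)
    fix t assume t: "t \<in> T"
    have "leaves t = 1 \<or> leaves t \<in> {2..k}" using leaves_T[OF t] leaves_pos[of t] by auto
    then show "t \<in> {t \<in> T. leaves t = 1} \<union> (\<Union>l\<in>{2..k}. {t \<in> T. leaves t = l})" using t by blast
  qed auto
  then have "chain_eval ` T = chain_eval ` {t \<in> T. leaves t = 1}
      \<union> (\<Union>l\<in>{2..k}. chain_eval ` {t \<in> T. leaves t = l})"
    by (metis image_UN image_Un)
  then show ?thesis by (simp add: chain_basis_eq)
qed

end

theorem proposition3p10:
  fixes K :: "('a, 'r) ring_scheme"
    and V :: "'v set" and E :: "('v \<times> 'v) set" and \<kappa> :: "'v \<times> 'v \<Rightarrow> nat"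
    and k :: nat
    and \<gg> :: "('a, ('v monomial \<Rightarrow> 'a) set set set set) bracket_algebra"
    and v :: "'v \<Rightarrow> ('v monomial \<Rightarrow> 'a) set set set set"
    and w :: "'v \<Rightarrow> 'v \<Rightarrow> nat \<Rightarrow> ('v monomial \<Rightarrow> 'a) set set set set"
    and B :: "nat \<Rightarrow> ('v monomial \<Rightarrow> 'a) set set set set set"
  assumes field: "field K"
    and char_0: "\<And>n::nat. 0 < n \<Longrightarrow> [n] \<cdot>\<^bsub>K\<^esub> \<one>\<^bsub>K\<^esub> \<noteq> \<zero>\<^bsub>K\<^esub>"
    and chain_digraph: "chain_digraph V E \<kappa>"
    and nonempty: "E \<noteq> {}"
    and k: "k = chain_step E \<kappa>"
    and \<gg>: "\<gg> = chain_lie K V E \<kappa>"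
    and v: "v = chain_gen K V E \<kappa>"
    and w: "w = chain_word K V E \<kappa>"
    and B: "B = chain_basis K V E \<kappa>"
  shows "lie_algebra K \<gg> \<and> step_nilpotent K \<gg> k
    \<and> (\<comment> \<open>the listed elements form a basis and are pairwise distinct\<close>
       vectorspace.basis K \<gg> (B 1 \<union> (\<Union>l\<in>{2..k}. B l))
       \<and> inj_on v V
       \<and> inj_on (\<lambda>(i, j, l). w i j l) {(i, j, l). (i, j) \<in> E \<and> 2 \<le> l \<and> l \<le> \<kappa> (i, j)}
       \<and> B 1 \<inter> (\<Union>l\<in>{2..k}. B l) = {})
    \<and> (\<forall>i j l. (i, j) \<in> E \<and> 1 \<le> l \<and> l \<le> \<kappa> (i, j) - 1 \<longrightarrow>
         \<lbrakk>w i j l, v j\<rbrakk>\<^bsub>\<gg>\<^esub> = w i j (l + 1) \<and> w i j (l + 1) \<noteq> \<zero>\<^bsub>\<gg>\<^esub>)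
    \<and> (\<forall>x \<in> B 1 \<union> (\<Union>l\<in>{2..k}. B l). \<forall>y \<in> B 1 \<union> (\<Union>l\<in>{2..k}. B l).
         \<not> (\<exists>i j l. (i, j) \<in> E \<and> 1 \<le> l \<and> l \<le> \<kappa> (i, j) - 1 \<and>
              (x = w i j l \<and> y = v j \<or> x = v j \<and> y = w i j l)) \<longrightarrow>
         \<lbrakk>x, y\<rbrakk>\<^bsub>\<gg>\<^esub> = \<zero>\<^bsub>\<gg>\<^esub>)
    \<and> naturally_graded K \<gg>
    \<and> carnot_grading K \<gg> k (\<lambda>l. lspan K \<gg> (B l))"
proof -
  interpret chain_digraph V E \<kappa> by (rule chain_digraph)
  interpret field K by (rule field)
  interpret A: chain_digraph_algebra V E \<kappa> K by unfold_locales (rule nonempty)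
  let ?b = "eval_monomial \<gg> v" and ?T = "comb_monomials V E \<kappa>"
  obtain \<phi> where "comb_coordinates K \<gg> ?T \<phi> ?b"
    unfolding \<gg> v by (rule A.chain_lie_coordinates)
  then interpret C: comb_coordinates K \<gg> ?T \<phi> ?b .
  have w_eq: "w i j (Suc n) = ?b (comb i j n)" for i j n
    unfolding w \<gg> v by (rule A.chain_word_eq)
  have v_eq: "v u = ?b (Var u)" for u by simp
  have B_eq: "B l = ?b ` {t \<in> ?T. leaves t = l}" if "1 \<le> l" for l
    unfolding B \<gg> v by (rule A.chain_basis_eq[OF that])
  have B_union: "B 1 \<union> (\<Union>l\<in>{2..k}. B l) = ?b ` ?T"
    unfolding B \<gg> v k by (rule A.chain_basis_union)
  have k1: "1 \<le> k" using A.k_ge_2 unfolding k by simp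
  obtain t where t: "t \<in> ?T" "leaves t = k"
  proof -
    obtain i j where ij: "(i, j) \<in> E" "\<kappa> (i, j) = k" using A.kappa_attained unfolding k by auto
    then have "comb i j (k - 1) \<in> ?T" using k1 by (intro A.comb_in_T) auto
    then show thesis using that[of "comb i j (k - 1)"] k1 by simp
  qed
  have carnot: "carnot_grading K \<gg> k (\<lambda>l. lspan K \<gg> (B l))"
    by (rule C.carnot_grading_coordinates) (use A.leaves_T B_eq in \<open>auto simp: k\<close>)
  have nil: "step_nilpotent K \<gg> k"
    by (rule C.step_nilpotent_coordinates[OF k1 _ t]) (simp add: k A.leaves_T)
  have inj_v: "inj_on v V"
  proof (rule inj_onI)
    fix a c assume ac: "a \<in> V" "c \<in> V" "v a = v c"
    then have "?b (Var a) = ?b (Var c)" by simp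
    from inj_onD[OF C.b_inj this] show "a = c" using ac A.Var_in_T by simp
  qed
  have inj_w: "inj_on (\<lambda>(i, j, l). w i j l) {(i, j, l). (i, j) \<in> E \<and> 2 \<le> l \<and> l \<le> \<kappa> (i, j)}"
  proof (intro inj_onI, clarsimp simp only: mem_Collect_eq case_prod_conv prod.inject)
    fix i j l i' j' l'
    assume *: "(i, j) \<in> E" "2 \<le> l" "l \<le> \<kappa> (i, j)" "(i', j') \<in> E" "2 \<le> l'" "l' \<le> \<kappa> (i', j')"
      "w i j l = w i' j' l'"
    obtain n n' where n: "l = Suc (Suc n)" and n': "l' = Suc (Suc n')"
      using le_Suc_ex[OF *(2)] le_Suc_ex[OF *(5)] by auto
    have "?b (comb i j (Suc n)) = ?b (comb i' j' (Suc n'))" using *(7) unfolding n n' w_eq .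
    from inj_onD[OF C.b_inj this] have "comb i j (Suc n) = comb i' j' (Suc n')"
      using * n n' by (simp add: A.comb_in_T del: comb.simps)
    then show "i = i' \<and> j = j' \<and> l = l'" unfolding comb_inject n n' by simp
  qed
  have disj: "B 1 \<inter> (\<Union>l\<in>{2..k}. B l) = {}"
  proof -
    have "B 1 \<inter> B l = {}" if "l \<in> {2..k}" for l
    proof -
      have "?b ` {t \<in> ?T. leaves t = 1} \<inter> ?b ` {t \<in> ?T. leaves t = l}
          = ?b ` ({t \<in> ?T. leaves t = 1} \<inter> {t \<in> ?T. leaves t = l})"
        by (rule inj_on_image_Int[symmetric, OF C.b_inj]) auto
      also have "\<dots> = {}" using that by auto
      finally show ?thesis using that B_eq[of 1] B_eq[of l] by simp
    qed
    then show ?thesis by blast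
  qed
  have nonzero_brackets: "\<lbrakk>w i j l, v j\<rbrakk>\<^bsub>\<gg>\<^esub> = w i j (l + 1) \<and> w i j (l + 1) \<noteq> \<zero>\<^bsub>\<gg>\<^esub>"
    if ij: "(i, j) \<in> E" "1 \<le> l" "l \<le> \<kappa> (i, j) - 1" for i j l
  proof -
    obtain n where n: "l = Suc n" using ij(2) by (cases l) auto
    have "comb i j (Suc n) \<in> ?T" "comb i j n \<in> ?T" "Var j \<in> ?T"
      using ij n edges by (auto intro!: A.comb_in_T A.Var_in_T simp del: comb.simps)
    then show ?thesis
      using C.b_bracket(1)[of "comb i j n" "Var j"] C.b_nonzero[of "comb i j (Suc n)"]
      by (simp add: n w_eq)
  qed
  have zero_brackets: "\<lbrakk>x, y\<rbrakk>\<^bsub>\<gg>\<^esub> = \<zero>\<^bsub>\<gg>\<^esub>"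
    if xy: "x \<in> B 1 \<union> (\<Union>l\<in>{2..k}. B l)" "y \<in> B 1 \<union> (\<Union>l\<in>{2..k}. B l)"
      and none: "\<not> (\<exists>i j l. (i, j) \<in> E \<and> 1 \<le> l \<and> l \<le> \<kappa> (i, j) - 1 \<and>
              (x = w i j l \<and> y = v j \<or> x = v j \<and> y = w i j l))" for x y
  proof -
    obtain s u where su: "s \<in> ?T" "u \<in> ?T" "x = ?b s" "y = ?b u"
      using xy unfolding B_union by blast
    \<comment> \<open>a pair of combs whose product is again a comb is one of the pairs excluded by \<open>none\<close>\<close>
    have edge: "\<exists>i j l. (i, j) \<in> E \<and> 1 \<le> l \<and> l \<le> \<kappa> (i, j) - 1 \<and> ?b p = w i j l \<and> ?b q = v j"
      if "Prod p q \<in> ?T" for p q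
    proof -
      obtain i j n where "(i, j) \<in> E" "Suc n < \<kappa> (i, j)" "p = comb i j n" "q = Var j"
        using \<open>Prod p q \<in> ?T\<close> by (rule A.Prod_in_T)
      then show ?thesis by (intro exI[of _ i] exI[of _ j] exI[of _ "Suc n"]) (simp add: w_eq)
    qed
    have "Prod s u \<notin> ?T" "Prod u s \<notin> ?T" using edge none su by blast+
    then show ?thesis using C.b_bracket(2)[OF su(1,2)] su by simp
  qed
  have basis: "vectorspace.basis K \<gg> (B 1 \<union> (\<Union>l\<in>{2..k}. B l))"
    unfolding B_union by (rule C.basis_b)
  have nonzero: "\<forall>i j l. (i, j) \<in> E \<and> 1 \<le> l \<and> l \<le> \<kappa> (i, j) - 1 \<longrightarrow>
      \<lbrakk>w i j l, v j\<rbrakk>\<^bsub>\<gg>\<^esub> = w i j (l + 1) \<and> w i j (l + 1) \<noteq> \<zero>\<^bsub>\<gg>\<^esub>"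
    by (intro allI impI, elim conjE) (rule nonzero_brackets)
  have zero: "\<forall>x \<in> B 1 \<union> (\<Union>l\<in>{2..k}. B l). \<forall>y \<in> B 1 \<union> (\<Union>l\<in>{2..k}. B l).
      \<not> (\<exists>i j l. (i, j) \<in> E \<and> 1 \<le> l \<and> l \<le> \<kappa> (i, j) - 1 \<and>
           (x = w i j l \<and> y = v j \<or> x = v j \<and> y = w i j l)) \<longrightarrow>
      \<lbrakk>x, y\<rbrakk>\<^bsub>\<gg>\<^esub> = \<zero>\<^bsub>\<gg>\<^esub>"
    by (intro ballI impI) (rule zero_brackets)
  show ?thesis
    by (intro conjI C.lie_algebra_axioms nil basis inj_v inj_w disj nonzero zero
        C.carnot_grading_naturally_graded[OF carnot] carnot)
qed

end
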